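(* Consider the setting, the primal inclusion (P), the dual inclusion (D), the parameter assumptions, and the iteration (Algorithm A) described in the context, and suppose that the dual inclusion (D) has a solution. Let $(\boldsymbol{x}_n)_{n\in\mathbb N}$, $(\boldsymbol{y}_n)_{n\in\mathbb N}$, $(\boldsymbol{z}_n)_{n\in\mathbb N}$, $(\boldsymbol{v}_n^* )_{n\in\mathbb N}$, $(a_{i,n})$, $(b_{k,n})$, $(d_{k,n})$, $(e^*_{k,n})$ be the sequences generated by Algorithm A. Then the following hold: (i) For every $i\in I$, $\sum_{n\in\mathbb N}\|x_{i,n+1}-x_{i,n}\|^2<+\infty$. (ii) For every $k\in K$, $\sum_{n\in\mathbb N}\|y_{k,n+1}-y_{k,n}\|^2<+\infty$, $\sum_{n\in\mathbb N}\|z_{k,n+1}-z_{k,n}\|^2<+\infty$, and $\sum_{n\in\mathbb N}\|v_{k,n+1}^*-v_{k,n}^*\|^2<+\infty$. (iii) For every $i\in I$ and every $k\in K$, $x_{i,n}-a_{i,n}\to 0$, $y_{k,n}-b_{k,n}\to 0$, $z_{k,n}-d_{k,n}\to 0$, and $v_{k,n}^*-e_{k,n}^*\to 0$ (strongly). (iv) There exist a solution $\overline{\boldsymbol{x}}$ to (P) and a solution $\overline{\boldsymbol{v}}^*$ to (D) such that, for every $i\in I$ and every $k\in K$, $x_{i,n}\rightharpoonup\overline{x}_i$, $a_{i,n}\rightharpoonup\overline{x}_i$, and $v_{k,n}^*\rightharpoonup\overline{v}_k^*$ (weak convergence). In addition, $(\overline{\boldsymbol{x}},\overline{\boldsymbol{v}}^*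 )$ belongs to the Kuhn--Tucker set $\mathsf{Z}$.
   Context: Notation. $\langle\cdot\mid\cdot\rangle$ is the scalar product and $\|\cdot\|$ the norm of a real Hilbert space. For a set-valued operator $A\colon\mathcal K\to 2^{\mathcal K}$, $A^{-1}$ is the set-valued inverse and $J_A=(\mathrm{Id}+A)^{-1}$ is the resolvent (single-valued with full domain if $A$ is maximally monotone). The parallel sum of $B,D\colon\mathcal K\to 2^{\mathcal K}$ is $B\,\square\,D=(B^{-1}+D^{-1})^{-1}$. $C\colon\mathcal K\to\mathcal K$ is cocoercive with constant $\alpha>0$ if $\langle x-y\mid Cx-Cy\rangle\geq\alpha\|Cx-Cy\|^2$ for all $x,y$. $\mathbb N=\{0,1,2,\dots\}$. Bold letters denote product space elements, e.g. $\boldsymbol{x}_n=(x_{i,n})_{i\in I}$. Setting. $(\mathcal H_i)_{i\in I}$ and $(\mathcal G_k)_{k\in K}$ are finite families of real Hilbert spaces, with Hilbert direct sums $\boldsymbol{\mathcal H}=\bigoplus_{i\in I}\mathcal H_i$ and $\boldsymbol{\mathcal G}=\bigoplus_{k\in K}\mathcal G_k$. For every $i\in I$ and $k\in K$, $s_i^*\in\mathcal H_i$, $r_k\in\mathcal G_k$, and: [a] $A_i\colon\mathcal H_i\to 2^{\mathcal H_i}$ is maximally monotone, $C_i\colon\mathcal H_i\to\mathcal H_i$ is cocoercive with constant $\alpha_i^{\rm c}\in(0,+\infty)$, $Q_i\colon\mathcal H_i\to\mathcal H_i$ is monotone and Lipschitzian with constant $\alpha_i^{\rm l}\in[0,+\infty)$,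 and $R_i\colon\boldsymbol{\mathcal H}\to\mathcal H_i$. [b] $B_k^{\rm m}\colon\mathcal G_k\to 2^{\mathcal G_k}$ is maximally monotone, $B_k^{\rm c}\colon\mathcal G_k\to\mathcal G_k$ is cocoercive with constant $\beta_k^{\rm c}\in(0,+\infty)$, $B_k^{\rm l}\colon\mathcal G_k\to\mathcal G_k$ is monotone and Lipschitzian with constant $\beta_k^{\rm l}\in[0,+\infty)$. [c] $D_k^{\rm m}\colon\mathcal G_k\to 2^{\mathcal G_k}$ is maximally monotone, $D_k^{\rm c}\colon\mathcal G_k\to\mathcal G_k$ is cocoercive with constant $\delta_k^{\rm c}\in(0,+\infty)$, $D_k^{\rm l}\colon\mathcal G_k\to\mathcal G_k$ is monotone and Lipschitzian with constant $\delta_k^{\rm l}\in[0,+\infty)$. [d] $L_{ki}\colon\mathcal H_i\to\mathcal G_k$ is linear and bounded. [e] $\boldsymbol R\colon\boldsymbol{\mathcal H}\to\boldsymbol{\mathcal H}\colon\boldsymbol x\mapsto(R_i\boldsymbol x)_{i\in I}$ is monotone and Lipschitzian with constant $\chi\in[0,+\infty)$. (P): find $\overline{\boldsymbol x}\in\boldsymbol{\mathcal H}$ such that, for every $i\in I$, $$s_i^*\in A_i\overline x_i+C_i\overline x_i+Q_i\overline x_i+R_i\overline{\boldsymbol x}+\sum_{k\in K}L_{ki}^*\Big(\big((B_k^{\rm m}+B_k^{\rm c}+B_k^{\rm l})\,\square\,(D_k^{\rm m}+D_k^{\rm c}+D_k^{\rm l})\big)\Big(\sum_{j\in I}L_{kj}\overline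 x_j-r_k\Big)\Big).$$ (D): find $\overline{\boldsymbol v}^*\in\boldsymbol{\mathcal G}$ such that there exists $\boldsymbol x\in\boldsymbol{\mathcal H}$ with, for all $i\in I$, $k\in K$, $$s_i^*-\sum_{j\in K}L_{ji}^*\overline v_j^*\in A_ix_i+C_ix_i+Q_ix_i+R_i\boldsymbol x,\qquad \overline v_k^*\in\big((B_k^{\rm m}+B_k^{\rm c}+B_k^{\rm l})\,\square\,(D_k^{\rm m}+D_k^{\rm c}+D_k^{\rm l})\big)\Big(\sum_{j\in I}L_{kj}x_j-r_k\Big).$$ Kuhn--Tucker set: $\mathsf Z$ is the set of $(\overline{\boldsymbol x},\overline{\boldsymbol v}^* )\in\boldsymbol{\mathcal H}\oplus\boldsymbol{\mathcal G}$ such that, for all $i\in I$, $k\in K$, $s_i^*-\sum_{j\in K}L_{ji}^*\overline v_j^*\in A_i\overline x_i+C_i\overline x_i+Q_i\overline x_i+R_i\overline{\boldsymbol x}$ and $\sum_{j\in I}L_{kj}\overline x_j-r_k\in(B_k^{\rm m}+B_k^{\rm c}+B_k^{\rm l})^{-1}\overline v_k^*+(D_k^{\rm m}+D_k^{\rm c}+D_k^{\rm l})^{-1}\overline v_k^*$. Parameter assumptions. Set $\alpha=\min\{\alpha_i^{\rm c},\beta_k^{\rm c},\delta_k^{\rm c}\}_{i\in I,k\in K}$; $\sigma\in(0,+\infty)$ and $\varepsilon\in(0,1)$ satisfy $\sigma>1/(4\alpha)$ and $1/\varepsilon>\max\{\alpha_i^{\rm l}+\chi+\sigma,\ \beta_k^{\rm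 l}+\sigma,\ \delta_k^{\rm l}+\sigma\}_{i\in I,k\in K}$. For all $i\in I$, $k\in K$, $n\in\mathbb N$: $\gamma_{i,n}\in[\varepsilon,1/(\alpha_i^{\rm l}+\chi+\sigma)]$, $\mu_{k,n}\in[\varepsilon,1/(\beta_k^{\rm l}+\sigma)]$, $\nu_{k,n}\in[\varepsilon,1/(\delta_k^{\rm l}+\sigma)]$, $\sigma_{k,n}\in[\varepsilon,1/\varepsilon]$, $\lambda_n\in[\varepsilon,2-\varepsilon]$; $x_{i,0}\in\mathcal H_i$ and $y_{k,0},z_{k,0},v_{k,0}^*\in\mathcal G_k$. Block selection: $P\in\mathbb N$; $(I_n)_{n\in\mathbb N}$ are nonempty subsets of $I$ and $(K_n)_{n\in\mathbb N}$ nonempty subsets of $K$ with $I_0=I$, $K_0=K$, and, for every $n$, $\bigcup_{j=n}^{n+P}I_j=I$ and $\bigcup_{j=n}^{n+P}K_j=K$. Delays: $T\in\mathbb N$; for all $i\in I$, $k\in K$, $(\pi_i(n))_{n\in\mathbb N}$ and $(\omega_k(n))_{n\in\mathbb N}$ are sequences in $\mathbb N$ with $n-T\le\pi_i(n)\le n$ and $n-T\le\omega_k(n)\le n$ for every $n$. Algorithm A. For $n=0,1,\dots$: 1. For every $i\in I_n$, writing $\pi=\pi_i(n)$: $l_{i,n}^*=Q_ix_{i,\pi}+R_i\boldsymbol x_{\pi}+\sum_{k\in K}L_{ki}^*v_{k,\pi}^*$; $a_{i,n}=J_{\gamma_{i,\pi}A_i}\big(x_{i,\pi}+\gamma_{i,\pi}(s_i^*-l_{i,n}^*-C_ix_{i,\pi})\big)$;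 $a_{i,n}^*=\gamma_{i,\pi}^{-1}(x_{i,\pi}-a_{i,n})-l_{i,n}^*+Q_ia_{i,n}$; $\xi_{i,n}=\|a_{i,n}-x_{i,\pi}\|^2$. 2. For every $i\in I\smallsetminus I_n$: $a_{i,n}=a_{i,n-1}$, $a_{i,n}^*=a_{i,n-1}^*$, $\xi_{i,n}=\xi_{i,n-1}$. 3. For every $k\in K_n$, writing $\omega=\omega_k(n)$: $u_{k,n}^*=v_{k,\omega}^*-B_k^{\rm l}y_{k,\omega}$; $w_{k,n}^*=v_{k,\omega}^*-D_k^{\rm l}z_{k,\omega}$; $b_{k,n}=J_{\mu_{k,\omega}B_k^{\rm m}}\big(y_{k,\omega}+\mu_{k,\omega}(u_{k,n}^*-B_k^{\rm c}y_{k,\omega})\big)$; $d_{k,n}=J_{\nu_{k,\omega}D_k^{\rm m}}\big(z_{k,\omega}+\nu_{k,\omega}(w_{k,n}^*-D_k^{\rm c}z_{k,\omega})\big)$; $e_{k,n}^*=\sigma_{k,\omega}\big(\sum_{i\in I}L_{ki}x_{i,\omega}-y_{k,\omega}-z_{k,\omega}-r_k\big)+v_{k,\omega}^*$; $q_{k,n}^*=\mu_{k,\omega}^{-1}(y_{k,\omega}-b_{k,n})+u_{k,n}^*+B_k^{\rm l}b_{k,n}-e_{k,n}^*$; $t_{k,n}^*=\nu_{k,\omega}^{-1}(z_{k,\omega}-d_{k,n})+w_{k,n}^*+D_k^{\rm l}d_{k,n}-e_{k,n}^*$; $\eta_{k,n}=\|b_{k,n}-y_{k,\omega}\|^2+\|d_{k,n}-z_{k,\omega}\|^2$.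 4. For every $k\in K\smallsetminus K_n$: $b_{k,n},d_{k,n},e_{k,n}^*,q_{k,n}^*,t_{k,n}^*,\eta_{k,n}$ are set equal to their values at index $n-1$. 5. For every $k\in K$: $e_{k,n}=r_k+b_{k,n}+d_{k,n}-\sum_{i\in I}L_{ki}a_{i,n}$. For every $i\in I$: $p_{i,n}^*=a_{i,n}^*+R_i\boldsymbol a_n+\sum_{k\in K}L_{ki}^*e_{k,n}^*$. 6. $\Delta_n=-(4\alpha)^{-1}\big(\sum_{i\in I}\xi_{i,n}+\sum_{k\in K}\eta_{k,n}\big)+\sum_{i\in I}\langle x_{i,n}-a_{i,n}\mid p_{i,n}^*\rangle+\sum_{k\in K}\big(\langle y_{k,n}-b_{k,n}\mid q_{k,n}^*\rangle+\langle z_{k,n}-d_{k,n}\mid t_{k,n}^*\rangle+\langle e_{k,n}\mid v_{k,n}^*-e_{k,n}^*\rangle\big)$. 7. If $\Delta_n>0$: $\theta_n=\lambda_n\Delta_n\big/\big(\sum_{i\in I}\|p_{i,n}^*\|^2+\sum_{k\in K}(\|q_{k,n}^*\|^2+\|t_{k,n}^*\|^2+\|e_{k,n}\|^2)\big)$ and, for all $i\in I$, $k\in K$, $x_{i,n+1}=x_{i,n}-\theta_np_{i,n}^*$, $y_{k,n+1}=y_{k,n}-\theta_nq_{k,n}^*$, $z_{k,n+1}=z_{k,n}-\theta_nt_{k,n}^*$, $v_{k,n+1}^*=v_{k,n}^*-\theta_ne_{k,n}$. Otherwise: $x_{i,n+1}=x_{i,n}$, $y_{k,n+1}=y_{k,n}$,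 $z_{k,n+1}=z_{k,n}$, $v_{k,n+1}^*=v_{k,n}^*$ for all $i\in I$, $k\in K$. *)

theory Defs
  imports "HOL-Analysis.Analysis"
begin

text \<open>
  A real Hilbert space is a complete linear subspace of an ambient inner product space.
  In this way the members of a family \<open>(H i)\<close>, indexed by a finite type, may be pairwise different
  Hilbert spaces; the ambient space itself plays no role. An operator on \<open>U\<close> is
  represented by a HOL function on the ambient type whose values outside \<open>U\<close> are irrelevant.
\<close>

definition hilbert_space :: "'a::real_inner set \<Rightarrow> bool" where
  "hilbert_space U \<longleftrightarrow> subspace U \<and> complete U"

text \<open>
  The inner product of \<open>'a ^ 'i\<close> is the sum of the componentwise inner products, so that
  this set carries the Hilbert direct sum structure.
\<close>

definition direct_sum :: "('i::finite \<Rightarrow> 'a::real_inner set) \<Rightarrow> ('a ^ 'i) set" where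
  "direct_sum H = {x. \<forall>i. x $ i \<in> H i}"

definition weakly_converges_in ::
    "'a::real_inner set \<Rightarrow> (nat \<Rightarrow> 'a) \<Rightarrow> 'a \<Rightarrow> bool" where
  "weakly_converges_in U X l \<longleftrightarrow> (\<forall>u\<in>U. (\<lambda>n. inner (X n) u) \<longlonglongrightarrow> inner l u)"

definition bounded_linear_between ::
    "'a::real_inner set \<Rightarrow> 'b::real_inner set \<Rightarrow> ('a \<Rightarrow> 'b) \<Rightarrow> bool" where
  "bounded_linear_between U V f \<longleftrightarrow> f \<in> U \<rightarrow> V
     \<and> (\<forall>x\<in>U. \<forall>y\<in>U. f (x + y) = f x + f y)
     \<and> (\<forall>c. \<forall>x\<in>U. f (c *\<^sub>R x) = c *\<^sub>R f x)
     \<and> (\<exists>M. \<forall>x\<in>U. norm (f x) \<le> norm x * M)"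

definition adjoint_from ::
    "'a::real_inner set \<Rightarrow> ('a \<Rightarrow> 'b::real_inner) \<Rightarrow> 'b \<Rightarrow> 'a" where
  "adjoint_from U f y = (THE z. z \<in> U \<and> (\<forall>x\<in>U. inner (f x) y = inner x z))"

definition set_operator :: "'a set \<Rightarrow> ('a \<Rightarrow> 'a set) \<Rightarrow> bool" where
  "set_operator U A \<longleftrightarrow> (\<forall>x\<in>U. A x \<subseteq> U)"

definition monotone_op :: "'a::real_inner set \<Rightarrow> ('a \<Rightarrow> 'a set) \<Rightarrow> bool" where
  "monotone_op U A \<longleftrightarrow> set_operator U A
     \<and> (\<forall>x\<in>U. \<forall>y\<in>U. \<forall>u\<in>A x. \<forall>v\<in>A y. inner (x - y) (u - v) \<ge> 0)"

definition maximally_monotone :: "'a::real_inner set \<Rightarrow> ('a \<Rightarrow> 'a set) \<Rightarrow> bool" where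
  "maximally_monotone U A \<longleftrightarrow> monotone_op U A
     \<and> (\<forall>B. monotone_op U B \<and> (\<forall>x\<in>U. A x \<subseteq> B x) \<longrightarrow> (\<forall>x\<in>U. B x = A x))"

definition cocoercive :: "real \<Rightarrow> 'a::real_inner set \<Rightarrow> ('a \<Rightarrow> 'a) \<Rightarrow> bool" where
  "cocoercive \<alpha> U C \<longleftrightarrow> C \<in> U \<rightarrow> U
     \<and> (\<forall>x\<in>U. \<forall>y\<in>U. inner (x - y) (C x - C y) \<ge> \<alpha> * (norm (C x - C y))\<^sup>2)"

definition monotone_lipschitz :: "real \<Rightarrow> 'a::real_inner set \<Rightarrow> ('a \<Rightarrow> 'a) \<Rightarrow> bool" where
  "monotone_lipschitz c U Q \<longleftrightarrow> monotone_op U (\<lambda>x. {Q x}) \<and> c-lipschitz_on U Q"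

definition inverse_op :: "'a set \<Rightarrow> ('a \<Rightarrow> 'a set) \<Rightarrow> 'a \<Rightarrow> 'a set" where
  "inverse_op U A u = {x \<in> U. u \<in> A x}"

text \<open>Sums of sets are Minkowski sums; in particular they are empty as soon as one summand is.\<close>

definition parallel_sum ::
    "'a::real_inner set \<Rightarrow> ('a \<Rightarrow> 'a set) \<Rightarrow> ('a \<Rightarrow> 'a set) \<Rightarrow> 'a \<Rightarrow> 'a set" where
  "parallel_sum U B D = inverse_op U (\<lambda>v. inverse_op U B v + inverse_op U D v)"

definition sum_op ::
    "('a::real_inner \<Rightarrow> 'a set) \<Rightarrow> ('a \<Rightarrow> 'a) \<Rightarrow> ('a \<Rightarrow> 'a) \<Rightarrow> 'a \<Rightarrow> 'a set" where
  "sum_op M C L x = M x + {C x} + {L x}"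

text \<open>The resolvent \<open>(Id + \<gamma> A)\<^sup>-\<^sup>1\<close> as a single-valued map.\<close>

definition resolvent :: "'a::real_inner set \<Rightarrow> real \<Rightarrow> ('a \<Rightarrow> 'a set) \<Rightarrow> 'a \<Rightarrow> 'a" where
  "resolvent U \<gamma> A x = the_elem (inverse_op U (\<lambda>p. {p} + (*\<^sub>R) \<gamma> ` A p) x)"

definition primal_solutions ::
    "('i::finite \<Rightarrow> 'h::real_inner set) \<Rightarrow> ('k::finite \<Rightarrow> 'g::real_inner set) \<Rightarrow>
     ('i \<Rightarrow> 'h) \<Rightarrow> ('k \<Rightarrow> 'g) \<Rightarrow>
     ('i \<Rightarrow> 'h \<Rightarrow> 'h set) \<Rightarrow> ('i \<Rightarrow> 'h \<Rightarrow> 'h) \<Rightarrow> ('i \<Rightarrow> 'h \<Rightarrow> 'h) \<Rightarrow> ('h ^ 'i \<Rightarrow> 'h ^ 'i) \<Rightarrow>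
     ('k \<Rightarrow> 'g \<Rightarrow> 'g set) \<Rightarrow> ('k \<Rightarrow> 'g \<Rightarrow> 'g) \<Rightarrow> ('k \<Rightarrow> 'g \<Rightarrow> 'g) \<Rightarrow>
     ('k \<Rightarrow> 'g \<Rightarrow> 'g set) \<Rightarrow> ('k \<Rightarrow> 'g \<Rightarrow> 'g) \<Rightarrow> ('k \<Rightarrow> 'g \<Rightarrow> 'g) \<Rightarrow>
     ('k \<Rightarrow> 'i \<Rightarrow> 'h \<Rightarrow> 'g) \<Rightarrow> ('h ^ 'i) set" where
  "primal_solutions H G s r A C Q R Bm Bc Bl Dm Dc Dl L =
     {x \<in> direct_sum H. \<forall>i.
        s i \<in> A i (x $ i) + {C i (x $ i)} + {Q i (x $ i)} + {R x $ i}
          + (\<Sum>k\<in>UNIV. adjoint_from (H i) (L k i) `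
               parallel_sum (G k) (sum_op (Bm k) (Bc k) (Bl k)) (sum_op (Dm k) (Dc k) (Dl k))
                 ((\<Sum>j\<in>UNIV. L k j (x $ j)) - r k))}"

definition dual_solutions ::
    "('i::finite \<Rightarrow> 'h::real_inner set) \<Rightarrow> ('k::finite \<Rightarrow> 'g::real_inner set) \<Rightarrow>
     ('i \<Rightarrow> 'h) \<Rightarrow> ('k \<Rightarrow> 'g) \<Rightarrow>
     ('i \<Rightarrow> 'h \<Rightarrow> 'h set) \<Rightarrow> ('i \<Rightarrow> 'h \<Rightarrow> 'h) \<Rightarrow> ('i \<Rightarrow> 'h \<Rightarrow> 'h) \<Rightarrow> ('h ^ 'i \<Rightarrow> 'h ^ 'i) \<Rightarrow>
     ('k \<Rightarrow> 'g \<Rightarrow> 'g set) \<Rightarrow> ('k \<Rightarrow> 'g \<Rightarrow> 'g) \<Rightarrow> ('k \<Rightarrow> 'g \<Rightarrow> 'g) \<Rightarrow>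
     ('k \<Rightarrow> 'g \<Rightarrow> 'g set) \<Rightarrow> ('k \<Rightarrow> 'g \<Rightarrow> 'g) \<Rightarrow> ('k \<Rightarrow> 'g \<Rightarrow> 'g) \<Rightarrow>
     ('k \<Rightarrow> 'i \<Rightarrow> 'h \<Rightarrow> 'g) \<Rightarrow> ('g ^ 'k) set" where
  "dual_solutions H G s r A C Q R Bm Bc Bl Dm Dc Dl L =
     {v \<in> direct_sum G. \<exists>x \<in> direct_sum H.
        (\<forall>i. s i - (\<Sum>j\<in>UNIV. adjoint_from (H i) (L j i) (v $ j))
               \<in> A i (x $ i) + {C i (x $ i)} + {Q i (x $ i)} + {R x $ i})
      \<and> (\<forall>k. v $ k \<in>
               parallel_sum (G k) (sum_op (Bm k) (Bc k) (Bl k)) (sum_op (Dm k) (Dc k) (Dl k))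
                 ((\<Sum>j\<in>UNIV. L k j (x $ j)) - r k))}"

definition kuhn_tucker_set ::
    "('i::finite \<Rightarrow> 'h::real_inner set) \<Rightarrow> ('k::finite \<Rightarrow> 'g::real_inner set) \<Rightarrow>
     ('i \<Rightarrow> 'h) \<Rightarrow> ('k \<Rightarrow> 'g) \<Rightarrow>
     ('i \<Rightarrow> 'h \<Rightarrow> 'h set) \<Rightarrow> ('i \<Rightarrow> 'h \<Rightarrow> 'h) \<Rightarrow> ('i \<Rightarrow> 'h \<Rightarrow> 'h) \<Rightarrow> ('h ^ 'i \<Rightarrow> 'h ^ 'i) \<Rightarrow>
     ('k \<Rightarrow> 'g \<Rightarrow> 'g set) \<Rightarrow> ('k \<Rightarrow> 'g \<Rightarrow> 'g) \<Rightarrow> ('k \<Rightarrow> 'g \<Rightarrow> 'g) \<Rightarrow>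
     ('k \<Rightarrow> 'g \<Rightarrow> 'g set) \<Rightarrow> ('k \<Rightarrow> 'g \<Rightarrow> 'g) \<Rightarrow> ('k \<Rightarrow> 'g \<Rightarrow> 'g) \<Rightarrow>
     ('k \<Rightarrow> 'i \<Rightarrow> 'h \<Rightarrow> 'g) \<Rightarrow> (('h ^ 'i) \<times> ('g ^ 'k)) set" where
  "kuhn_tucker_set H G s r A C Q R Bm Bc Bl Dm Dc Dl L =
     {(x, v). x \<in> direct_sum H \<and> v \<in> direct_sum G
      \<and> (\<forall>i. s i - (\<Sum>j\<in>UNIV. adjoint_from (H i) (L j i) (v $ j))
               \<in> A i (x $ i) + {C i (x $ i)} + {Q i (x $ i)} + {R x $ i})
      \<and> (\<forall>k. (\<Sum>j\<in>UNIV. L k j (x $ j)) - r k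
               \<in> inverse_op (G k) (sum_op (Bm k) (Bc k) (Bl k)) (v $ k)
                 + inverse_op (G k) (sum_op (Dm k) (Dc k) (Dl k)) (v $ k))}"

end

theory Submission
  imports Defs
begin

text \<open>
  Two auxiliary variables per dual index turn the problem into a zero problem on the Hilbert direct
  sum \<open>W\<close> of points \<open>(x, y, z, v)\<close>: the Kuhn--Tucker condition that involves the inverses of \<open>B\<close> and \<open>D\<close>
  says that some \<open>y\<close>, \<open>z\<close> satisfy \<open>v \<in> B y\<close>, \<open>v \<in> D z\<close> and \<open>y + z = L x - r\<close>. Together with the primal
  inclusion this is \<open>0 \<in> M w + F w + E w\<close>, where \<open>M\<close> collects the maximally monotone operators, \<open>E\<close> the cocoercive ones,
  and \<open>F\<close> the Lipschitzian ones together with the skew coupling through \<open>L\<close> and its adjoint. The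
  coupling cancels in \<open>\<langle>w - w', F w - F w'\<rangle>\<close>, so \<open>F\<close> is monotone.

  In this space the algorithm is a projection method. From delayed data it builds a point \<open>c\<close> of the
  domain of \<open>M\<close> and a vector \<open>t \<in> M c + F c + E p\<close>, where \<open>p\<close> is the delayed point. Monotonicity of
  \<open>M\<close> and \<open>F\<close> and cocoercivity of \<open>E\<close> give \<open>\<Delta> \<le> \<langle>w - z, t\<rangle>\<close> for every zero \<open>z\<close> (lemma
  \<open>separation\<close>): the zeros lie in the half-space of the points \<open>z\<close> with this property, which
  excludes the current iterate \<open>w\<close> when \<open>\<Delta> > 0\<close>, and the update is a relaxed projection onto it.
  Hence the distances to all zeros decrease and the squared increments are summable (lemma
  \<open>fejer_consequences\<close>), which is claims (i) and (ii).

  For (iii), the increments tend to \<open>0\<close>, so a delay of bounded length costs only a vanishing error.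
  Up to such an error, \<open>t\<close> is \<open>\<Gamma> (w - c) - (F w - F c)\<close> with \<open>\<Gamma>\<close> the diagonal operator of the inverse
  step sizes. The upper bounds on the steps make \<open>\<Gamma> - F\<close> strongly monotone, with modulus \<open>\<epsilon>\<close> in
  the dual variable and a modulus \<open>\<sigma> > 1 / (4 \<alpha>)\<close> in the others, so \<open>\<Delta>\<close> is bounded below by a positive multiple of \<open>\<parallel>w - c\<parallel>\<^sup>2\<close> up to terms of
  lower order (lemma \<open>gap_lower_bound\<close>). On the other hand \<open>\<Delta>\<close> is at most a constant times \<open>\<parallel>t\<parallel>\<close>, and
  \<open>\<lambda> \<Delta>\<close> at most \<open>\<parallel>t\<parallel>\<close> times the length of the increment. The first bound keeps \<open>w - c\<close> bounded, the
  second one then makes it vanish (lemma \<open>gap_vanishes\<close>).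

  For (iv), \<open>t \<rightarrow> 0\<close> and \<open>w - c \<rightarrow> 0\<close>, so every weak cluster point of \<open>w\<close> is a zero because the graph of
  \<open>M + F + E\<close> is closed in the weak-strong topology (lemma \<open>demiclosed_graph\<close>). Together with the
  convergence of the distances to the zeros, this forces weak convergence of the whole sequence
  (lemma \<open>opial\<close>).

  Three facts of Hilbert space theory are needed on the way: the Riesz representation, which makes
  the adjoints meaningful, Minty's theorem, which makes the resolvents total, and the weak compactness
  of bounded sets. The first two come from one principle, the existence of minimisers of strongly
  convex functions (lemma \<open>strongly_convex_attains_minimum\<close>).
\<close>

section \<open>Hilbert direct sums, Riesz representation and adjoints\<close>

lemma complete_Times:
  fixes U :: "'a::real_normed_vector set" and V :: "'b::real_normed_vector set"
  assumes "complete U" "complete V"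
  shows "complete (U \<times> V)"
  unfolding complete_def
proof (intro allI impI)
  fix X :: "nat \<Rightarrow> 'a \<times> 'b" assume X: "(\<forall>n. X n \<in> U \<times> V) \<and> Cauchy X"
  then have "\<forall>n. fst (X n) \<in> U" "\<forall>n. snd (X n) \<in> V" by (auto simp: mem_Times_iff)
  moreover have "Cauchy (\<lambda>n. fst (X n))" "Cauchy (\<lambda>n. snd (X n))" using X by (auto intro: Cauchy_fst Cauchy_snd)
  ultimately obtain a b where ab: "a \<in> U" "(\<lambda>n. fst (X n)) \<longlonglongrightarrow> a" "b \<in> V" "(\<lambda>n. snd (X n)) \<longlonglongrightarrow> b"
    using assms unfolding complete_def by metis
  then show "\<exists>l\<in>U \<times> V. X \<longlonglongrightarrow> l"
    using tendsto_Pair[of "\<lambda>n. fst (X n)" a _ "\<lambda>n. snd (X n)" b] by auto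
qed

lemma hilbert_space_Times:
  "hilbert_space U \<Longrightarrow> hilbert_space V \<Longrightarrow> hilbert_space (U \<times> V)"
  by (simp add: hilbert_space_def complete_Times subspace_Times)

lemma hilbert_space_direct_sum:
  assumes "\<And>i. hilbert_space (H i)"
  shows "hilbert_space (direct_sum H)"
  unfolding hilbert_space_def
proof
  show "subspace (direct_sum H)"
    using assms by (auto simp: hilbert_space_def subspace_def direct_sum_def)
  show "complete (direct_sum H)"
    unfolding complete_def
  proof (intro allI impI)
    fix X assume X: "(\<forall>n. X n \<in> direct_sum H) \<and> Cauchy X"
    have "\<exists>l\<in>H i. (\<lambda>n. X n $ i) \<longlonglongrightarrow> l" for i
    proof -
      have "\<forall>n. X n $ i \<in> H i" using X by (simp add: direct_sum_def)
      moreover have "Cauchy (\<lambda>n. X n $ i)" using X by (simp add: Cauchy_vec_nth)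
      ultimately show ?thesis using assms[of i] unfolding hilbert_space_def complete_def by metis
    qed
    then obtain l where l: "\<And>i. l i \<in> H i" "\<And>i. (\<lambda>n. X n $ i) \<longlonglongrightarrow> l i" by metis
    then have "X \<longlonglongrightarrow> (\<chi> i. l i)" by (intro vec_tendstoI) simp
    then show "\<exists>l\<in>direct_sum H. X \<longlonglongrightarrow> l"
      using l(1) by (intro bexI[of _ "\<chi> i. l i"]) (auto simp: direct_sum_def)
  qed
qed

text \<open>
  The epigraph \<open>E\<close> stands for a possibly infinite function, which avoids extended reals. A minimising
  sequence is Cauchy: the midpoint hypothesis is strong convexity, and at the midpoint of two almost
  minimal points the value cannot fall below the infimum, which bounds their distance.
\<close>
lemma strongly_convex_attains_minimum:
  fixes E :: "('a::real_inner \<times> real) set"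
  assumes "complete U" and EU: "fst ` E \<subseteq> U" and "E \<noteq> {}"
    and bound: "\<And>p t. (p, t) \<in> E \<Longrightarrow> c \<le> t"
    and midpoint: "\<And>p q t s. (p, t) \<in> E \<Longrightarrow> (q, s) \<in> E \<Longrightarrow>
      ((1/2) *\<^sub>R (p + q), (t + s) / 2 - (norm (p - q))\<^sup>2 / 8) \<in> E"
    and closed: "\<And>X T p t. (\<And>n. (X n, T n) \<in> E) \<Longrightarrow> X \<longlonglongrightarrow> p \<Longrightarrow> T \<longlonglongrightarrow> t \<Longrightarrow> p \<in> U \<Longrightarrow> (p, t) \<in> E"
  shows "\<exists>p t. (p, t) \<in> E \<and> (\<forall>q s. (q, s) \<in> E \<longrightarrow> t \<le> s)"
proof -
  define m where "m = Inf (snd ` E)"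
  have bdd: "bdd_below (snd ` E)" using bound by (auto intro!: bdd_belowI[of _ c])
  have m_le: "m \<le> t" if "(p, t) \<in> E" for p t
    unfolding m_def using that bdd by (force intro: cInf_lower)
  have "\<exists>p t. (p, t) \<in> E \<and> t < m + 1 / real (Suc n)" for n
  proof -
    have "\<exists>t\<in>snd ` E. t < m + 1 / real (Suc n)"
      unfolding m_def using \<open>E \<noteq> {}\<close> by (intro cInf_lessD) auto
    then show ?thesis by force
  qed
  then obtain X T where XT: "\<And>n. (X n, T n) \<in> E" and Tm: "\<And>n. T n < m + 1 / real (Suc n)"
    by metis
  have "(\<lambda>n. m + 1 / real (Suc n)) \<longlonglongrightarrow> m + 0"
    by (intro tendsto_add tendsto_const) (use LIMSEQ_inverse_real_of_nat in \<open>simp add: inverse_eq_divide\<close>)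
  then have T: "T \<longlonglongrightarrow> m"
    using m_le[OF XT] Tm by (intro tendsto_sandwich[of "\<lambda>_. m" T _ "\<lambda>n. m + 1 / real (Suc n)"]) (auto intro: less_imp_le always_eventually)
  have dist: "(norm (X i - X j))\<^sup>2 \<le> 4 * (1 / real (Suc i) + 1 / real (Suc j))" for i j
  proof -
    have "m \<le> (T i + T j) / 2 - (norm (X i - X j))\<^sup>2 / 8"
      using m_le[OF midpoint[OF XT[of i] XT[of j]]] .
    then have "(norm (X i - X j))\<^sup>2 \<le> 4 * (T i - m) + 4 * (T j - m)" by argo
    also have "\<dots> \<le> 4 * (1 / real (Suc i)) + 4 * (1 / real (Suc j))"
      using Tm[of i] Tm[of j] by (intro add_mono mult_left_mono) linarith+
    finally show ?thesis by (simp only: distrib_left)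
  qed
  have "Cauchy X"
  proof (rule CauchyI)
    fix e :: real assume "e > 0"
    then obtain N where N: "1 / real (Suc N) < e\<^sup>2 / 8"
      using nat_approx_posE[of "e\<^sup>2 / 8"] by auto
    show "\<exists>N. \<forall>i\<ge>N. \<forall>j\<ge>N. norm (X i - X j) < e"
    proof (intro exI allI impI)
      fix i j assume "N \<le> i" "N \<le> j"
      then have "1 / real (Suc i) \<le> 1 / real (Suc N)" "1 / real (Suc j) \<le> 1 / real (Suc N)"
        by (auto simp: frac_le)
      then have "(norm (X i - X j))\<^sup>2 < e\<^sup>2" using dist[of i j] N by simp
      then show "norm (X i - X j) < e" using \<open>e > 0\<close> power2_less_imp_less by force
    qed
  qed
  moreover have "X n \<in> U" for n using EU XT by force
  ultimately obtain p where "p \<in> U" "X \<longlonglongrightarrow> p"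
    using \<open>complete U\<close> unfolding complete_def by blast
  then have "(p, m) \<in> E" using closed[OF XT _ T] by blast
  then show ?thesis using m_le by blast
qed

text \<open>
  First-order optimality without derivatives: divide by \<open>s\<close> and let it decrease to \<open>0\<close>.
\<close>
lemma nonneg_of_quadratic_perturbation:
  fixes A B :: real
  assumes "\<And>s. 0 < s \<Longrightarrow> s \<le> 1 \<Longrightarrow> 0 \<le> s * A + s\<^sup>2 * B"
  shows "0 \<le> A"
proof -
  have "0 \<le> A + s * B" if "0 < s" "s \<le> 1" for s
  proof -
    have "0 \<le> s * (A + s * B)" using assms[OF that] by (simp add: power2_eq_square algebra_simps)
    then show ?thesis using that by (simp add: zero_le_mult_iff)
  qed
  then have "eventually (\<lambda>s. 0 \<le> A + s * B) (at_right 0)"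
    by (intro eventually_at_rightI[of 0 1]) auto
  moreover have "((\<lambda>s. A + s * B) \<longlongrightarrow> A + 0 * B) (at_right 0)" by (intro tendsto_intros)
  ultimately show ?thesis by (metis add.right_neutral mult_zero_left tendsto_lowerbound trivial_limit_at_right_real)
qed

lemma norm_midpoint_sq:
  fixes p q :: "'a::real_inner"
  shows "(norm ((1/2) *\<^sub>R (p + q)))\<^sup>2 = ((norm p)\<^sup>2 + (norm q)\<^sup>2) / 2 - (norm (p - q))\<^sup>2 / 4"
proof -
  have "(norm ((1/2) *\<^sub>R (p + q)))\<^sup>2 = inner (p + q) (p + q) / 4"
    by (simp only: power2_norm_eq_inner inner_scaleR_left inner_scaleR_right)
  then show ?thesis
    by (simp add: power2_norm_eq_inner inner_add inner_diff inner_commute[of q p] field_simps)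
qed

lemma norm_add_scaleR_sq:
  fixes p u :: "'a::real_inner"
  shows "(norm (p + s *\<^sub>R u))\<^sup>2 = (norm p)\<^sup>2 + 2 * (s * inner p u) + s\<^sup>2 * (norm u)\<^sup>2"
  by (simp add: power2_norm_eq_inner inner_add inner_commute[of u p] power2_eq_square[of s] distrib_left)

text \<open>
  The representing vector is the minimiser of \<open>\<parallel>p\<parallel>\<^sup>2 / 2 - f p\<close>, and the representation is the
  stationarity condition.
\<close>
lemma riesz_representation:
  fixes f :: "'a::real_inner \<Rightarrow> real"
  assumes U: "hilbert_space U"
    and add: "\<And>x y. x \<in> U \<Longrightarrow> y \<in> U \<Longrightarrow> f (x + y) = f x + f y"
    and scale: "\<And>c x. x \<in> U \<Longrightarrow> f (c *\<^sub>R x) = c * f x"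
    and bounded: "\<And>x. x \<in> U \<Longrightarrow> \<bar>f x\<bar> \<le> B * norm x"
  obtains z where "z \<in> U" "\<And>x. x \<in> U \<Longrightarrow> f x = inner x z"
proof -
  have sub: "subspace U" and compl: "complete U" using U by (auto simp: hilbert_space_def)
  have diff: "f (x - y) = f x - f y" if "x \<in> U" "y \<in> U" for x y
    using add[OF \<open>x \<in> U\<close> subspace_neg[OF sub \<open>y \<in> U\<close>]] scale[OF \<open>y \<in> U\<close>, of "-1"] by simp
  define E where "E = {(p, t). p \<in> U \<and> (norm p)\<^sup>2 / 2 - f p \<le> t}"
  have "\<exists>p t. (p, t) \<in> E \<and> (\<forall>q s. (q, s) \<in> E \<longrightarrow> t \<le> s)"
  proof (rule strongly_convex_attains_minimum[OF compl, of E "- (B\<^sup>2 / 2)"])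
    show "fst ` E \<subseteq> U" by (auto simp: E_def)
    have "(0, - f 0) \<in> E" using sub by (auto simp: E_def subspace_0)
    then show "E \<noteq> {}" by blast
    show "- (B\<^sup>2 / 2) \<le> t" if "(p, t) \<in> E" for p t
    proof -
      have "0 \<le> (norm p - B)\<^sup>2" by simp
      then have "B * norm p \<le> (norm p)\<^sup>2 / 2 + B\<^sup>2 / 2" by (simp add: power2_diff field_simps)
      moreover have "p \<in> U" "(norm p)\<^sup>2 / 2 - f p \<le> t" using that by (auto simp: E_def)
      ultimately show ?thesis using bounded[of p] by linarith
    qed
    show "((1/2) *\<^sub>R (p + q), (t + s) / 2 - (norm (p - q))\<^sup>2 / 8) \<in> E"
      if "(p, t) \<in> E" "(q, s) \<in> E" for p q t s
    proof -
      have pq: "p \<in> U" "q \<in> U" "(norm p)\<^sup>2 / 2 - f p \<le> t" "(norm q)\<^sup>2 / 2 - f q \<le> s"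
        using that by (auto simp: E_def)
      have "p + q \<in> U" "(1/2) *\<^sub>R (p + q) \<in> U" using sub pq by (auto intro: subspace_add subspace_scale)
      moreover have "(norm ((1/2) *\<^sub>R (p + q)))\<^sup>2 / 2 - f ((1/2) *\<^sub>R (p + q)) \<le> (t + s) / 2 - (norm (p - q))\<^sup>2 / 8"
        unfolding norm_midpoint_sq scale[OF \<open>p + q \<in> U\<close>] add[OF pq(1,2)] using pq(3,4) by argo
      ultimately show ?thesis by (simp add: E_def)
    qed
    show "(p, t) \<in> E" if XT: "\<And>n. (X n, T n) \<in> E" and X: "X \<longlonglongrightarrow> p" and T: "T \<longlonglongrightarrow> t" and "p \<in> U"
      for X T p t
    proof -
      have XU: "X n \<in> U" for n using XT[of n] by (simp add: E_def)
      have lip: "\<bar>f (X n) - f p\<bar> \<le> B * norm (X n - p)" for n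
        using bounded[OF subspace_diff[OF sub XU \<open>p \<in> U\<close>]] diff[OF XU \<open>p \<in> U\<close>] by simp
      have "(\<lambda>n. B * norm (X n - p)) \<longlonglongrightarrow> B * 0"
        by (intro tendsto_mult tendsto_const tendsto_norm_zero) (use X in \<open>simp add: LIM_zero\<close>)
      then have "(\<lambda>n. f (X n) - f p) \<longlonglongrightarrow> 0"
        using Lim_null_comparison[of "\<lambda>n. f (X n) - f p" "\<lambda>n. B * norm (X n - p)"] lip by simp
      then have fX: "(\<lambda>n. f (X n)) \<longlonglongrightarrow> f p" by (rule LIM_zero_cancel)
      have "(\<lambda>n. (norm (X n))\<^sup>2 / 2 - f (X n)) \<longlonglongrightarrow> (norm p)\<^sup>2 / 2 - f p"
        by (rule tendsto_diff[OF _ fX]) (intro tendsto_intros X, simp)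
      then have "(norm p)\<^sup>2 / 2 - f p \<le> t"
        by (rule LIMSEQ_le[OF _ T]) (use XT in \<open>auto simp: E_def\<close>)
      then show ?thesis using \<open>p \<in> U\<close> by (simp add: E_def)
    qed
  qed
  then obtain p t where pt: "(p, t) \<in> E" and min: "\<And>q s. (q, s) \<in> E \<Longrightarrow> t \<le> s" by blast
  have pU: "p \<in> U" using pt by (simp add: E_def)
  have le: "0 \<le> inner u p - f u" if "u \<in> U" for u
  proof (rule nonneg_of_quadratic_perturbation[of _ "(norm u)\<^sup>2 / 2"])
    fix s :: real
    have "(p + s *\<^sub>R u, (norm (p + s *\<^sub>R u))\<^sup>2 / 2 - f (p + s *\<^sub>R u)) \<in> E"
      using pU that sub by (auto simp: E_def intro!: subspace_add subspace_scale)
    from min[OF this] pt have "(norm p)\<^sup>2 / 2 - f p \<le> (norm (p + s *\<^sub>R u))\<^sup>2 / 2 - f (p + s *\<^sub>R u)"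
      by (simp add: E_def)
    moreover have "f (p + s *\<^sub>R u) = f p + s * f u"
      using pU that sub by (simp add: add scale subspace_scale)
    moreover have "(norm (p + s *\<^sub>R u))\<^sup>2 = (norm p)\<^sup>2 + 2 * (s * inner p u) + s\<^sup>2 * (norm u)\<^sup>2"
      by (rule norm_add_scaleR_sq)
    ultimately show "0 \<le> s * (inner u p - f u) + s\<^sup>2 * ((norm u)\<^sup>2 / 2)"
      by (simp add: inner_commute algebra_simps)
  qed
  have "f u = inner u p" if "u \<in> U" for u
    using le[OF that] le[OF subspace_neg[OF sub that]] scale[OF that, of "-1"] by simp
  then show ?thesis using that pU by blast
qed

text \<open>
  The functional \<open>\<langle>f \<cdot>, y\<rangle>\<close> is bounded on \<open>U\<close> for every \<open>y\<close> of the ambient type, so Riesz supplies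
  the vector that the definite description singles out.
\<close>
lemma adjoint_from_works:
  assumes U: "hilbert_space U" and f: "bounded_linear_between U V f"
  shows adjoint_from_in: "adjoint_from U f y \<in> U"
    and inner_adjoint_from: "\<And>x. x \<in> U \<Longrightarrow> inner (f x) y = inner x (adjoint_from U f y)"
proof -
  obtain M where M: "\<And>x. x \<in> U \<Longrightarrow> norm (f x) \<le> norm x * M"
    and add: "\<And>x y. x \<in> U \<Longrightarrow> y \<in> U \<Longrightarrow> f (x + y) = f x + f y"
    and scale: "\<And>c x. x \<in> U \<Longrightarrow> f (c *\<^sub>R x) = c *\<^sub>R f x"
    using f unfolding bounded_linear_between_def by blast
  have "\<bar>inner (f x) y\<bar> \<le> M * norm y * norm x" if "x \<in> U" for x
    using Cauchy_Schwarz_ineq2[of "f x" y] mult_right_mono[OF M[OF that] norm_ge_zero[of y]]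
    by (simp add: mult_ac)
  then obtain z where z: "z \<in> U" "\<And>x. x \<in> U \<Longrightarrow> inner (f x) y = inner x z"
    using riesz_representation[OF U, of "\<lambda>x. inner (f x) y" "M * norm y"]
    by (auto simp: add scale inner_add)
  have "w = z" if "w \<in> U" "\<forall>x\<in>U. inner (f x) y = inner x w" for w
  proof -
    have "w - z \<in> U" using U that z by (simp add: hilbert_space_def subspace_diff)
    then have "inner (w - z) (w - z) = 0" using that z by (simp add: inner_diff_right)
    then show ?thesis by simp
  qed
  then have "adjoint_from U f y = z" unfolding adjoint_from_def using z by (intro the_equality) auto
  then show "adjoint_from U f y \<in> U" "\<And>x. x \<in> U \<Longrightarrow> inner (f x) y = inner x (adjoint_from U f y)"
    using z by auto
qed

lemma adjoint_from_diff:
  assumes U: "hilbert_space U" and f: "bounded_linear_between U V f"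
  shows "adjoint_from U f (y - z) = adjoint_from U f y - adjoint_from U f z" (is "?l = ?r")
proof -
  have in_U: "?l - ?r \<in> U"
    using adjoint_from_in[OF U f] U by (simp add: hilbert_space_def subspace_diff)
  have "inner (?l - ?r) (?l - ?r) = 0"
    by (simp only: inner_diff_right[of "?l - ?r"] flip: inner_adjoint_from[OF U f in_U]) (simp add: inner_diff_right)
  then show ?thesis by simp
qed

lemma adjoint_from_bounded:
  assumes U: "hilbert_space U" and f: "bounded_linear_between U V f"
  obtains M where "M-lipschitz_on UNIV (adjoint_from U f)"
proof -
  obtain M where M: "\<And>x. x \<in> U \<Longrightarrow> norm (f x) \<le> norm x * M"
    using f unfolding bounded_linear_between_def by blast
  have "norm (adjoint_from U f y) \<le> \<bar>M\<bar> * norm y" for y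
  proof -
    let ?a = "adjoint_from U f y"
    have aU: "?a \<in> U" by (rule adjoint_from_in[OF U f])
    have "(norm ?a)\<^sup>2 = inner (f ?a) y"
      by (simp add: power2_norm_eq_inner inner_adjoint_from[OF U f aU])
    also have "\<dots> \<le> norm (f ?a) * norm y" by (rule norm_cauchy_schwarz)
    also have "\<dots> \<le> norm ?a * \<bar>M\<bar> * norm y"
      using M[OF aU] by (intro mult_right_mono) (auto intro: order_trans[OF _ mult_left_mono[of M "\<bar>M\<bar>"]])
    finally show ?thesis by (cases "norm ?a = 0") (auto simp: power2_eq_square)
  qed
  then have "\<bar>M\<bar>-lipschitz_on UNIV (adjoint_from U f)"
    by (intro lipschitz_onI) (auto simp: dist_norm simp flip: adjoint_from_diff[OF U f])
  then show ?thesis using that by blast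
qed

lemma lipschitz_of_bounded_linear_between:
  assumes U: "subspace U" and f: "bounded_linear_between U V f"
  obtains M where "M-lipschitz_on U f"
proof -
  obtain M where M: "\<And>x. x \<in> U \<Longrightarrow> norm (f x) \<le> norm x * M"
    and add: "\<And>x y. x \<in> U \<Longrightarrow> y \<in> U \<Longrightarrow> f (x + y) = f x + f y"
    and scale: "\<And>c x. x \<in> U \<Longrightarrow> f (c *\<^sub>R x) = c *\<^sub>R f x"
    using f unfolding bounded_linear_between_def by blast
  have diff: "f (x - y) = f x - f y" if "x \<in> U" "y \<in> U" for x y
    using add[OF \<open>x \<in> U\<close> subspace_neg[OF U \<open>y \<in> U\<close>]] scale[OF \<open>y \<in> U\<close>, of "-1"] by simp
  have "norm (f x - f y) \<le> \<bar>M\<bar> * norm (x - y)" if "x \<in> U" "y \<in> U" for x y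
  proof -
    have "norm (f (x - y)) \<le> norm (x - y) * M" using that U by (intro M) (simp add: subspace_diff)
    also have "\<dots> \<le> norm (x - y) * \<bar>M\<bar>" by (intro mult_left_mono) auto
    finally show ?thesis using diff that by (simp add: mult_ac)
  qed
  then have "\<bar>M\<bar>-lipschitz_on U f" by (intro lipschitz_onI) (auto simp: dist_norm)
  then show ?thesis using that by blast
qed

section \<open>Maximally monotone operators and resolvents\<close>

lemma maximally_monotone_in:
  "maximally_monotone U A \<Longrightarrow> x \<in> U \<Longrightarrow> u \<in> A x \<Longrightarrow> u \<in> U"
  by (auto simp: maximally_monotone_def monotone_op_def set_operator_def)

text \<open>
  Adding one monotonically related point to the graph gives a monotone extension, which maximality
  forbids to be proper.
\<close>
lemma maximally_monotone_memI:
  assumes A: "maximally_monotone U A" and "x \<in> U" "u \<in> U"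
    and rel: "\<And>y v. y \<in> U \<Longrightarrow> v \<in> A y \<Longrightarrow> 0 \<le> inner (x - y) (u - v)"
  shows "u \<in> A x"
proof -
  define B where "B = A(x := insert u (A x))"
  have mono: "monotone_op U A" using A by (simp add: maximally_monotone_def)
  have sym: "0 \<le> inner (y - x) (v - u)" if "y \<in> U" "v \<in> A y" for y v
    using rel[OF that] by (metis inner_minus_left inner_minus_right minus_diff_eq)
  have "monotone_op U B"
    using mono \<open>u \<in> U\<close> rel sym unfolding monotone_op_def set_operator_def B_def by auto
  moreover have "\<forall>x\<in>U. A x \<subseteq> B x" by (auto simp: B_def)
  ultimately have "B x = A x" using A \<open>x \<in> U\<close> unfolding maximally_monotone_def by blast
  then show ?thesis by (auto simp: B_def)
qed

text \<open>
  Minty's theorem, by the Fitzpatrick function \<open>\<phi>(x, u) = sup \<langle>x, v\<rangle> + \<langle>y, u\<rangle> - \<langle>y, v\<rangle>\<close> over the graph.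
  It dominates \<open>\<langle>x, u\<rangle>\<close> by maximality and equals it on the graph. Minimise
  \<open>\<phi>(p) + \<parallel>p\<parallel>\<^sup>2 / 2\<close>: the optimality condition at the minimiser \<open>(x, u)\<close>, tested with graph points, says
  that \<open>(-u, -x)\<close> is monotonically related to the graph with the surplus \<open>\<parallel>x + u\<parallel>\<^sup>2\<close>. So it
  lies in the graph, and testing it against itself gives \<open>x = -u\<close>.
\<close>
lemma minty:
  assumes U: "hilbert_space U" and MU: "M \<subseteq> U \<times> U"
    and mono: "\<And>x u y v. (x, u) \<in> M \<Longrightarrow> (y, v) \<in> M \<Longrightarrow> 0 \<le> inner (x - y) (u - v)"
    and maximal: "\<And>x u. x \<in> U \<Longrightarrow> u \<in> U \<Longrightarrow> (\<And>y v. (y, v) \<in> M \<Longrightarrow> 0 \<le> inner (x - y) (u - v)) \<Longrightarrow> (x, u) \<in> M"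
  obtains p where "(p, - p) \<in> M"
proof -
  have sub: "subspace U" and compl: "complete U" using U by (auto simp: hilbert_space_def)
  \<comment> \<open>The affine minorant of the Fitzpatrick function that belongs to the graph point \<open>q\<close>.\<close>
  define \<phi> where "\<phi> p q = inner (fst p) (snd q) + inner (fst q) (snd p) - inner (fst q) (snd q)"
    for p q :: "'a \<times> 'a"
  define E where "E = {(p, t). p \<in> U \<times> U \<and> (\<forall>q\<in>M. \<phi> p q + (norm p)\<^sup>2 / 2 \<le> t)}"
  have \<phi>_self: "inner (fst q) (snd q) \<le> s" if "\<And>q'. q' \<in> M \<Longrightarrow> \<phi> q q' \<le> s" "q \<in> U \<times> U" for q s
  proof (rule ccontr)
    assume neg: "\<not> inner (fst q) (snd q) \<le> s"
    have *: "inner (fst q - y) (snd q - v) = inner (fst q) (snd q) - \<phi> q (y, v)" for y v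
      by (simp add: \<phi>_def inner_diff algebra_simps)
    have "(fst q, snd q) \<in> M"
    proof (rule maximal)
      show "0 \<le> inner (fst q - y) (snd q - v)" if "(y, v) \<in> M" for y v
        using \<open>\<And>q'. q' \<in> M \<Longrightarrow> \<phi> q q' \<le> s\<close>[OF that] neg unfolding * by linarith
    qed (use \<open>q \<in> U \<times> U\<close> in \<open>auto simp: mem_Times_iff\<close>)
    then have "q \<in> M" by simp
    then show False using that(1)[of q] neg by (simp add: \<phi>_def)
  qed
  have \<phi>_on_M: "\<phi> p q \<le> inner (fst p) (snd p)" if "p \<in> M" "q \<in> M" for p q
    using mono[of "fst p" "snd p" "fst q" "snd q"] that by (simp add: \<phi>_def inner_diff algebra_simps)
  have M_ne: "M \<noteq> {}" using maximal[of 0 0] sub by (auto simp: subspace_0)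
  have norm_pair: "(norm p)\<^sup>2 = (norm (fst p))\<^sup>2 + (norm (snd p))\<^sup>2" for p :: "'a \<times> 'a"
    by (cases p) (simp add: norm_Pair)
  have sum_sq: "0 \<le> inner (fst p) (snd p) + (norm p)\<^sup>2 / 2" for p :: "'a \<times> 'a"
  proof -
    have "0 \<le> (norm (fst p + snd p))\<^sup>2" by simp
    then show ?thesis
      by (simp only: norm_pair power2_norm_eq_inner) (simp add: inner_add inner_commute field_simps)
  qed
  have E_nonneg: "0 \<le> t" if "(p, t) \<in> E" for p t
  proof -
    have "inner (fst p) (snd p) \<le> t - (norm p)\<^sup>2 / 2"
      by (rule \<phi>_self) (use that in \<open>auto simp: E_def algebra_simps\<close>)
    then show ?thesis using sum_sq[of p] by linarith
  qed
  have \<phi>_mid: "\<phi> ((1/2) *\<^sub>R (p + q)) m = (\<phi> p m + \<phi> q m) / 2" for p q m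
    by (simp add: \<phi>_def inner_add algebra_simps)
  have sub2: "subspace (U \<times> U)" by (simp add: sub subspace_Times)
  have "\<exists>p t. (p, t) \<in> E \<and> (\<forall>q s. (q, s) \<in> E \<longrightarrow> t \<le> s)"
  proof (rule strongly_convex_attains_minimum[of "U \<times> U" E 0])
    show "complete (U \<times> U)" using compl by (rule complete_Times[OF _ compl])
    show "fst ` E \<subseteq> U \<times> U" by (auto simp: E_def)
    from M_ne obtain q where "q \<in> M" by blast
    then have "(q, inner (fst q) (snd q) + (norm q)\<^sup>2 / 2) \<in> E"
      using \<phi>_on_M MU by (auto simp: E_def)
    then show "E \<noteq> {}" by blast
    show "0 \<le> t" if "(p, t) \<in> E" for p t using E_nonneg[OF that] .
    show "((1/2) *\<^sub>R (p + q), (t + s) / 2 - (norm (p - q))\<^sup>2 / 8) \<in> E"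
      if "(p, t) \<in> E" "(q, s) \<in> E" for p q t s
    proof -
      have "\<phi> ((1/2) *\<^sub>R (p + q)) m + (norm ((1/2) *\<^sub>R (p + q)))\<^sup>2 / 2 \<le> (t + s) / 2 - (norm (p - q))\<^sup>2 / 8"
        if "m \<in> M" for m
      proof -
        have "\<phi> p m + (norm p)\<^sup>2 / 2 \<le> t" "\<phi> q m + (norm q)\<^sup>2 / 2 \<le> s"
          using \<open>(p, t) \<in> E\<close> \<open>(q, s) \<in> E\<close> that by (auto simp: E_def)
        then show ?thesis unfolding \<phi>_mid norm_midpoint_sq by (simp add: field_simps)
      qed
      moreover have "(1/2) *\<^sub>R (p + q) \<in> U \<times> U"
        using that sub2 by (intro subspace_scale subspace_add) (auto simp: E_def)
      ultimately show ?thesis by (simp add: E_def)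
    qed
    show "(p, t) \<in> E" if XT: "\<And>n. (X n, T n) \<in> E" and X: "X \<longlonglongrightarrow> p" and T: "T \<longlonglongrightarrow> t" and "p \<in> U \<times> U"
      for X T p t
    proof -
      have "\<phi> p m + (norm p)\<^sup>2 / 2 \<le> t" if "m \<in> M" for m
      proof (rule LIMSEQ_le[OF _ T])
        show "(\<lambda>n. \<phi> (X n) m + (norm (X n))\<^sup>2 / 2) \<longlonglongrightarrow> \<phi> p m + (norm p)\<^sup>2 / 2"
          unfolding \<phi>_def by (intro tendsto_intros X) auto
      qed (use XT that in \<open>auto simp: E_def\<close>)
      then show ?thesis using \<open>p \<in> U \<times> U\<close> by (simp add: E_def)
    qed
  qed
  then obtain p t where pt: "(p, t) \<in> E" and min: "\<And>q s. (q, s) \<in> E \<Longrightarrow> t \<le> s" by blast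
  define x u where "x = fst p" and "u = snd p"
  have p_eq: "p = (x, u)" by (simp add: x_def u_def)
  have xu: "x \<in> U" "u \<in> U" using pt by (auto simp: E_def p_eq)
  define \<phi>0 where "\<phi>0 = t - (norm p)\<^sup>2 / 2"
  have \<phi>_p: "\<phi> p m \<le> \<phi>0" if "m \<in> M" for m using pt that by (auto simp: E_def \<phi>0_def algebra_simps)
  have "inner x u \<le> \<phi>0" using \<phi>_self[of p \<phi>0] \<phi>_p xu by (simp add: p_eq)
  have sub_grad: "0 \<le> inner (fst q) (snd q) - \<phi>0 + inner p (q - p)" if "q \<in> M" for q
  proof (rule nonneg_of_quadratic_perturbation[of _ "(norm (q - p))\<^sup>2 / 2"])
    fix s :: real assume s: "0 < s" "s \<le> 1"
    let ?r = "p + s *\<^sub>R (q - p)"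
    let ?b = "\<phi>0 + s * (inner (fst q) (snd q) - \<phi>0)"
    have "\<phi> ?r m \<le> ?b" if "m \<in> M" for m
    proof -
      have "\<phi> ?r m = (1 - s) * \<phi> p m + s * \<phi> q m"
        by (simp add: \<phi>_def inner_add inner_diff algebra_simps)
      also have "\<dots> \<le> (1 - s) * \<phi>0 + s * inner (fst q) (snd q)"
        using s \<phi>_p[OF that] \<phi>_on_M[OF \<open>q \<in> M\<close> that] by (intro add_mono mult_left_mono) auto
      finally show ?thesis by (simp add: algebra_simps)
    qed
    moreover have "?r \<in> U \<times> U"
      using sub2 xu MU \<open>q \<in> M\<close>
      by (intro subspace_add subspace_scale subspace_diff) (auto simp: p_eq)
    ultimately have "(?r, ?b + (norm ?r)\<^sup>2 / 2) \<in> E" by (simp add: E_def)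
    from min[OF this] have "(norm p)\<^sup>2 / 2 \<le> s * (inner (fst q) (snd q) - \<phi>0) + (norm ?r)\<^sup>2 / 2"
      by (simp add: \<phi>0_def)
    moreover have "(norm ?r)\<^sup>2 = (norm p)\<^sup>2 + 2 * (s * inner p (q - p)) + s\<^sup>2 * (norm (q - p))\<^sup>2"
      by (rule norm_add_scaleR_sq)
    ultimately show "0 \<le> s * (inner (fst q) (snd q) - \<phi>0 + inner p (q - p)) + s\<^sup>2 * ((norm (q - p))\<^sup>2 / 2)"
      by (simp add: algebra_simps)
  qed
  have key: "(norm (x + u))\<^sup>2 \<le> inner (- u - y) (- x - v)" if "(y, v) \<in> M" for y v
  proof -
    have "\<phi>0 \<le> inner y v + inner x (y - x) + inner u (v - u)"
      using sub_grad[OF that] by (simp add: p_eq)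
    then have "inner x u \<le> inner y v + inner x (y - x) + inner u (v - u)"
      using \<open>inner x u \<le> \<phi>0\<close> by linarith
    then show ?thesis
      by (simp only: power2_norm_eq_inner) (simp add: inner_add inner_diff inner_commute algebra_simps)
  qed
  have "(- u, - x) \<in> M"
  proof (rule maximal)
    show "0 \<le> inner (- u - y) (- x - v)" if "(y, v) \<in> M" for y v
      using key[OF that] by (meson order_trans zero_le_power2)
  qed (use xu sub in \<open>auto simp: subspace_neg\<close>)
  moreover from key[OF this] have "x = - u" by (simp add: eq_neg_iff_add_eq_0)
  ultimately show ?thesis using that[of "- u"] by simp
qed

text \<open>
  Minty's theorem for the operator \<open>\<gamma> A - z\<close>, which is again maximally monotone.
\<close>
lemma maximally_monotone_surj:
  assumes U: "hilbert_space U" and A: "maximally_monotone U A" and "0 < \<gamma>" and "z \<in> U"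
  obtains p m where "p \<in> U" "m \<in> U" "m \<in> A p" "p + \<gamma> *\<^sub>R m = z"
proof -
  have sub: "subspace U" using U by (auto simp: hilbert_space_def)
  have mono: "0 \<le> inner (x - y) (u - v)" if "x \<in> U" "y \<in> U" "u \<in> A x" "v \<in> A y" for x y u v
    using A that by (auto simp: maximally_monotone_def monotone_op_def)
  have AU: "A x \<subseteq> U" if "x \<in> U" for x
    using A that by (auto simp: maximally_monotone_def monotone_op_def set_operator_def)
  define M where "M = {(x, \<gamma> *\<^sub>R v - z) | x v. x \<in> U \<and> v \<in> A x}"
  obtain p where "(p, - p) \<in> M"
  proof (rule minty[OF U, of M])
    show "M \<subseteq> U \<times> U"
      using AU \<open>z \<in> U\<close> sub by (auto simp: M_def intro!: subspace_diff subspace_scale)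
    show "0 \<le> inner (x - y) (u - v)" if "(x, u) \<in> M" "(y, v) \<in> M" for x y u v
      using that mono \<open>0 < \<gamma>\<close> by (auto simp: M_def simp flip: scaleR_right_diff_distrib)
    show "(x, u) \<in> M" if "x \<in> U" "u \<in> U" and rel: "\<And>y v. (y, v) \<in> M \<Longrightarrow> 0 \<le> inner (x - y) (u - v)" for x u
    proof -
      have "(1 / \<gamma>) *\<^sub>R (u + z) \<in> A x"
      proof (rule maximally_monotone_memI[OF A \<open>x \<in> U\<close>])
        show "(1 / \<gamma>) *\<^sub>R (u + z) \<in> U" using sub \<open>u \<in> U\<close> \<open>z \<in> U\<close> by (intro subspace_scale subspace_add)
        fix y v assume "y \<in> U" "v \<in> A y"
        then have "0 \<le> inner (x - y) (u - (\<gamma> *\<^sub>R v - z))" by (intro rel) (auto simp: M_def)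
        also have "u - (\<gamma> *\<^sub>R v - z) = \<gamma> *\<^sub>R ((1 / \<gamma>) *\<^sub>R (u + z) - v)"
          using \<open>0 < \<gamma>\<close> by (simp add: algebra_simps)
        finally show "0 \<le> inner (x - y) ((1 / \<gamma>) *\<^sub>R (u + z) - v)"
          using \<open>0 < \<gamma>\<close> by (simp add: zero_le_mult_iff)
      qed
      then show ?thesis using \<open>x \<in> U\<close> \<open>0 < \<gamma>\<close>
        by (auto simp: M_def intro!: exI[of _ "(1 / \<gamma>) *\<^sub>R (u + z)"])
    qed
  qed
  then obtain v where v: "p \<in> U" "v \<in> A p" "- p = \<gamma> *\<^sub>R v - z" by (auto simp: M_def)
  show ?thesis
    by (rule that[of p v]) (use v AU in \<open>auto simp: algebra_simps\<close>)
qed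

text \<open>
  Surjectivity gives a point of the resolvent, monotonicity its uniqueness, so that the element
  selected by the definition of the resolvent is the right one.
\<close>
lemma resolvent_works:
  assumes U: "hilbert_space U" and A: "maximally_monotone U A" and "0 < \<gamma>" and "z \<in> U"
  shows resolvent_in: "resolvent U \<gamma> A z \<in> U"
    and resolvent_graph: "inverse \<gamma> *\<^sub>R (z - resolvent U \<gamma> A z) \<in> A (resolvent U \<gamma> A z)"
proof -
  obtain p m where p: "p \<in> U" "m \<in> A p" "p + \<gamma> *\<^sub>R m = z"
    using maximally_monotone_surj[OF assms] by metis
  have "inverse_op U (\<lambda>p. {p} + (*\<^sub>R) \<gamma> ` A p) z = {p}"
  proof (intro set_eqI iffI)
    fix q assume "q \<in> inverse_op U (\<lambda>p. {p} + (*\<^sub>R) \<gamma> ` A p) z"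
    then obtain n where q: "q \<in> U" "n \<in> A q" "q + \<gamma> *\<^sub>R n = z"
      by (auto simp: inverse_op_def elim!: set_plus_elim)
    then have "0 \<le> inner (q - p) (n - m)"
      using A p by (auto simp: maximally_monotone_def monotone_op_def)
    moreover have "q - p = - \<gamma> *\<^sub>R (n - m)" using p(3) q(3) by (simp add: algebra_simps)
    ultimately have "\<gamma> * inner (n - m) (n - m) \<le> 0" by simp
    then have "inner (n - m) (n - m) \<le> 0" using \<open>0 < \<gamma>\<close> by (simp add: mult_le_0_iff)
    then have "n = m" using inner_ge_zero[of "n - m"] by (metis eq_iff_diff_eq_0 inner_eq_zero_iff order_antisym)
    then show "q \<in> {p}" using \<open>q - p = _\<close> by simp
  qed (use p in \<open>auto simp: inverse_op_def intro!: set_plus_intro\<close>)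
  then have r: "resolvent U \<gamma> A z = p" by (simp add: resolvent_def)
  show "resolvent U \<gamma> A z \<in> U" using p r by simp
  have "inverse \<gamma> *\<^sub>R (z - p) = m" using p(3) \<open>0 < \<gamma>\<close> by auto
  then show "inverse \<gamma> *\<^sub>R (z - resolvent U \<gamma> A z) \<in> A (resolvent U \<gamma> A z)" using p r by simp
qed

section \<open>Weak cluster points and weak convergence\<close>

lemma tendsto_inner_null:
  fixes f g :: "'n \<Rightarrow> 'a::real_inner"
  assumes "\<And>n. norm (f n) \<le> B" and "(g \<longlongrightarrow> 0) F"
  shows "((\<lambda>n. inner (f n) (g n)) \<longlongrightarrow> 0) F"
proof (rule Lim_null_comparison)
  show "eventually (\<lambda>n. norm (inner (f n) (g n)) \<le> B * norm (g n)) F"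
  proof (intro always_eventually allI)
    show "norm (inner (f n) (g n)) \<le> B * norm (g n)" for n
      using Cauchy_Schwarz_ineq2[of "f n" "g n"] mult_right_mono[OF assms(1)[of n] norm_ge_zero[of "g n"]]
      by simp
  qed
  have "((\<lambda>n. B * norm (g n)) \<longlongrightarrow> B * 0) F"
    by (intro tendsto_mult tendsto_const tendsto_norm_zero assms)
  then show "((\<lambda>n. B * norm (g n)) \<longlongrightarrow> 0) F" by simp
qed

text \<open>
  The functionals \<open>\<langle>w n, \<cdot>\<rangle>\<close> lie in a product of compact intervals, which is compact by Tychonoff's
  theorem. A cluster point of them is linear and bounded, hence represented by a vector. Filters replace
  subsequences because compactness of an uncountable product provides cluster points, but not
  convergent subsequences.
\<close>
lemma weak_cluster_point:
  fixes w :: "'n \<Rightarrow> 'a::real_inner"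
  assumes W: "hilbert_space W" and "\<And>n. w n \<in> W" and bound: "\<And>n. norm (w n) \<le> B" and "F \<noteq> bot"
  obtains G z where "G \<le> F" "G \<noteq> bot" "z \<in> W" "\<And>u. u \<in> W \<Longrightarrow> ((\<lambda>n. inner (w n) u) \<longlongrightarrow> inner z u) G"
proof -
  define S where "S = PiE UNIV (\<lambda>u::'a. {- (B * norm u) .. B * norm u})"
  define \<Phi> where "\<Phi> n = (\<lambda>u. inner (w n) u)" for n
  have "compactin (product_topology (\<lambda>_. euclidean) UNIV) S"
    unfolding S_def compactin_PiE by simp
  then have "compact S" by (simp add: euclidean_product_topology)
  have \<Phi>S: "\<Phi> n \<in> S" for n
  proof -
    have "\<bar>inner (w n) u\<bar> \<le> B * norm u" for u
      using Cauchy_Schwarz_ineq2[of "w n" u] mult_right_mono[OF bound[of n] norm_ge_zero[of u]] by linarith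
    then show ?thesis by (auto simp: S_def \<Phi>_def abs_le_iff) (metis minus_le_iff)
  qed
  then have "eventually (\<lambda>\<phi>. \<phi> \<in> S) (filtermap \<Phi> F)" by (simp add: eventually_filtermap)
  then obtain \<psi> where \<psi>: "\<psi> \<in> S" "inf (nhds \<psi>) (filtermap \<Phi> F) \<noteq> bot"
    using \<open>compact S\<close> \<open>F \<noteq> bot\<close> unfolding compact_filter by (metis filtermap_bot_iff)
  define G where "G = inf F (filtercomap \<Phi> (nhds \<psi>))"
  have "G \<noteq> bot"
  proof
    assume "G = bot"
    then have "eventually (\<lambda>_. False) G" by simp
    then obtain P Q where P: "eventually P F" and Q: "eventually Q (filtercomap \<Phi> (nhds \<psi>))"
      and PQ: "\<And>n. P n \<Longrightarrow> Q n \<Longrightarrow> False"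
      unfolding G_def eventually_inf by blast
    then obtain R where R: "eventually R (nhds \<psi>)" "\<And>n. R (\<Phi> n) \<Longrightarrow> Q n"
      unfolding eventually_filtercomap by blast
    have "eventually (\<lambda>\<phi>. \<not> R \<phi>) (filtermap \<Phi> F)"
      unfolding eventually_filtermap using P by (rule eventually_mono) (use R PQ in blast)
    then have "eventually (\<lambda>_. False) (inf (nhds \<psi>) (filtermap \<Phi> F))"
      unfolding eventually_inf using R(1) by blast
    then show False using \<psi>(2) by (simp add: trivial_limit_def)
  qed
  have "filterlim \<Phi> (nhds \<psi>) G"
    unfolding G_def filterlim_iff_le_filtercomap by simp
  then have lim: "((\<lambda>n. inner (w n) u) \<longlongrightarrow> \<psi> u) G" for u
    using continuous_on_tendsto_compose[of UNIV "\<lambda>\<phi>. \<phi> u" \<Phi> \<psi> G]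
    by (simp add: \<Phi>_def continuous_on_product_coordinates)
  have "\<psi> (x + y) = \<psi> x + \<psi> y" for x y
    using tendsto_unique[OF \<open>G \<noteq> bot\<close> lim[of "x + y"]] tendsto_add[OF lim[of x] lim[of y]]
    by (simp add: inner_add_right)
  moreover have "\<psi> (c *\<^sub>R x) = c * \<psi> x" for c x
    using tendsto_unique[OF \<open>G \<noteq> bot\<close> lim[of "c *\<^sub>R x"]] tendsto_mult_left[OF lim[of x], of c] by simp
  moreover have "\<bar>\<psi> x\<bar> \<le> B * norm x" for x using \<psi>(1) by (auto simp: S_def PiE_def Pi_def abs_le_iff) (metis minus_le_iff)
  ultimately obtain z where z: "z \<in> W" "\<And>u. u \<in> W \<Longrightarrow> \<psi> u = inner u z"
    using riesz_representation[OF W, of \<psi> B] by blast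
  then have "((\<lambda>n. inner (w n) u) \<longlongrightarrow> inner z u) G" if "u \<in> W" for u
    using lim[of u] that by (simp add: inner_commute[of z])
  moreover have "G \<le> F" by (simp add: G_def)
  ultimately show ?thesis using that \<open>G \<noteq> bot\<close> z(1) by blast
qed

text \<open>
  Opial's argument. For two cluster points \<open>z\<close>, \<open>z'\<close> in \<open>Z\<close> the difference of the squared distances
  shows that \<open>\<langle>w n, z - z'\<rangle>\<close> converges, so \<open>\<langle>z, z - z'\<rangle> = \<langle>z', z - z'\<rangle>\<close> and both agree. If the sequence
  did not converge weakly to the only cluster point, the indices at which it stays away would carry a
  second one.
\<close>
lemma opial:
  fixes w :: "nat \<Rightarrow> 'a::real_inner"
  assumes W: "hilbert_space W" and wW: "\<And>n. w n \<in> W" and bound: "\<And>n. norm (w n) \<le> B"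
    and conv: "\<And>z. z \<in> Z \<Longrightarrow> convergent (\<lambda>n. norm (w n - z))"
    and cluster: "\<And>G z. G \<le> sequentially \<Longrightarrow> G \<noteq> bot \<Longrightarrow> z \<in> W \<Longrightarrow>
      (\<And>u. u \<in> W \<Longrightarrow> ((\<lambda>n. inner (w n) u) \<longlongrightarrow> inner z u) G) \<Longrightarrow> z \<in> Z"
  obtains z where "z \<in> Z" "weakly_converges_in W w z"
proof -
  have sub: "subspace W" using W by (simp add: hilbert_space_def)
  have unique: "z = z'"
    if G: "G \<le> sequentially" "G \<noteq> bot" "z \<in> W" "\<And>u. u \<in> W \<Longrightarrow> ((\<lambda>n. inner (w n) u) \<longlongrightarrow> inner z u) G"
      and G': "G' \<le> sequentially" "G' \<noteq> bot" "z' \<in> W" "\<And>u. u \<in> W \<Longrightarrow> ((\<lambda>n. inner (w n) u) \<longlongrightarrow> inner z' u) G'"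
    for G G' z z'
  proof -
    have zW: "z - z' \<in> W" using G(3) G'(3) sub by (simp add: subspace_diff)
    have "z \<in> Z" "z' \<in> Z" using cluster G G' by blast+
    then obtain l l' where "(\<lambda>n. norm (w n - z)) \<longlonglongrightarrow> l" "(\<lambda>n. norm (w n - z')) \<longlonglongrightarrow> l'"
      using conv unfolding convergent_def by blast
    then have "(\<lambda>n. ((norm (w n - z'))\<^sup>2 - (norm (w n - z))\<^sup>2 + (norm z)\<^sup>2 - (norm z')\<^sup>2) / 2)
        \<longlonglongrightarrow> (l'\<^sup>2 - l\<^sup>2 + (norm z)\<^sup>2 - (norm z')\<^sup>2) / 2"
      by (intro tendsto_intros) auto
    moreover have "((norm (w n - z'))\<^sup>2 - (norm (w n - z))\<^sup>2 + (norm z)\<^sup>2 - (norm z')\<^sup>2) / 2 = inner (w n) (z - z')" for n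
      by (simp add: power2_norm_eq_inner inner_diff inner_commute field_simps)
    ultimately have "\<exists>c. (\<lambda>n. inner (w n) (z - z')) \<longlonglongrightarrow> c" by auto
    then obtain c where c: "(\<lambda>n. inner (w n) (z - z')) \<longlonglongrightarrow> c" by blast
    have "inner z (z - z') = c"
      using tendsto_unique[OF G(2) G(4)[OF zW] tendsto_mono[OF G(1) c]] .
    moreover have "inner z' (z - z') = c"
      using tendsto_unique[OF G'(2) G'(4)[OF zW] tendsto_mono[OF G'(1) c]] .
    ultimately have "inner (z - z') (z - z') = 0" by (simp add: inner_diff_left)
    then show ?thesis by simp
  qed
  obtain G z where G: "G \<le> sequentially" "G \<noteq> bot" "z \<in> W" "\<And>u. u \<in> W \<Longrightarrow> ((\<lambda>n. inner (w n) u) \<longlongrightarrow> inner z u) G"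
    using weak_cluster_point[where w = w, OF W wW bound sequentially_bot] by blast
  have "(\<lambda>n. inner (w n) u) \<longlonglongrightarrow> inner z u" if "u \<in> W" for u
  proof (rule tendstoI, rule ccontr)
    fix e :: real assume "0 < e" and neg: "\<not> eventually (\<lambda>n. dist (inner (w n) u) (inner z u) < e) sequentially"
    define F where "F = inf sequentially (principal {n. \<not> dist (inner (w n) u) (inner z u) < e})"
    have "F \<noteq> bot"
      using neg unfolding F_def trivial_limit_def eventually_inf_principal by simp
    then obtain G' z' where G': "G' \<le> F" "G' \<noteq> bot" "z' \<in> W" "\<And>u. u \<in> W \<Longrightarrow> ((\<lambda>n. inner (w n) u) \<longlongrightarrow> inner z' u) G'"
      using weak_cluster_point[where w = w, OF W wW bound] by blast
    have "G' \<le> sequentially" using G'(1) by (simp add: F_def)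
    then have "z = z'" using unique[OF G] G' by blast
    then have "eventually (\<lambda>n. dist (inner (w n) u) (inner z u) < e) G'"
      using tendstoD[OF G'(4)[OF that] \<open>0 < e\<close>] by simp
    moreover have "eventually (\<lambda>n. \<not> dist (inner (w n) u) (inner z u) < e) G'"
      using G'(1) by (rule filter_leD) (simp add: F_def eventually_inf_principal)
    ultimately have "eventually (\<lambda>_. False) G'" by eventually_elim simp
    then show False using G'(2) by (simp add: trivial_limit_def)
  qed
  moreover have "z \<in> Z" using cluster G by blast
  ultimately show ?thesis using that by (simp add: weakly_converges_in_def)
qed

section \<open>Demiclosedness and cocoercivity\<close>

text \<open>
  The graph of \<open>M + F\<close> is closed for weak convergence of the points and strong convergence of the
  values. Passing to the limit in the monotonicity inequalities gives \<open>0 \<le> \<langle>z - y, -F y - v\<rangle>\<close> for all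
  \<open>(y, v)\<close> in \<open>M\<close>. To replace \<open>F y\<close> by \<open>F z\<close>, choose \<open>(y, v)\<close> with \<open>z - y = \<gamma> (v + F z)\<close>: then
  \<open>\<parallel>v + F z\<parallel>\<^sup>2\<close> is at most \<open>\<gamma> l\<close> times itself, and it vanishes for \<open>\<gamma> l < 1\<close>.
\<close>
lemma demiclosed_graph:
  fixes c :: "nat \<Rightarrow> 'a::real_inner"
  assumes "subspace W" and MW: "M \<subseteq> W \<times> W"
    and mono: "\<And>x u y v. (x, u) \<in> M \<Longrightarrow> (y, v) \<in> M \<Longrightarrow> 0 \<le> inner (x - y) (u - v)"
    and surj: "\<And>\<gamma> p. 0 < \<gamma> \<Longrightarrow> p \<in> W \<Longrightarrow> \<exists>(x, u) \<in> M. x + \<gamma> *\<^sub>R u = p"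
    and FW: "F \<in> W \<rightarrow> W" and Fmono: "\<And>x y. x \<in> W \<Longrightarrow> y \<in> W \<Longrightarrow> 0 \<le> inner (x - y) (F x - F y)"
    and Flip: "l-lipschitz_on W F"
    and "G \<noteq> bot" and cM: "\<And>n. (c n, m n) \<in> M" and cbound: "\<And>n. norm (c n) \<le> B"
    and strong: "((\<lambda>n. m n + F (c n)) \<longlongrightarrow> 0) G"
    and "z \<in> W" and weak: "\<And>u. u \<in> W \<Longrightarrow> ((\<lambda>n. inner (c n) u) \<longlongrightarrow> inner z u) G"
  shows "(z, - F z) \<in> M"
proof -
  have lim: "0 \<le> inner (z - y) (- F y - v)" if yv: "(y, v) \<in> M" for y v
  proof -
    have yW: "y \<in> W" "v \<in> W" using yv MW by auto
    have FyW: "- F y - v \<in> W"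
      using yW FW \<open>subspace W\<close> by (auto intro!: subspace_diff subspace_neg)
    have "0 \<le> inner (c n - y) (m n + F (c n)) + inner (c n - y) (- F y - v)" for n
    proof -
      have "c n \<in> W" using cM[of n] MW by auto
      then show ?thesis
        using mono[OF cM[of n] yv] Fmono[of "c n" y] yW by (simp add: inner_add_right inner_diff_right)
    qed
    moreover have "((\<lambda>n. inner (c n - y) (m n + F (c n)) + inner (c n - y) (- F y - v))
        \<longlongrightarrow> 0 + inner (z - y) (- F y - v)) G"
    proof (rule tendsto_add)
      show "((\<lambda>n. inner (c n - y) (m n + F (c n))) \<longlongrightarrow> 0) G"
      proof (rule tendsto_inner_null[OF _ strong])
        show "norm (c n - y) \<le> B + norm y" for n
          using norm_triangle_ineq4[of "c n" y] cbound[of n] by linarith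
      qed
      show "((\<lambda>n. inner (c n - y) (- F y - v)) \<longlongrightarrow> inner (z - y) (- F y - v)) G"
        unfolding inner_diff_left[of _ y] by (intro tendsto_diff weak[OF FyW] tendsto_const)
    qed
    ultimately show ?thesis
      using tendsto_lowerbound[OF _ _ \<open>G \<noteq> bot\<close>] by (metis (no_types, lifting) add_0 eventually_sequentially always_eventually)
  qed
  define \<gamma> where "\<gamma> = 1 / (l + 1)"
  have "0 \<le> l" using Flip by (rule lipschitz_on_nonneg)
  then have \<gamma>: "0 < \<gamma>" "\<gamma> * l < 1" by (simp_all add: \<gamma>_def)
  have "z - \<gamma> *\<^sub>R F z \<in> W"
    using \<open>z \<in> W\<close> FW \<open>subspace W\<close> by (auto intro!: subspace_diff subspace_scale)
  then obtain y v where yv: "(y, v) \<in> M" and eq: "y + \<gamma> *\<^sub>R v = z - \<gamma> *\<^sub>R F z"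
    using surj[OF \<gamma>(1)] by blast
  define d where "d = v + F z"
  have zy: "z - y = \<gamma> *\<^sub>R d" using eq by (simp add: d_def algebra_simps)
  have yW: "y \<in> W" using yv MW by auto
  have "0 \<le> inner d (- F y - v)" using lim[OF yv] \<gamma>(1) by (simp add: zy zero_le_mult_iff)
  also have "- F y - v = (F z - F y) - d" by (simp add: d_def)
  finally have "(norm d)\<^sup>2 \<le> inner d (F z - F y)" by (simp add: inner_diff_right power2_norm_eq_inner)
  also have "\<dots> \<le> norm d * norm (F z - F y)" by (rule norm_cauchy_schwarz)
  also have "\<dots> \<le> norm d * (l * norm (z - y))"
    using lipschitz_onD[OF Flip \<open>z \<in> W\<close> yW] by (intro mult_left_mono) (auto simp: dist_norm)
  also have "\<dots> = (\<gamma> * l) * (norm d)\<^sup>2" using \<gamma>(1) by (simp add: zy power2_eq_square)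
  finally have "(norm d)\<^sup>2 * (1 - \<gamma> * l) \<le> 0" by (simp add: algebra_simps)
  then have "d = 0" using \<gamma>(2) by (simp add: mult_le_0_iff)
  then have "y = z" "v = - F z" using zy by (auto simp: d_def eq_neg_iff_add_eq_0)
  then show ?thesis using yv by simp
qed

text \<open>
  The price of evaluating a cocoercive operator at \<open>p\<close> instead of \<open>c\<close>; it is the quantity that enters
  the definition of the gap \<open>\<Delta>\<close>. The bound is Young's inequality.
\<close>
lemma cocoercive_delayed:
  assumes C: "cocoercive \<alpha> W C" and "0 < \<alpha>" and "p \<in> W" "z \<in> W"
  shows "- ((norm (c - p))\<^sup>2 / (4 * \<alpha>)) \<le> inner (c - z) (C p - C z)"
proof -
  let ?g = "C p - C z"
  have "\<alpha> * (norm ?g)\<^sup>2 \<le> inner (p - z) ?g" using assms by (auto simp: cocoercive_def)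
  moreover have "- (norm (c - p) * norm ?g) \<le> inner (c - p) ?g"
    using Cauchy_Schwarz_ineq2[of "c - p" ?g] by linarith
  moreover have "norm (c - p) * norm ?g \<le> \<alpha> * (norm ?g)\<^sup>2 + (norm (c - p))\<^sup>2 / (4 * \<alpha>)"
  proof -
    have "0 \<le> (2 * \<alpha> * norm ?g - norm (c - p))\<^sup>2 / (4 * \<alpha>)" using \<open>0 < \<alpha>\<close> by simp
    also have "\<dots> = \<alpha> * (norm ?g)\<^sup>2 + (norm (c - p))\<^sup>2 / (4 * \<alpha>) - norm (c - p) * norm ?g"
      using \<open>0 < \<alpha>\<close> by (simp add: power2_diff power2_eq_square field_simps)
    finally show ?thesis by simp
  qed
  moreover have "inner (c - z) ?g = inner (c - p) ?g + inner (p - z) ?g"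
    by (simp flip: inner_add_left)
  ultimately show ?thesis by linarith
qed

lemma cocoercive_monotone_lipschitz:
  assumes C: "cocoercive \<alpha> W C" and "0 < \<alpha>"
  shows "\<And>x y. x \<in> W \<Longrightarrow> y \<in> W \<Longrightarrow> 0 \<le> inner (x - y) (C x - C y)"
    and "(1 / \<alpha>)-lipschitz_on W C"
proof -
  have coco: "\<alpha> * (norm (C x - C y))\<^sup>2 \<le> inner (x - y) (C x - C y)" if "x \<in> W" "y \<in> W" for x y
    using C that by (auto simp: cocoercive_def)
  show "0 \<le> inner (x - y) (C x - C y)" if "x \<in> W" "y \<in> W" for x y
    using coco[OF that] \<open>0 < \<alpha>\<close> by (meson order_trans less_imp_le mult_nonneg_nonneg zero_le_power2)
  show "(1 / \<alpha>)-lipschitz_on W C"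
  proof (rule lipschitz_onI)
    fix x y assume "x \<in> W" "y \<in> W"
    then have "\<alpha> * (norm (C x - C y))\<^sup>2 \<le> norm (x - y) * norm (C x - C y)"
      using coco norm_cauchy_schwarz order_trans by blast
    then have "\<alpha> * norm (C x - C y) \<le> norm (x - y)"
      by (cases "norm (C x - C y) = 0") (auto simp: power2_eq_square)
    then show "dist (C x) (C y) \<le> 1 / \<alpha> * dist x y"
      using \<open>0 < \<alpha>\<close> by (simp add: dist_norm field_simps)
  qed (use \<open>0 < \<alpha>\<close> in simp)
qed

section \<open>Relaxed projections onto separating half-spaces\<close>

text \<open>
  One relaxed projection step: \<open>w'\<close> is the projection of \<open>w\<close> onto the half-space
  \<open>{z. \<Delta> \<le> \<langle>w - z, t\<rangle>}\<close> with relaxation \<open>lam\<close>. The squared distance decreases by at least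
  \<open>2 / lam - 1 \<ge> \<epsilon> / 2\<close> times the squared length of the step.
\<close>
lemma fejer_step:
  fixes w w' t z :: "'a::real_inner"
  assumes lam: "0 < lam" "lam \<le> 2 - \<epsilon>" and "0 < \<epsilon>" "\<epsilon> < 1"
    and step: "0 < \<Delta> \<Longrightarrow> w' = w - (lam * \<Delta> / (norm t)\<^sup>2) *\<^sub>R t"
    and stay: "\<not> 0 < \<Delta> \<Longrightarrow> w' = w"
    and sep: "\<Delta> \<le> inner (w - z) t"
  shows "(norm (w' - z))\<^sup>2 + \<epsilon> / 2 * (norm (w' - w))\<^sup>2 \<le> (norm (w - z))\<^sup>2"
    and "lam * \<Delta> \<le> norm (w' - w) * norm t"
proof -
  show "(norm (w' - z))\<^sup>2 + \<epsilon> / 2 * (norm (w' - w))\<^sup>2 \<le> (norm (w - z))\<^sup>2"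
  proof (cases "0 < \<Delta>")
    case True
    define \<theta> where "\<theta> = lam * \<Delta> / (norm t)\<^sup>2"
    have "t \<noteq> 0" using sep True by auto
    then have \<theta>: "\<theta> * (norm t)\<^sup>2 = lam * \<Delta>" "0 < \<theta>" using lam True by (auto simp: \<theta>_def)
    have w': "w' = w - \<theta> *\<^sub>R t" using step[OF True] by (simp add: \<theta>_def)
    have "(norm (w' - z))\<^sup>2 = (norm ((w - z) + (- \<theta>) *\<^sub>R t))\<^sup>2" by (simp add: w' algebra_simps)
    also have "\<dots> = (norm (w - z))\<^sup>2 - 2 * \<theta> * inner (w - z) t + \<theta>\<^sup>2 * (norm t)\<^sup>2"
      by (simp only: norm_add_scaleR_sq) simp
    also have "\<dots> \<le> (norm (w - z))\<^sup>2 - 2 * \<theta> * \<Delta> + \<theta>\<^sup>2 * (norm t)\<^sup>2"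
      using sep \<theta>(2) by simp
    also have "2 * \<theta> * \<Delta> = (2 / lam) * (\<theta>\<^sup>2 * (norm t)\<^sup>2)"
    proof -
      have "\<theta>\<^sup>2 * (norm t)\<^sup>2 = \<theta> * (lam * \<Delta>)" by (simp add: power2_eq_square[of \<theta>] \<theta>(1) mult.assoc)
      then show ?thesis using lam(1) by simp
    qed
    also have "\<theta>\<^sup>2 * (norm t)\<^sup>2 = (norm (w' - w))\<^sup>2" by (simp add: w' power_mult_distrib)
    finally have *: "(norm (w' - z))\<^sup>2 \<le> (norm (w - z))\<^sup>2 - (2 / lam - 1) * (norm (w' - w))\<^sup>2"
      by (simp add: algebra_simps)
    have "(1 + \<epsilon> / 2) * lam \<le> (1 + \<epsilon> / 2) * (2 - \<epsilon>)" using lam \<open>0 < \<epsilon>\<close> by (intro mult_left_mono) auto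
    also have "\<dots> \<le> 2" by (simp add: algebra_simps)
    finally have "\<epsilon> / 2 \<le> 2 / lam - 1" using lam(1) by (simp add: field_simps)
    then have "\<epsilon> / 2 * (norm (w' - w))\<^sup>2 \<le> (2 / lam - 1) * (norm (w' - w))\<^sup>2" by (intro mult_right_mono) auto
    then show ?thesis using * by linarith
  qed (simp add: stay)
  show "lam * \<Delta> \<le> norm (w' - w) * norm t"
  proof (cases "0 < \<Delta>")
    case True
    then have "t \<noteq> 0" using sep by auto
    then show ?thesis using step[OF True] lam True by (simp add: power2_eq_square)
  next
    case False
    then have "lam * \<Delta> \<le> 0" using lam by (simp add: mult_le_0_iff)
    then show ?thesis using stay[OF False] by simp
  qed
qed

lemma fejer_monotone_summable:
  fixes w :: "nat \<Rightarrow> 'a::real_inner"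
  assumes "0 < q" and dec: "\<And>n. (norm (w (Suc n) - z))\<^sup>2 + q * (norm (w (Suc n) - w n))\<^sup>2 \<le> (norm (w n - z))\<^sup>2"
  shows "summable (\<lambda>n. (norm (w (Suc n) - w n))\<^sup>2)"
    and "convergent (\<lambda>n. norm (w n - z))"
    and "norm (w n - z) \<le> norm (w 0 - z)"
proof -
  have le: "norm (w (Suc n) - z) \<le> norm (w n - z)" for n
  proof -
    have "0 \<le> q * (norm (w (Suc n) - w n))\<^sup>2" using \<open>0 < q\<close> by simp
    then have "(norm (w (Suc n) - z))\<^sup>2 \<le> (norm (w n - z))\<^sup>2" using dec[of n] by linarith
    then show ?thesis by (rule power2_le_imp_le) simp
  qed
  then have dseq: "decseq (\<lambda>n. norm (w n - z))" by (rule decseq_SucI)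
  then show "norm (w n - z) \<le> norm (w 0 - z)" by (simp add: decseq_def)
  show "convergent (\<lambda>n. norm (w n - z))"
    using decseq_convergent[OF dseq, of 0] by (auto simp: convergent_def)
  have "(\<Sum>i<n. (norm (w (Suc i) - w i))\<^sup>2) \<le> ((norm (w 0 - z))\<^sup>2 - (norm (w n - z))\<^sup>2) / q" for n
  proof (induction n)
    case (Suc n)
    have "(norm (w (Suc n) - w n))\<^sup>2 \<le> ((norm (w n - z))\<^sup>2 - (norm (w (Suc n) - z))\<^sup>2) / q"
      using dec[of n] \<open>0 < q\<close> by (simp add: field_simps)
    then have "(\<Sum>i<Suc n. (norm (w (Suc i) - w i))\<^sup>2)
        \<le> ((norm (w 0 - z))\<^sup>2 - (norm (w n - z))\<^sup>2) / q + ((norm (w n - z))\<^sup>2 - (norm (w (Suc n) - z))\<^sup>2) / q"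
      using Suc by simp
    also have "\<dots> = ((norm (w 0 - z))\<^sup>2 - (norm (w (Suc n) - z))\<^sup>2) / q"
      by (simp flip: add_divide_distrib)
    finally show ?case .
  qed simp
  moreover have "((norm (w 0 - z))\<^sup>2 - (norm (w n - z))\<^sup>2) / q \<le> (norm (w 0 - z))\<^sup>2 / q" for n
    using \<open>0 < q\<close> by (intro divide_right_mono) auto
  ultimately have "(\<Sum>i<n. (norm (w (Suc i) - w i))\<^sup>2) \<le> (norm (w 0 - z))\<^sup>2 / q" for n
    by (meson order_trans)
  then show "summable (\<lambda>n. (norm (w (Suc n) - w n))\<^sup>2)"
    by (intro bounded_imp_summable[of _ "(norm (w 0 - z))\<^sup>2 / q"])
       (simp_all add: lessThan_Suc_atMost[symmetric] del: sum.lessThan_Suc)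
qed

lemma tendsto_zero_of_power2:
  fixes f :: "nat \<Rightarrow> real"
  assumes "(\<lambda>n. (f n)\<^sup>2) \<longlonglongrightarrow> 0"
  shows "f \<longlonglongrightarrow> 0"
proof -
  have "(\<lambda>n. sqrt ((f n)\<^sup>2)) \<longlonglongrightarrow> sqrt 0" by (intro tendsto_real_sqrt assms)
  then show ?thesis by (simp add: tendsto_rabs_zero_iff)
qed

text \<open>
  Here \<open>D\<close> is the distance \<open>\<parallel>w - c\<parallel>\<close>, \<open>\<tau>\<close> the norm of the normal vector, \<open>S\<close> the step length and \<open>r\<close> a
  vanishing error. The quadratic lower bound on \<open>\<Delta>\<close> against the linear upper bound keeps \<open>D\<close> bounded;
  then \<open>\<tau>\<close> is bounded, the positive part of \<open>\<Delta>\<close> vanishes because \<open>S\<close> does, and the lower bound gives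
  the claim.
\<close>
lemma gap_vanishes:
  fixes D r \<Delta> \<tau> S lam :: "nat \<Rightarrow> real"
  assumes "0 < \<delta>" "0 < \<epsilon>" "0 \<le> B" "0 \<le> k"
    and D: "\<And>n. 0 \<le> D n" and r: "\<And>n. 0 \<le> r n" "r \<longlonglongrightarrow> 0" and S: "\<And>n. 0 \<le> S n" "S \<longlonglongrightarrow> 0"
    and lam: "\<And>n. \<epsilon> \<le> lam n"
    and lower: "\<And>n. \<delta> * (D n)\<^sup>2 - r n * D n - r n \<le> \<Delta> n"
    and upper: "\<And>n. \<Delta> n \<le> B * \<tau> n" and step: "\<And>n. lam n * \<Delta> n \<le> S n * \<tau> n"
    and \<tau>: "\<And>n. 0 \<le> \<tau> n" "\<And>n. \<tau> n \<le> k * D n + r n"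
  shows "D \<longlonglongrightarrow> 0"
proof -
  obtain b where b: "\<And>n. r n \<le> b"
    using convergent_imp_Bseq[of r] r unfolding convergent_def Bseq_def by (metis abs_of_nonneg real_norm_def)
  have "0 \<le> b" using b[of 0] r(1)[of 0] by linarith
  \<comment> \<open>For \<open>D > 1\<close> the two bounds on \<open>\<Delta>\<close> give \<open>\<delta> D \<le> B k + B b + 2 b\<close>.\<close>
  define m where "m = max 1 ((B * k + B * b + 2 * b) / \<delta>)"
  have Dm: "D n \<le> m" for n
  proof (cases "D n \<le> 1")
    case False
    have "\<delta> * (D n)\<^sup>2 \<le> B * (k * D n + r n) + r n * D n + r n"
      using lower[of n] upper[of n] mult_left_mono[OF \<tau>(2)[of n] \<open>0 \<le> B\<close>] by linarith
    also have "\<dots> \<le> B * (k * D n + b * D n) + b * D n + b * D n"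
    proof -
      have "b * 1 \<le> b * D n" using False \<open>0 \<le> b\<close> by (intro mult_left_mono) auto
      then have rb: "r n \<le> b * D n" using b[of n] by linarith
      have "B * (k * D n + r n) \<le> B * (k * D n + b * D n)"
        using rb \<open>0 \<le> B\<close> by (intro mult_left_mono) auto
      moreover have "r n * D n \<le> b * D n" using b D by (intro mult_right_mono) auto
      ultimately show ?thesis using rb by linarith
    qed
    finally have "(\<delta> * D n) * D n \<le> (B * k + B * b + 2 * b) * D n"
      by (simp add: algebra_simps power2_eq_square)
    then have "\<delta> * D n \<le> B * k + B * b + 2 * b" using False by (simp add: mult_le_cancel_right)
    then have "D n \<le> (B * k + B * b + 2 * b) / \<delta>" using \<open>0 < \<delta>\<close> by (simp add: field_simps)
    then show ?thesis by (simp add: m_def)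
  qed (simp add: m_def)
  have "0 \<le> m" by (simp add: m_def)
  have le: "(D n)\<^sup>2 \<le> (S n * ((k * m + b) / \<epsilon>) + r n * m + r n) / \<delta>" for n
  proof -
    have St: "S n * \<tau> n \<le> S n * (k * m + b)"
      using \<tau>(2)[of n] b[of n] mult_left_mono[OF Dm \<open>0 \<le> k\<close>, of n] S(1)[of n]
      by (intro mult_left_mono) linarith+
    have nn: "0 \<le> S n * (k * m + b)"
      using S(1)[of n] \<open>0 \<le> k\<close> \<open>0 \<le> m\<close> \<open>0 \<le> b\<close> by simp
    have "\<epsilon> * \<Delta> n \<le> S n * (k * m + b)"
    proof (cases "0 \<le> \<Delta> n")
      case True
      then have "\<epsilon> * \<Delta> n \<le> lam n * \<Delta> n" using lam by (intro mult_right_mono)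
      then show ?thesis using step[of n] St by linarith
    next
      case False
      then have "\<epsilon> * \<Delta> n \<le> 0" using \<open>0 < \<epsilon>\<close> by (simp add: mult_le_0_iff)
      then show ?thesis using nn by linarith
    qed
    then have "\<Delta> n \<le> S n * ((k * m + b) / \<epsilon>)" using \<open>0 < \<epsilon>\<close> by (simp add: field_simps)
    moreover have "r n * D n \<le> r n * m" using Dm r by (intro mult_left_mono)
    ultimately have "\<delta> * (D n)\<^sup>2 \<le> S n * ((k * m + b) / \<epsilon>) + r n * m + r n" using lower[of n] by linarith
    then show ?thesis using \<open>0 < \<delta>\<close> by (simp add: field_simps)
  qed
  have "(\<lambda>n. (S n * ((k * m + b) / \<epsilon>) + r n * m + r n) / \<delta>) \<longlonglongrightarrow> (0 * ((k * m + b) / \<epsilon>) + 0 * m + 0) / \<delta>"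
    using \<open>0 < \<delta>\<close> by (intro tendsto_intros S r) auto
  then have "(\<lambda>n. (D n)\<^sup>2) \<longlonglongrightarrow> 0"
    using tendsto_sandwich[of "\<lambda>_. 0" "\<lambda>n. (D n)\<^sup>2" sequentially "\<lambda>n. (S n * ((k * m + b) / \<epsilon>) + r n * m + r n) / \<delta>" 0] le
    by simp
  then show ?thesis by (rule tendsto_zero_of_power2)
qed

section \<open>Lipschitzian maps\<close>

text \<open>
  Only the existence of a Lipschitz constant matters for vanishing differences; hiding it gives
  structural rules without bookkeeping.
\<close>
definition lipschitzian :: "'a::metric_space set \<Rightarrow> ('a \<Rightarrow> 'b::metric_space) \<Rightarrow> bool" where
  "lipschitzian U f \<longleftrightarrow> (\<exists>c. c-lipschitz_on U f)"

named_theorems lipschitzian_intros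

lemma lipschitzianI: "c-lipschitz_on U f \<Longrightarrow> lipschitzian U f"
  by (auto simp: lipschitzian_def)

lemma lipschitzian_const [lipschitzian_intros]: "lipschitzian U (\<lambda>x. c)"
  by (rule lipschitzianI[OF lipschitz_on_constant])

lemma lipschitzian_add [lipschitzian_intros]:
  fixes f g :: "_ \<Rightarrow> 'b::real_normed_vector"
  shows "lipschitzian U f \<Longrightarrow> lipschitzian U g \<Longrightarrow> lipschitzian U (\<lambda>x. f x + g x)"
  unfolding lipschitzian_def using lipschitz_on_add by blast

lemma lipschitzian_diff [lipschitzian_intros]:
  fixes f g :: "_ \<Rightarrow> 'b::real_normed_vector"
  shows "lipschitzian U f \<Longrightarrow> lipschitzian U g \<Longrightarrow> lipschitzian U (\<lambda>x. f x - g x)"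
  unfolding lipschitzian_def using lipschitz_on_diff by blast

lemma lipschitzian_sum [lipschitzian_intros]:
  fixes f :: "'i \<Rightarrow> _ \<Rightarrow> 'b::real_normed_vector"
  shows "(\<And>i. i \<in> J \<Longrightarrow> lipschitzian U (f i)) \<Longrightarrow> lipschitzian U (\<lambda>x. \<Sum>i\<in>J. f i x)"
  by (induction J rule: infinite_finite_induct) (auto intro!: lipschitzian_intros)

lemma lipschitzian_Pair [lipschitzian_intros]:
  "lipschitzian U f \<Longrightarrow> lipschitzian U g \<Longrightarrow> lipschitzian U (\<lambda>x. (f x, g x))"
  unfolding lipschitzian_def using lipschitz_on_Pair by blast

lemma lipschitzian_compose:
  "lipschitzian V g \<Longrightarrow> lipschitzian U f \<Longrightarrow> f ` U \<subseteq> V \<Longrightarrow> lipschitzian U (\<lambda>x. g (f x))"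
  unfolding lipschitzian_def using lipschitz_on_compose2 lipschitz_on_subset by metis

lemma lipschitzian_bounded_linear:
  "bounded_linear f \<Longrightarrow> lipschitzian U f"
  by (metis bounded_linear.lipschitz_boundE lipschitzian_def)

lemma lipschitzian_vec [lipschitzian_intros]:
  fixes f :: "'i::finite \<Rightarrow> _ \<Rightarrow> 'b::real_normed_vector"
  assumes "\<And>i. lipschitzian U (f i)"
  shows "lipschitzian U (\<lambda>x. \<chi> i. f i x)"
proof -
  obtain c where c: "\<And>i. (c i)-lipschitz_on U (f i)" using assms unfolding lipschitzian_def by metis
  have "(\<Sum>i\<in>UNIV. c i)-lipschitz_on U (\<lambda>x. \<chi> i. f i x)"
  proof (rule lipschitz_onI)
    fix x y assume xy: "x \<in> U" "y \<in> U"
    have "dist (\<chi> i. f i x) (\<chi> i. f i y) \<le> (\<Sum>i\<in>UNIV. dist (f i x) (f i y))"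
      by (simp add: dist_vec_def L2_set_le_sum)
    also have "\<dots> \<le> (\<Sum>i\<in>UNIV. c i * dist x y)"
      using c xy by (intro sum_mono lipschitz_onD)
    finally show "dist (\<chi> i. f i x) (\<chi> i. f i y) \<le> (\<Sum>i\<in>UNIV. c i) * dist x y"
      by (simp add: sum_distrib_right)
  qed (use c in \<open>auto intro: sum_nonneg lipschitz_on_nonneg\<close>)
  then show ?thesis by (rule lipschitzianI)
qed

lemma lipschitzian_tendsto_diff:
  fixes g :: "'a::real_normed_vector \<Rightarrow> 'b::real_normed_vector"
  assumes "lipschitzian U g" "\<And>n. X n \<in> U" "\<And>n. Y n \<in> U" "((\<lambda>n. X n - Y n) \<longlongrightarrow> 0) F"
  shows "((\<lambda>n. g (X n) - g (Y n)) \<longlongrightarrow> 0) F"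
proof -
  obtain c where c: "c-lipschitz_on U g" using assms(1) by (auto simp: lipschitzian_def)
  show ?thesis
  proof (rule Lim_null_comparison)
    show "eventually (\<lambda>n. norm (g (X n) - g (Y n)) \<le> c * norm (X n - Y n)) F"
      using lipschitz_onD[OF c assms(2,3)] by (intro always_eventually) (simp add: dist_norm)
    show "((\<lambda>n. c * norm (X n - Y n)) \<longlongrightarrow> 0) F"
      using tendsto_mult_right_zero[OF tendsto_norm_zero[OF assms(4)]] .
  qed
qed

section \<open>Bounded delays and block activation\<close>

text \<open>
  A delay of at most \<open>N\<close> spans at most \<open>N\<close> increments.
\<close>
lemma bounded_delay_tendsto:
  fixes w :: "nat \<Rightarrow> 'a::real_normed_vector"
  assumes lim: "(\<lambda>n. w (Suc n) - w n) \<longlonglongrightarrow> 0" and \<tau>: "\<And>n. \<tau> n \<le> n" "\<And>n. n \<le> \<tau> n + N"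
  shows "(\<lambda>n. w (\<tau> n) - w n) \<longlonglongrightarrow> 0"
proof (rule LIMSEQ_I)
  fix e :: real assume "0 < e"
  define b where "b = e / real (Suc N)"
  have "0 < b" using \<open>0 < e\<close> by (simp add: b_def)
  then obtain n0 where n0: "\<And>n. n0 \<le> n \<Longrightarrow> norm (w (Suc n) - w n) < b"
    using LIMSEQ_D[OF lim, of b] by auto
  have drift: "norm (w (m + d) - w m) \<le> real d * b" if "n0 \<le> m" for m d
  proof (induction d)
    case (Suc d)
    have "norm (w (m + Suc d) - w m) \<le> norm (w (Suc (m + d)) - w (m + d)) + norm (w (m + d) - w m)"
      using norm_triangle_ineq[of "w (Suc (m + d)) - w (m + d)" "w (m + d) - w m"] by simp
    also have "\<dots> \<le> b + real d * b" using Suc n0[of "m + d"] that by linarith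
    finally show ?case by (simp add: algebra_simps)
  qed simp
  show "\<exists>n0. \<forall>n\<ge>n0. norm (w (\<tau> n) - w n - 0) < e"
  proof (intro exI allI impI)
    fix n assume n: "n0 + N \<le> n"
    have "norm (w (\<tau> n + (n - \<tau> n)) - w (\<tau> n)) \<le> real (n - \<tau> n) * b"
      by (rule drift) (use \<tau>(2)[of n] n in linarith)
    also have "\<dots> \<le> real N * b" using \<tau>(2)[of n] \<open>0 < b\<close> by (intro mult_right_mono) auto
    also have "\<dots> < real (Suc N) * b" using \<open>0 < b\<close> by simp
    also have "\<dots> = e" by (simp add: b_def)
    finally show "norm (w (\<tau> n) - w n - 0) < e" using \<tau>(1)[of n] by (simp add: norm_minus_commute)
  qed
qed

text \<open>
  \<open>l i n\<close> is the last time up to \<open>n\<close> at which index \<open>i\<close> was active. It exists since all indices are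
  active at time \<open>0\<close>.
\<close>
lemma last_activation:
  fixes J :: "nat \<Rightarrow> 'i set"
  assumes J0: "J 0 = UNIV" and cover: "\<forall>n. (\<Union>j\<in>{n..n+P}. J j) = UNIV"
  obtains l :: "'i \<Rightarrow> nat \<Rightarrow> nat" where "\<And>i n. l i n \<le> n" "\<And>i n. n \<le> l i n + P" "\<And>i n. i \<in> J (l i n)"
    "\<And>i n m. l i n < m \<Longrightarrow> m \<le> n \<Longrightarrow> i \<notin> J m"
proof -
  define l where "l i n = Max {j. j \<le> n \<and> i \<in> J j}" for i n
  have fin: "finite {j. j \<le> n \<and> i \<in> J j}" for i n by (rule finite_subset[of _ "{..n}"]) auto
  have "l i n \<in> {j. j \<le> n \<and> i \<in> J j}" for i n
    unfolding l_def using J0 by (intro Max_in fin) auto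
  then have l: "l i n \<le> n" "i \<in> J (l i n)" for i n by auto
  have max: "j \<le> l i n" if "j \<le> n" "i \<in> J j" for i j n
    unfolding l_def using that by (intro Max_ge fin) auto
  have "n \<le> l i n + P" for i n
  proof (cases "n \<le> P")
    case False
    have "i \<in> (\<Union>j\<in>{n - P..n - P + P}. J j)" using cover by blast
    then obtain j where "n - P \<le> j" "j \<le> n" "i \<in> J j" using False by auto
    then show ?thesis using max[of j n i] by linarith
  qed simp
  moreover have "i \<notin> J m" if "l i n < m" "m \<le> n" for i n m using max[of m n i] that by auto
  ultimately show ?thesis using that l by blast
qed

lemma frozen_since:
  fixes f :: "nat \<Rightarrow> 'a"
  assumes "\<And>m. l < m \<Longrightarrow> m \<le> n \<Longrightarrow> f m = f (m - 1)" and "l \<le> n"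
  shows "f n = f l"
  using \<open>l \<le> n\<close> assms(1)
proof (induction n rule: dec_induct)
  case (step n)
  have "f (Suc n) = f (Suc n - 1)" by (rule step.prems) (use step.hyps in auto)
  also have "f (Suc n - 1) = f l" unfolding diff_Suc_1 by (rule step.IH, rule step.prems) auto
  finally show ?case .
qed simp

section \<open>The saddle operator\<close>

lemma inner_scaled_vec_ge:
  fixes v :: "'a::real_inner ^ 'n"
  assumes "\<And>i. h i + c \<le> g i"
  shows "(\<Sum>i\<in>UNIV. h i * (norm (v $ i))\<^sup>2) + c * (norm v)\<^sup>2 \<le> inner v (\<chi> i. g i *\<^sub>R v $ i)"
proof -
  have "(\<Sum>i\<in>UNIV. h i * (norm (v $ i))\<^sup>2) + c * (norm v)\<^sup>2 = (\<Sum>i\<in>UNIV. (h i + c) * (norm (v $ i))\<^sup>2)"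
    by (simp add: power2_norm_eq_inner inner_vec_def sum_distrib_left sum.distrib distrib_right)
  also have "\<dots> \<le> (\<Sum>i\<in>UNIV. g i * (norm (v $ i))\<^sup>2)"
    using assms by (intro sum_mono mult_right_mono) auto
  finally show ?thesis by (simp add: inner_vec_def power2_norm_eq_inner)
qed

lemma norm_scaled_vec_le:
  fixes v :: "'a::real_inner ^ 'n"
  assumes "\<And>i. \<bar>g i\<bar> \<le> c"
  shows "norm (\<chi> i. g i *\<^sub>R v $ i) \<le> c * norm v"
proof -
  have "0 \<le> c" using assms[of undefined] by linarith
  have "norm (\<chi> i. g i *\<^sub>R v $ i) \<le> L2_set (\<lambda>i. c * norm (v $ i)) UNIV"
    unfolding norm_vec_def using assms by (intro L2_set_mono) (auto intro: mult_right_mono)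
  also have "\<dots> = c * norm v" using \<open>0 \<le> c\<close> by (simp add: norm_vec_def L2_set_right_distrib)
  finally show ?thesis .
qed

lemma norm_Pair_le_mult:
  assumes "norm a' \<le> c * norm a" "norm b' \<le> c * norm b" "0 \<le> c"
  shows "norm (a', b') \<le> c * norm (a, b)"
proof -
  have "(norm a')\<^sup>2 + (norm b')\<^sup>2 \<le> (c * norm a)\<^sup>2 + (c * norm b)\<^sup>2"
    using assms by (intro add_mono power_mono) auto
  then have "sqrt ((norm a')\<^sup>2 + (norm b')\<^sup>2) \<le> sqrt (c\<^sup>2 * ((norm a)\<^sup>2 + (norm b)\<^sup>2))"
    by (simp add: power_mult_distrib distrib_left)
  then show ?thesis using \<open>0 \<le> c\<close> by (simp add: norm_Pair real_sqrt_mult)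
qed

text \<open>
  Points of the product space are quadruples of a primal point, the two auxiliary points on which \<open>B\<close>
  and \<open>D\<close> act, and a dual point.
\<close>
abbreviation px :: "'a \<times> 'b \<times> 'b \<times> 'b \<Rightarrow> 'a" where "px w \<equiv> fst w"
abbreviation py :: "'a \<times> 'b \<times> 'b \<times> 'b \<Rightarrow> 'b" where "py w \<equiv> fst (snd w)"
abbreviation pz :: "'a \<times> 'b \<times> 'b \<times> 'b \<Rightarrow> 'b" where "pz w \<equiv> fst (snd (snd w))"
abbreviation pv :: "'a \<times> 'b \<times> 'b \<times> 'b \<Rightarrow> 'b" where "pv w \<equiv> snd (snd (snd w))"

lemma norm_quad_sq:
  fixes w :: "'a::real_inner \<times> 'b::real_inner \<times> 'b \<times> 'b"
  shows "(norm w)\<^sup>2 = (norm (px w))\<^sup>2 + (norm (py w))\<^sup>2 + (norm (pz w))\<^sup>2 + (norm (pv w))\<^sup>2"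
  by (simp add: power2_norm_eq_inner inner_prod_def)

lemma tendsto_vec_Pair_zeroI:
  fixes f :: "'n \<Rightarrow> ('a::real_normed_vector ^ 'i) \<times> ('b::real_normed_vector ^ 'k) \<times> ('b ^ 'k) \<times> ('b ^ 'k)"
  assumes "\<And>i. ((\<lambda>n. px (f n) $ i) \<longlongrightarrow> 0) F" "\<And>k. ((\<lambda>n. py (f n) $ k) \<longlongrightarrow> 0) F"
    "\<And>k. ((\<lambda>n. pz (f n) $ k) \<longlongrightarrow> 0) F" "\<And>k. ((\<lambda>n. pv (f n) $ k) \<longlongrightarrow> 0) F"
  shows "(f \<longlongrightarrow> 0) F"
proof -
  have "((\<lambda>n. px (f n)) \<longlongrightarrow> 0) F" "((\<lambda>n. py (f n)) \<longlongrightarrow> 0) F" "((\<lambda>n. pz (f n)) \<longlongrightarrow> 0) F"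
    "((\<lambda>n. pv (f n)) \<longlongrightarrow> 0) F"
    using assms by (auto intro!: vec_tendstoI)
  from tendsto_Pair[OF this(1) tendsto_Pair[OF this(2) tendsto_Pair[OF this(3,4)]]]
  show ?thesis by (simp flip: zero_prod_def)
qed

text \<open>
  One cocoercivity constant serves all operators; the smallest of the individual ones is admissible.
\<close>
locale saddle_problem =
  fixes H :: "'i::finite \<Rightarrow> 'h::real_inner set" and G :: "'k::finite \<Rightarrow> 'g::real_inner set"
    and s :: "'i \<Rightarrow> 'h" and r :: "'k \<Rightarrow> 'g"
    and A :: "'i \<Rightarrow> 'h \<Rightarrow> 'h set" and C Q :: "'i \<Rightarrow> 'h \<Rightarrow> 'h"
    and R :: "'h ^ 'i \<Rightarrow> 'h ^ 'i"
    and Bm :: "'k \<Rightarrow> 'g \<Rightarrow> 'g set" and Bc Bl :: "'k \<Rightarrow> 'g \<Rightarrow> 'g"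
    and Dm :: "'k \<Rightarrow> 'g \<Rightarrow> 'g set" and Dc Dl :: "'k \<Rightarrow> 'g \<Rightarrow> 'g"
    and L :: "'k \<Rightarrow> 'i \<Rightarrow> 'h \<Rightarrow> 'g"
    and \<alpha>l :: "'i \<Rightarrow> real" and \<beta>l \<delta>l :: "'k \<Rightarrow> real" and \<kappa> \<alpha> :: real
  assumes H: "\<And>i. hilbert_space (H i)" and G: "\<And>k. hilbert_space (G k)"
    and s: "\<And>i. s i \<in> H i" and r: "\<And>k. r k \<in> G k"
    and A: "\<And>i. maximally_monotone (H i) (A i)"
    and C: "\<And>i. cocoercive \<alpha> (H i) (C i)"
    and Q: "\<And>i. monotone_lipschitz (\<alpha>l i) (H i) (Q i)"
    and Bm: "\<And>k. maximally_monotone (G k) (Bm k)"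
    and Bc: "\<And>k. cocoercive \<alpha> (G k) (Bc k)"
    and Bl: "\<And>k. monotone_lipschitz (\<beta>l k) (G k) (Bl k)"
    and Dm: "\<And>k. maximally_monotone (G k) (Dm k)"
    and Dc: "\<And>k. cocoercive \<alpha> (G k) (Dc k)"
    and Dl: "\<And>k. monotone_lipschitz (\<delta>l k) (G k) (Dl k)"
    and L: "\<And>k i. bounded_linear_between (H i) (G k) (L k i)"
    and R: "monotone_lipschitz \<kappa> (direct_sum H) R"
    and \<alpha>: "0 < \<alpha>"
begin

abbreviation L_adj :: "'k \<Rightarrow> 'i \<Rightarrow> 'g \<Rightarrow> 'h" where
  "L_adj k i \<equiv> adjoint_from (H i) (L k i)"

definition W :: "(('h ^ 'i) \<times> ('g ^ 'k) \<times> ('g ^ 'k) \<times> ('g ^ 'k)) set" where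
  "W = direct_sum H \<times> direct_sum G \<times> direct_sum G \<times> direct_sum G"

definition M :: "((('h ^ 'i) \<times> ('g ^ 'k) \<times> ('g ^ 'k) \<times> ('g ^ 'k)) \<times> (('h ^ 'i) \<times> ('g ^ 'k) \<times> ('g ^ 'k) \<times> ('g ^ 'k))) set" where
  "M = {(w, m). w \<in> W \<and> (\<forall>i. px m $ i \<in> A i (px w $ i)) \<and> (\<forall>k. py m $ k \<in> Bm k (py w $ k))
    \<and> (\<forall>k. pz m $ k \<in> Dm k (pz w $ k)) \<and> pv m = 0}"

text \<open>
  The zeros of \<open>M + F + E\<close> encode the Kuhn--Tucker conditions: the fourth component of \<open>F\<close> is the
  residual of \<open>y + z = L x - r\<close>.
\<close>
definition F :: "('h ^ 'i) \<times> ('g ^ 'k) \<times> ('g ^ 'k) \<times> ('g ^ 'k) \<Rightarrow> ('h ^ 'i) \<times> ('g ^ 'k) \<times> ('g ^ 'k) \<times> ('g ^ 'k)" where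
  "F w = (\<chi> i. Q i (px w $ i) + R (px w) $ i + (\<Sum>k\<in>UNIV. L_adj k i (pv w $ k)) - s i,
          \<chi> k. Bl k (py w $ k) - pv w $ k,
          \<chi> k. Dl k (pz w $ k) - pv w $ k,
          \<chi> k. r k + py w $ k + pz w $ k - (\<Sum>i\<in>UNIV. L k i (px w $ i)))"

definition E :: "('h ^ 'i) \<times> ('g ^ 'k) \<times> ('g ^ 'k) \<times> ('g ^ 'k) \<Rightarrow> ('h ^ 'i) \<times> ('g ^ 'k) \<times> ('g ^ 'k) \<times> ('g ^ 'k)" where
  "E w = (\<chi> i. C i (px w $ i), \<chi> k. Bc k (py w $ k), \<chi> k. Dc k (pz w $ k), 0)"

definition Z :: "(('h ^ 'i) \<times> ('g ^ 'k) \<times> ('g ^ 'k) \<times> ('g ^ 'k)) set" where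
  "Z = {w. (w, - (F w + E w)) \<in> M}"

lemma subspaces: "subspace (H i)" "subspace (G k)"
  using H G by (auto simp: hilbert_space_def)

lemma mem_W_iff: "w \<in> W \<longleftrightarrow> (\<forall>i. px w $ i \<in> H i) \<and> (\<forall>k. py w $ k \<in> G k)
    \<and> (\<forall>k. pz w $ k \<in> G k) \<and> (\<forall>k. pv w $ k \<in> G k)"
  by (auto simp: W_def mem_Times_iff direct_sum_def)

lemma W_D:
  assumes "w \<in> W"
  shows "px w $ i \<in> H i" "py w $ k \<in> G k" "pz w $ k \<in> G k" "pv w $ k \<in> G k" "px w \<in> direct_sum H"
  using assms by (auto simp: mem_W_iff direct_sum_def)

lemma hilbert_W: "hilbert_space W"
  unfolding W_def using H G by (intro hilbert_space_Times hilbert_space_direct_sum)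

lemma subspace_W: "subspace W"
  using hilbert_W by (simp add: hilbert_space_def)

lemma A_in: "x \<in> H i \<Longrightarrow> u \<in> A i x \<Longrightarrow> u \<in> H i"
  and Bm_in: "y \<in> G k \<Longrightarrow> v \<in> Bm k y \<Longrightarrow> v \<in> G k"
  and Dm_in: "y \<in> G k \<Longrightarrow> v \<in> Dm k y \<Longrightarrow> v \<in> G k"
  by (rule maximally_monotone_in[OF A] maximally_monotone_in[OF Bm] maximally_monotone_in[OF Dm], assumption+)+

lemma M_subset: "M \<subseteq> W \<times> W"
proof safe
  fix w m assume "(w, m) \<in> M"
  then have w: "w \<in> W" and "\<And>i. px m $ i \<in> A i (px w $ i)" "\<And>k. py m $ k \<in> Bm k (py w $ k)"
    "\<And>k. pz m $ k \<in> Dm k (pz w $ k)" "pv m = 0"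
    by (auto simp: M_def)
  then show "w \<in> W" "m \<in> W"
    using A_in[OF W_D(1)[OF w]] Bm_in[OF W_D(2)[OF w]] Dm_in[OF W_D(3)[OF w]]
    by (auto simp: mem_W_iff[of m] subspace_0 subspaces)
qed

lemma M_monotone:
  assumes "(w, m) \<in> M" "(w', m') \<in> M"
  shows "0 \<le> inner (w - w') (m - m')"
proof -
  have W: "w \<in> W" "w' \<in> W" using assms by (auto simp: M_def)
  have "0 \<le> inner (px w $ i - px w' $ i) (px m $ i - px m' $ i)" for i
    using assms A[of i] W_D[OF W(1)] W_D[OF W(2)] by (auto simp: M_def maximally_monotone_def monotone_op_def)
  moreover have "0 \<le> inner (py w $ k - py w' $ k) (py m $ k - py m' $ k)" for k
    using assms Bm[of k] W_D[OF W(1)] W_D[OF W(2)] by (auto simp: M_def maximally_monotone_def monotone_op_def)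
  moreover have "0 \<le> inner (pz w $ k - pz w' $ k) (pz m $ k - pz m' $ k)" for k
    using assms Dm[of k] W_D[OF W(1)] W_D[OF W(2)] by (auto simp: M_def maximally_monotone_def monotone_op_def)
  moreover have "pv m = 0" "pv m' = 0" using assms by (auto simp: M_def)
  ultimately show ?thesis by (auto simp: inner_prod_def inner_vec_def intro!: add_nonneg_nonneg sum_nonneg)
qed

text \<open>
  The resolvent of \<open>M\<close> acts componentwise, being the identity on the dual component, on which \<open>M\<close>
  is zero.
\<close>
lemma M_surj:
  assumes "0 < \<gamma>" "p \<in> W"
  shows "\<exists>(w, m) \<in> M. w + \<gamma> *\<^sub>R m = p"
proof -
  have "\<exists>x u. x \<in> H i \<and> u \<in> A i x \<and> x + \<gamma> *\<^sub>R u = px p $ i" for i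
    using maximally_monotone_surj[OF H A \<open>0 < \<gamma>\<close> W_D(1)[OF \<open>p \<in> W\<close>]] by metis
  moreover have "\<exists>y u. y \<in> G k \<and> u \<in> Bm k y \<and> y + \<gamma> *\<^sub>R u = py p $ k" for k
    using maximally_monotone_surj[OF G Bm \<open>0 < \<gamma>\<close> W_D(2)[OF \<open>p \<in> W\<close>]] by metis
  moreover have "\<exists>z u. z \<in> G k \<and> u \<in> Dm k z \<and> z + \<gamma> *\<^sub>R u = pz p $ k" for k
    using maximally_monotone_surj[OF G Dm \<open>0 < \<gamma>\<close> W_D(3)[OF \<open>p \<in> W\<close>]] by metis
  ultimately obtain x u y v z t where
    x: "\<And>i. x i \<in> H i" "\<And>i. u i \<in> A i (x i)" "\<And>i. x i + \<gamma> *\<^sub>R u i = px p $ i" and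
    y: "\<And>k. y k \<in> G k" "\<And>k. v k \<in> Bm k (y k)" "\<And>k. y k + \<gamma> *\<^sub>R v k = py p $ k" and
    z: "\<And>k. z k \<in> G k" "\<And>k. t k \<in> Dm k (z k)" "\<And>k. z k + \<gamma> *\<^sub>R t k = pz p $ k"
    by metis
  let ?w = "(\<chi> i. x i, \<chi> k. y k, \<chi> k. z k, pv p)" and ?m = "(\<chi> i. u i, \<chi> k. v k, \<chi> k. t k, 0)"
  have "(?w, ?m) \<in> M" using x y z W_D(4)[OF \<open>p \<in> W\<close>] by (simp add: M_def mem_W_iff)
  moreover have "?w + \<gamma> *\<^sub>R ?m = p"
    using x y z by (simp add: prod_eq_iff vec_eq_iff)
  ultimately show ?thesis by blast
qed

lemma L_in: "x \<in> H i \<Longrightarrow> L k i x \<in> G k"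
  using L[of i k] by (auto simp: bounded_linear_between_def)

lemma L_adj_in: "L_adj k i v \<in> H i"
  by (rule adjoint_from_in[OF H L])

lemma single_valued_in:
  shows Q_in: "x \<in> H i \<Longrightarrow> Q i x \<in> H i"
    and R_in: "X \<in> direct_sum H \<Longrightarrow> R X \<in> direct_sum H"
    and Bl_in: "y \<in> G k \<Longrightarrow> Bl k y \<in> G k"
    and Dl_in: "y \<in> G k \<Longrightarrow> Dl k y \<in> G k"
    and C_in: "x \<in> H i \<Longrightarrow> C i x \<in> H i"
    and Bc_in: "y \<in> G k \<Longrightarrow> Bc k y \<in> G k"
    and Dc_in: "y \<in> G k \<Longrightarrow> Dc k y \<in> G k"
  using Q R Bl Dl C Bc Dc
  by (auto simp: monotone_lipschitz_def monotone_op_def set_operator_def cocoercive_def Pi_def)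

lemma F_in: "w \<in> W \<Longrightarrow> F w \<in> W"
  using s r R_in[of "px w"]
  by (auto simp: mem_W_iff F_def direct_sum_def
      intro!: subspaces subspace_add subspace_diff subspace_sum Q_in Bl_in Dl_in L_in L_adj_in)

lemma E_in: "w \<in> W \<Longrightarrow> E w \<in> W"
  by (auto simp: mem_W_iff E_def subspace_0 subspaces C_in Bc_in Dc_in)

text \<open>
  The contributions of \<open>L\<close> and its adjoint, and of the pairs \<open>(y, v)\<close> and \<open>(z, v)\<close>, cancel.
\<close>
lemma F_inner:
  assumes "w \<in> W" "w' \<in> W"
  shows "inner (w - w') (F w - F w')
    = (\<Sum>i\<in>UNIV. inner (px w $ i - px w' $ i) (Q i (px w $ i) - Q i (px w' $ i)))
      + inner (px w - px w') (R (px w) - R (px w'))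
      + (\<Sum>k\<in>UNIV. inner (py w $ k - py w' $ k) (Bl k (py w $ k) - Bl k (py w' $ k)))
      + (\<Sum>k\<in>UNIV. inner (pz w $ k - pz w' $ k) (Dl k (pz w $ k) - Dl k (pz w' $ k)))"
proof -
  have adj: "inner (px w $ i - px w' $ i) (L_adj k i (pv w $ k) - L_adj k i (pv w' $ k))
      = inner (L k i (px w $ i) - L k i (px w' $ i)) (pv w $ k - pv w' $ k)" for i k
    using assms
    by (simp add: inner_diff_left inner_diff_right inner_adjoint_from[OF H L, OF W_D(1)])
  have "(\<Sum>i\<in>UNIV. inner (px w $ i - px w' $ i)
        ((\<Sum>k\<in>UNIV. L_adj k i (pv w $ k)) - (\<Sum>k\<in>UNIV. L_adj k i (pv w' $ k))))
      = (\<Sum>i\<in>UNIV. \<Sum>k\<in>UNIV. inner (L k i (px w $ i) - L k i (px w' $ i)) (pv w $ k - pv w' $ k))"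
    by (simp only: adj inner_sum_right flip: sum_subtractf)
  also have "\<dots> = (\<Sum>k\<in>UNIV. inner (pv w $ k - pv w' $ k)
        ((\<Sum>i\<in>UNIV. L k i (px w $ i)) - (\<Sum>i\<in>UNIV. L k i (px w' $ i))))"
    by (subst sum.swap) (simp only: inner_commute[of "pv w $ _ - _"] inner_sum_left flip: sum_subtractf)
  finally have skew: "(\<Sum>i\<in>UNIV. inner (px w $ i - px w' $ i)
        ((\<Sum>k\<in>UNIV. L_adj k i (pv w $ k)) - (\<Sum>k\<in>UNIV. L_adj k i (pv w' $ k))))
      = (\<Sum>k\<in>UNIV. inner (pv w $ k - pv w' $ k)
        ((\<Sum>i\<in>UNIV. L k i (px w $ i)) - (\<Sum>i\<in>UNIV. L k i (px w' $ i))))" .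
  have 1: "inner (px (w - w')) (px (F w - F w'))
      = (\<Sum>i\<in>UNIV. inner (px w $ i - px w' $ i) (Q i (px w $ i) - Q i (px w' $ i)))
        + inner (px w - px w') (R (px w) - R (px w'))
        + (\<Sum>i\<in>UNIV. inner (px w $ i - px w' $ i)
            ((\<Sum>k\<in>UNIV. L_adj k i (pv w $ k)) - (\<Sum>k\<in>UNIV. L_adj k i (pv w' $ k))))"
  proof -
    have "px (F w - F w') $ i = (Q i (px w $ i) - Q i (px w' $ i)) + (R (px w) $ i - R (px w') $ i)
        + ((\<Sum>k\<in>UNIV. L_adj k i (pv w $ k)) - (\<Sum>k\<in>UNIV. L_adj k i (pv w' $ k)))" for i
      by (simp add: F_def)
    then show ?thesis by (simp only: inner_vec_def inner_add_right sum.distrib fst_diff vector_minus_component)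
  qed
  have 2: "inner (py (w - w')) (py (F w - F w'))
      = (\<Sum>k\<in>UNIV. inner (py w $ k - py w' $ k) (Bl k (py w $ k) - Bl k (py w' $ k)))
        - (\<Sum>k\<in>UNIV. inner (pv w $ k - pv w' $ k) (py w $ k - py w' $ k))"
  proof -
    have "py (F w - F w') $ k = (Bl k (py w $ k) - Bl k (py w' $ k)) - (pv w $ k - pv w' $ k)" for k
      by (simp add: F_def)
    then show ?thesis
      by (simp only: inner_vec_def inner_diff_right[of _ _ "pv w $ _ - _"] sum_subtractf
          inner_commute[of "_ - _" "pv w $ _ - _"] fst_diff snd_diff vector_minus_component)
  qed
  have 3: "inner (pz (w - w')) (pz (F w - F w'))
      = (\<Sum>k\<in>UNIV. inner (pz w $ k - pz w' $ k) (Dl k (pz w $ k) - Dl k (pz w' $ k)))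
        - (\<Sum>k\<in>UNIV. inner (pv w $ k - pv w' $ k) (pz w $ k - pz w' $ k))"
  proof -
    have "pz (F w - F w') $ k = (Dl k (pz w $ k) - Dl k (pz w' $ k)) - (pv w $ k - pv w' $ k)" for k
      by (simp add: F_def)
    then show ?thesis
      by (simp only: inner_vec_def inner_diff_right[of _ _ "pv w $ _ - _"] sum_subtractf
          inner_commute[of "_ - _" "pv w $ _ - _"] fst_diff snd_diff vector_minus_component)
  qed
  have 4: "inner (pv (w - w')) (pv (F w - F w'))
      = (\<Sum>k\<in>UNIV. inner (pv w $ k - pv w' $ k) (py w $ k - py w' $ k))
        + (\<Sum>k\<in>UNIV. inner (pv w $ k - pv w' $ k) (pz w $ k - pz w' $ k))
        - (\<Sum>k\<in>UNIV. inner (pv w $ k - pv w' $ k)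
        ((\<Sum>i\<in>UNIV. L k i (px w $ i)) - (\<Sum>i\<in>UNIV. L k i (px w' $ i))))"
  proof -
    have "pv (F w - F w') $ k = (py w $ k - py w' $ k) + (pz w $ k - pz w' $ k)
        - ((\<Sum>i\<in>UNIV. L k i (px w $ i)) - (\<Sum>i\<in>UNIV. L k i (px w' $ i)))" for k
      by (simp add: F_def)
    then show ?thesis
      by (simp only: inner_vec_def inner_add_right inner_diff_right[of _ "_ + _"] sum.distrib sum_subtractf
          snd_diff vector_minus_component)
  qed
  have "inner (w - w') (F w - F w') = inner (px (w - w')) (px (F w - F w')) + inner (py (w - w')) (py (F w - F w'))
      + inner (pz (w - w')) (pz (F w - F w')) + inner (pv (w - w')) (pv (F w - F w'))"
    by (simp add: inner_prod_def)
  then show ?thesis unfolding 1 2 3 4 skew by simp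
qed

lemma monotone_lipschitz_inner:
  assumes "monotone_lipschitz c U f" "x \<in> U" "y \<in> U"
  shows "0 \<le> inner (x - y) (f x - f y)" "inner (x - y) (f x - f y) \<le> c * (norm (x - y))\<^sup>2"
proof -
  show "0 \<le> inner (x - y) (f x - f y)"
    using assms by (auto simp: monotone_lipschitz_def monotone_op_def)
  have "norm (f x - f y) \<le> c * norm (x - y)"
    using assms lipschitz_onD[of c U f x y] by (auto simp: monotone_lipschitz_def dist_norm)
  then have "norm (x - y) * norm (f x - f y) \<le> norm (x - y) * (c * norm (x - y))"
    by (intro mult_left_mono) auto
  then show "inner (x - y) (f x - f y) \<le> c * (norm (x - y))\<^sup>2"
    using norm_cauchy_schwarz[of "x - y" "f x - f y"] by (simp add: power2_eq_square algebra_simps)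
qed

lemma F_monotone:
  assumes "w \<in> W" "w' \<in> W"
  shows "0 \<le> inner (w - w') (F w - F w')"
  unfolding F_inner[OF assms]
  by (intro add_nonneg_nonneg sum_nonneg monotone_lipschitz_inner(1)[OF Q] monotone_lipschitz_inner(1)[OF R]
      monotone_lipschitz_inner(1)[OF Bl] monotone_lipschitz_inner(1)[OF Dl] W_D[OF assms(1)] W_D[OF assms(2)])

text \<open>
  This refines a Lipschitz bound for \<open>F\<close>: each component only sees its own constant, plus \<open>\<kappa>\<close> for
  the primal ones, and the dual component contributes nothing. The step size bounds are calibrated to it.
\<close>
lemma F_inner_le:
  assumes "w \<in> W" "w' \<in> W"
  shows "inner (w - w') (F w - F w')
    \<le> (\<Sum>i\<in>UNIV. (\<alpha>l i + \<kappa>) * (norm (px w $ i - px w' $ i))\<^sup>2)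
      + (\<Sum>k\<in>UNIV. \<beta>l k * (norm (py w $ k - py w' $ k))\<^sup>2)
      + (\<Sum>k\<in>UNIV. \<delta>l k * (norm (pz w $ k - pz w' $ k))\<^sup>2)"
proof -
  have "inner (px w - px w') (R (px w) - R (px w')) \<le> \<kappa> * (norm (px w - px w'))\<^sup>2"
    by (intro monotone_lipschitz_inner(2)[OF R] W_D[OF assms(1)] W_D[OF assms(2)])
  also have "\<dots> = (\<Sum>i\<in>UNIV. \<kappa> * (norm (px w $ i - px w' $ i))\<^sup>2)"
    by (simp add: power2_norm_eq_inner inner_vec_def sum_distrib_left)
  finally have "inner (px w - px w') (R (px w) - R (px w')) \<le> (\<Sum>i\<in>UNIV. \<kappa> * (norm (px w $ i - px w' $ i))\<^sup>2)" .
  then have "inner (w - w') (F w - F w')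
    \<le> (\<Sum>i\<in>UNIV. \<alpha>l i * (norm (px w $ i - px w' $ i))\<^sup>2) + (\<Sum>i\<in>UNIV. \<kappa> * (norm (px w $ i - px w' $ i))\<^sup>2)
      + (\<Sum>k\<in>UNIV. \<beta>l k * (norm (py w $ k - py w' $ k))\<^sup>2)
      + (\<Sum>k\<in>UNIV. \<delta>l k * (norm (pz w $ k - pz w' $ k))\<^sup>2)"
    unfolding F_inner[OF assms]
    by (intro add_mono sum_mono monotone_lipschitz_inner(2)[OF Q] monotone_lipschitz_inner(2)[OF Bl]
        monotone_lipschitz_inner(2)[OF Dl] W_D[OF assms(1)] W_D[OF assms(2)])
  then show ?thesis by (simp add: distrib_right sum.distrib)
qed

lemma lipschitzian_component:
  shows "lipschitzian U (\<lambda>w :: ('h ^ 'i) \<times> ('g ^ 'k) \<times> ('g ^ 'k) \<times> ('g ^ 'k). px w $ i)"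
    and "lipschitzian U (\<lambda>w :: ('h ^ 'i) \<times> ('g ^ 'k) \<times> ('g ^ 'k) \<times> ('g ^ 'k). py w $ k)"
    and "lipschitzian U (\<lambda>w :: ('h ^ 'i) \<times> ('g ^ 'k) \<times> ('g ^ 'k) \<times> ('g ^ 'k). pz w $ k)"
    and "lipschitzian U (\<lambda>w :: ('h ^ 'i) \<times> ('g ^ 'k) \<times> ('g ^ 'k) \<times> ('g ^ 'k). pv w $ k)"
    and "lipschitzian U (\<lambda>w :: ('h ^ 'i) \<times> ('g ^ 'k) \<times> ('g ^ 'k) \<times> ('g ^ 'k). px w)"
  by (intro lipschitzian_bounded_linear bounded_linear_compose[OF bounded_linear_vec_nth] bounded_linear_intros)+

lemma F_lipschitzian: "lipschitzian W F"
proof -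
  have Q': "lipschitzian (H i) (Q i)" and Bl': "lipschitzian (G k) (Bl k)" and Dl': "lipschitzian (G k) (Dl k)"
    and R': "lipschitzian (direct_sum H) R" for i k
    using Q[of i] Bl[of k] Dl[of k] R by (auto simp: monotone_lipschitz_def intro: lipschitzianI)
  have L': "lipschitzian (H i) (L k i)" for i k
    using lipschitz_of_bounded_linear_between[OF subspaces(1) L] by (metis lipschitzianI)
  have Ladj: "lipschitzian UNIV (L_adj k i)" for i k
    using adjoint_from_bounded[OF H L] by (metis lipschitzianI)
  have 1: "lipschitzian W (\<lambda>w. Q i (px w $ i))" for i
    by (rule lipschitzian_compose[OF Q' lipschitzian_component(1)]) (auto dest: W_D)
  have "lipschitzian W (\<lambda>w. R (px w))"
    by (rule lipschitzian_compose[OF R' lipschitzian_component(5)]) (auto dest: W_D)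
  from lipschitzian_compose[OF lipschitzian_bounded_linear[OF bounded_linear_vec_nth] this]
  have 2: "lipschitzian W (\<lambda>w. R (px w) $ i)" for i by blast
  have 3: "lipschitzian W (\<lambda>w. L_adj k i (pv w $ k))" for i k
    by (rule lipschitzian_compose[OF Ladj lipschitzian_component(4)]) auto
  have 4: "lipschitzian W (\<lambda>w. Bl k (py w $ k))" for k
    by (rule lipschitzian_compose[OF Bl' lipschitzian_component(2)]) (auto dest: W_D)
  have 5: "lipschitzian W (\<lambda>w. Dl k (pz w $ k))" for k
    by (rule lipschitzian_compose[OF Dl' lipschitzian_component(3)]) (auto dest: W_D)
  have 6: "lipschitzian W (\<lambda>w. L k i (px w $ i))" for i k
    by (rule lipschitzian_compose[OF L' lipschitzian_component(1)]) (auto dest: W_D)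
  show ?thesis
    unfolding F_def[abs_def] by (intro lipschitzian_intros lipschitzian_component 1 2 3 4 5 6)
qed

lemma E_cocoercive: "cocoercive \<alpha> W E"
proof -
  have "\<alpha> * (norm (E w - E w'))\<^sup>2 \<le> inner (w - w') (E w - E w')" if "w \<in> W" "w' \<in> W" for w w'
  proof -
    have 1: "\<alpha> * (norm (px (E w - E w')))\<^sup>2 \<le> inner (px (w - w')) (px (E w - E w'))"
      using C W_D(1)[OF that(1)] W_D(1)[OF that(2)]
      unfolding power2_norm_eq_inner inner_vec_def sum_distrib_left
      by (intro sum_mono) (auto simp: E_def cocoercive_def power2_norm_eq_inner)
    have 2: "\<alpha> * (norm (py (E w - E w')))\<^sup>2 \<le> inner (py (w - w')) (py (E w - E w'))"
      using Bc W_D(2)[OF that(1)] W_D(2)[OF that(2)]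
      unfolding power2_norm_eq_inner inner_vec_def sum_distrib_left
      by (intro sum_mono) (auto simp: E_def cocoercive_def power2_norm_eq_inner)
    have 3: "\<alpha> * (norm (pz (E w - E w')))\<^sup>2 \<le> inner (pz (w - w')) (pz (E w - E w'))"
      using Dc W_D(3)[OF that(1)] W_D(3)[OF that(2)]
      unfolding power2_norm_eq_inner inner_vec_def sum_distrib_left
      by (intro sum_mono) (auto simp: E_def cocoercive_def power2_norm_eq_inner)
    have "pv (E w - E w') = 0" by (simp add: E_def)
    then show ?thesis
      using 1 2 3 unfolding norm_quad_sq inner_prod_def by (simp add: distrib_left)
  qed
  then show ?thesis by (auto simp: cocoercive_def E_in)
qed

end

lemma mem_set_plus_singleton_iff:
  fixes u a :: "'a::ab_group_add"
  shows "u \<in> S + {a} \<longleftrightarrow> u - a \<in> S"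
  by (force simp: set_plus_def algebra_simps)

lemma sum_mem_set_sum:
  fixes f :: "'k::finite \<Rightarrow> 'a::comm_monoid_add"
  assumes "\<And>k. f k \<in> S k"
  shows "(\<Sum>k\<in>UNIV. f k) \<in> (\<Sum>k\<in>UNIV. S k)"
  using assms by (auto simp: set_sum_alt)

lemma mem_parallel_sum_iff:
  "v \<in> parallel_sum U B D u \<longleftrightarrow> v \<in> U \<and> u \<in> inverse_op U B v + inverse_op U D v"
  unfolding parallel_sum_def by (subst inverse_op_def) simp

context saddle_problem
begin

abbreviation "KT \<equiv> kuhn_tucker_set H G s r A C Q R Bm Bc Bl Dm Dc Dl L"

text \<open>
  The last three conditions are the unfolded membership of \<open>L x - r\<close> in the sum of the two inverses,
  so forgetting \<open>y\<close> and \<open>z\<close> turns the zeros into the Kuhn--Tucker points.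
\<close>
lemma mem_Z_iff:
  "w \<in> Z \<longleftrightarrow> w \<in> W
    \<and> (\<forall>i. s i - (\<Sum>k\<in>UNIV. L_adj k i (pv w $ k)) \<in> A i (px w $ i) + {C i (px w $ i)} + {Q i (px w $ i)} + {R (px w) $ i})
    \<and> (\<forall>k. pv w $ k \<in> sum_op (Bm k) (Bc k) (Bl k) (py w $ k))
    \<and> (\<forall>k. pv w $ k \<in> sum_op (Dm k) (Dc k) (Dl k) (pz w $ k))
    \<and> (\<forall>k. py w $ k + pz w $ k = (\<Sum>i\<in>UNIV. L k i (px w $ i)) - r k)"
proof -
  let ?m = "- (F w + E w)"
  have 1: "px ?m $ i = s i - (\<Sum>k\<in>UNIV. L_adj k i (pv w $ k)) - R (px w) $ i - Q i (px w $ i) - C i (px w $ i)" for i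
    by (simp add: F_def E_def)
  have 2: "py ?m $ k = pv w $ k - Bl k (py w $ k) - Bc k (py w $ k)"
    and 3: "pz ?m $ k = pv w $ k - Dl k (pz w $ k) - Dc k (pz w $ k)" for k
    by (simp_all add: F_def E_def)
  have "pv ?m $ k = ((\<Sum>i\<in>UNIV. L k i (px w $ i)) - r k) - (py w $ k + pz w $ k)" for k
    by (simp add: F_def E_def)
  then have 4: "pv ?m = 0 \<longleftrightarrow> (\<forall>k. py w $ k + pz w $ k = (\<Sum>i\<in>UNIV. L k i (px w $ i)) - r k)"
    by (simp only: vec_eq_iff zero_index right_minus_eq eq_commute[of "py w $ _ + _"])
  show ?thesis
    unfolding Z_def M_def mem_Collect_eq case_prod_conv 1 2 3 4 sum_op_def mem_set_plus_singleton_iff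
    by (rule refl)
qed

lemma Z_imp_solutions:
  assumes "w \<in> Z"
  shows "(px w, pv w) \<in> KT"
    and "pv w \<in> dual_solutions H G s r A C Q R Bm Bc Bl Dm Dc Dl L"
    and "px w \<in> primal_solutions H G s r A C Q R Bm Bc Bl Dm Dc Dl L"
proof -
  have w: "w \<in> W"
    and inc: "\<And>i. s i - (\<Sum>k\<in>UNIV. L_adj k i (pv w $ k)) \<in> A i (px w $ i) + {C i (px w $ i)} + {Q i (px w $ i)} + {R (px w) $ i}"
    and B: "\<And>k. pv w $ k \<in> sum_op (Bm k) (Bc k) (Bl k) (py w $ k)"
    and D: "\<And>k. pv w $ k \<in> sum_op (Dm k) (Dc k) (Dl k) (pz w $ k)"
    and eq: "\<And>k. (\<Sum>i\<in>UNIV. L k i (px w $ i)) - r k = py w $ k + pz w $ k"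
    using assms[unfolded mem_Z_iff] by (blast, blast, blast, blast, simp)
  have xv: "px w \<in> direct_sum H" "pv w \<in> direct_sum G" using w by (auto simp: mem_W_iff direct_sum_def)
  have "(\<Sum>i\<in>UNIV. L k i (px w $ i)) - r k \<in> inverse_op (G k) (sum_op (Bm k) (Bc k) (Bl k)) (pv w $ k)
        + inverse_op (G k) (sum_op (Dm k) (Dc k) (Dl k)) (pv w $ k)" for k
    unfolding eq using B D W_D[OF w] by (intro set_plus_intro) (auto simp: inverse_op_def)
  note par = this
  then have ps: "pv w $ k \<in> parallel_sum (G k) (sum_op (Bm k) (Bc k) (Bl k)) (sum_op (Dm k) (Dc k) (Dl k))
      ((\<Sum>j\<in>UNIV. L k j (px w $ j)) - r k)" for k
    unfolding mem_parallel_sum_iff using W_D[OF w] by simp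
  show "(px w, pv w) \<in> KT" unfolding kuhn_tucker_set_def using xv inc par by simp
  show "pv w \<in> dual_solutions H G s r A C Q R Bm Bc Bl Dm Dc Dl L"
    unfolding dual_solutions_def mem_Collect_eq
    by (intro conjI bexI[of _ "px w"] allI xv inc ps)
  have "s i \<in> A i (px w $ i) + {C i (px w $ i)} + {Q i (px w $ i)} + {R (px w) $ i}
          + (\<Sum>k\<in>UNIV. L_adj k i `
               parallel_sum (G k) (sum_op (Bm k) (Bc k) (Bl k)) (sum_op (Dm k) (Dc k) (Dl k))
                 ((\<Sum>j\<in>UNIV. L k j (px w $ j)) - r k))" (is "_ \<in> ?S + (\<Sum>k\<in>UNIV. ?T k)") for i
  proof -
    have "(\<Sum>k\<in>UNIV. L_adj k i (pv w $ k)) \<in> (\<Sum>k\<in>UNIV. ?T k)"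
      by (rule sum_mem_set_sum) (rule imageI, rule ps)
    from set_plus_intro[OF inc[of i] this] show ?thesis by (simp only: diff_add_cancel)
  qed
  then show "px w \<in> primal_solutions H G s r A C Q R Bm Bc Bl Dm Dc Dl L"
    unfolding primal_solutions_def using xv by simp
qed

text \<open>
  Membership in the parallel sum supplies the auxiliary variables.
\<close>
lemma dual_solution_imp_Z:
  assumes "v \<in> dual_solutions H G s r A C Q R Bm Bc Bl Dm Dc Dl L"
  shows "Z \<noteq> {}"
proof -
  obtain x where v: "v \<in> direct_sum G" and x: "x \<in> direct_sum H"
    and inc: "\<forall>i. s i - (\<Sum>j\<in>UNIV. L_adj j i (v $ j)) \<in> A i (x $ i) + {C i (x $ i)} + {Q i (x $ i)} + {R x $ i}"
    and ps: "\<forall>k. v $ k \<in> parallel_sum (G k) (sum_op (Bm k) (Bc k) (Bl k)) (sum_op (Dm k) (Dc k) (Dl k))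
                 ((\<Sum>j\<in>UNIV. L k j (x $ j)) - r k)"
    using assms unfolding dual_solutions_def mem_Collect_eq by (elim conjE bexE) (rule that)
  have "\<exists>y z. y \<in> G k \<and> v $ k \<in> sum_op (Bm k) (Bc k) (Bl k) y \<and> z \<in> G k
      \<and> v $ k \<in> sum_op (Dm k) (Dc k) (Dl k) z \<and> (\<Sum>j\<in>UNIV. L k j (x $ j)) - r k = y + z" for k
    using ps[rule_format, of k] unfolding mem_parallel_sum_iff set_plus_def inverse_op_def by blast
  then have "\<forall>k. \<exists>y z. y \<in> G k \<and> v $ k \<in> sum_op (Bm k) (Bc k) (Bl k) y \<and> z \<in> G k
      \<and> v $ k \<in> sum_op (Dm k) (Dc k) (Dl k) z \<and> (\<Sum>j\<in>UNIV. L k j (x $ j)) - r k = y + z" ..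
  from choice[OF this] obtain y where "\<forall>k. \<exists>z. y k \<in> G k \<and> v $ k \<in> sum_op (Bm k) (Bc k) (Bl k) (y k) \<and> z \<in> G k
      \<and> v $ k \<in> sum_op (Dm k) (Dc k) (Dl k) z \<and> (\<Sum>j\<in>UNIV. L k j (x $ j)) - r k = y k + z" ..
  from choice[OF this] obtain z where yz: "\<forall>k. y k \<in> G k \<and> v $ k \<in> sum_op (Bm k) (Bc k) (Bl k) (y k) \<and> z k \<in> G k
      \<and> v $ k \<in> sum_op (Dm k) (Dc k) (Dl k) (z k) \<and> (\<Sum>j\<in>UNIV. L k j (x $ j)) - r k = y k + z k" ..
  have "(x, \<chi> k. y k, \<chi> k. z k, v) \<in> Z"
    unfolding mem_Z_iff
  proof (intro conjI allI)
    show "(x, \<chi> k. y k, \<chi> k. z k, v) \<in> W" using yz v x by (simp add: mem_W_iff direct_sum_def)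
  qed (simp_all only: fst_conv snd_conv vec_lambda_beta inc yz)
  then show ?thesis by blast
qed

definition scale :: "('i \<Rightarrow> real) \<Rightarrow> ('k \<Rightarrow> real) \<Rightarrow> ('k \<Rightarrow> real) \<Rightarrow> ('k \<Rightarrow> real)
    \<Rightarrow> ('h ^ 'i) \<times> ('g ^ 'k) \<times> ('g ^ 'k) \<times> ('g ^ 'k) \<Rightarrow> ('h ^ 'i) \<times> ('g ^ 'k) \<times> ('g ^ 'k) \<times> ('g ^ 'k)" where
  "scale a b c d p = (\<chi> i. a i *\<^sub>R px p $ i, \<chi> k. b k *\<^sub>R py p $ k, \<chi> k. c k *\<^sub>R pz p $ k, \<chi> k. d k *\<^sub>R pv p $ k)"

lemma norm_scale_le:
  assumes "\<And>i. \<bar>a i\<bar> \<le> c'" "\<And>k. \<bar>b k\<bar> \<le> c'" "\<And>k. \<bar>c k\<bar> \<le> c'" "\<And>k. \<bar>d k\<bar> \<le> c'"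
  shows "norm (scale a b c d p) \<le> c' * norm p"
proof -
  have "0 \<le> c'" using assms(1)[of undefined] by linarith
  then have "norm (scale a b c d p) \<le> c' * norm (px p, py p, pz p, pv p)"
    unfolding scale_def using assms by (intro norm_Pair_le_mult norm_scaled_vec_le)
  then show ?thesis by simp
qed

text \<open>
  Strong monotonicity of \<open>\<Gamma> - F\<close>, where \<open>\<Gamma>\<close> is diagonal with entries bounded below by the constants
  of \<open>F\<close> plus \<open>\<sigma>\<close>; on the dual component, to which \<open>F\<close> contributes nothing, \<open>\<epsilon>\<close> suffices.
\<close>
lemma scale_inner_ge:
  assumes "u \<in> W" "c \<in> W"
    and a: "\<And>i. \<alpha>l i + \<kappa> + \<sigma> \<le> a i" and b: "\<And>k. \<beta>l k + \<sigma> \<le> b k" and d: "\<And>k. \<delta>l k + \<sigma> \<le> d k" and q: "\<And>k. \<epsilon> \<le> q k"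
  shows "\<sigma> * ((norm (px (u - c)))\<^sup>2 + (norm (py (u - c)))\<^sup>2 + (norm (pz (u - c)))\<^sup>2) + \<epsilon> * (norm (pv (u - c)))\<^sup>2
    \<le> inner (u - c) (scale a b d q (u - c) - (F u - F c))"
proof -
  have "inner (u - c) (scale a b d q (u - c)) =
      inner (px (u - c)) (\<chi> i. a i *\<^sub>R px (u - c) $ i) + inner (py (u - c)) (\<chi> k. b k *\<^sub>R py (u - c) $ k)
      + inner (pz (u - c)) (\<chi> k. d k *\<^sub>R pz (u - c) $ k) + inner (pv (u - c)) (\<chi> k. q k *\<^sub>R pv (u - c) $ k)"
    by (simp add: scale_def inner_prod_def)
  moreover have "(\<Sum>i\<in>UNIV. (\<alpha>l i + \<kappa>) * (norm (px (u - c) $ i))\<^sup>2) + \<sigma> * (norm (px (u - c)))\<^sup>2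
      \<le> inner (px (u - c)) (\<chi> i. a i *\<^sub>R px (u - c) $ i)" by (rule inner_scaled_vec_ge) (rule a)
  moreover have "(\<Sum>k\<in>UNIV. \<beta>l k * (norm (py (u - c) $ k))\<^sup>2) + \<sigma> * (norm (py (u - c)))\<^sup>2
      \<le> inner (py (u - c)) (\<chi> k. b k *\<^sub>R py (u - c) $ k)" by (rule inner_scaled_vec_ge) (rule b)
  moreover have "(\<Sum>k\<in>UNIV. \<delta>l k * (norm (pz (u - c) $ k))\<^sup>2) + \<sigma> * (norm (pz (u - c)))\<^sup>2
      \<le> inner (pz (u - c)) (\<chi> k. d k *\<^sub>R pz (u - c) $ k)" by (rule inner_scaled_vec_ge) (rule d)
  moreover have "(\<Sum>k\<in>UNIV. 0 * (norm (pv (u - c) $ k))\<^sup>2) + \<epsilon> * (norm (pv (u - c)))\<^sup>2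
      \<le> inner (pv (u - c)) (\<chi> k. q k *\<^sub>R pv (u - c) $ k)" by (rule inner_scaled_vec_ge) (simp add: q)
  moreover have "inner (u - c) (F u - F c)
    \<le> (\<Sum>i\<in>UNIV. (\<alpha>l i + \<kappa>) * (norm (px (u - c) $ i))\<^sup>2)
      + (\<Sum>k\<in>UNIV. \<beta>l k * (norm (py (u - c) $ k))\<^sup>2)
      + (\<Sum>k\<in>UNIV. \<delta>l k * (norm (pz (u - c) $ k))\<^sup>2)"
    using F_inner_le[OF assms(1,2)] by simp
  moreover have "inner (u - c) (scale a b d q (u - c) - (F u - F c))
      = inner (u - c) (scale a b d q (u - c)) - inner (u - c) (F u - F c)" by (rule inner_diff_right)
  ultimately show ?thesis unfolding distrib_left mult_zero_left sum.neutral_const by linarith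
qed

end


section \<open>The delayed block iteration\<close>

text \<open>
  The algorithm in the product space. Index \<open>\<tau> i n\<close> is the time of the data on which component \<open>i\<close> of
  \<open>c n\<close> rests, block selection and delay combined. All components follow one pattern, a
  forward-backward step followed by \<open>t = \<Gamma> (w - c) - (F w - F c)\<close> with \<open>w\<close> taken at the delayed time; in
  the dual component the operator is zero, its resolvent is the identity, and the formula for \<open>t\<close>
  collapses to \<open>F c\<close>. The dual component of \<open>delayed\<close> is free as \<open>E\<close> ignores it; taking that of \<open>c\<close>
  makes \<open>\<parallel>c - delayed\<parallel>\<^sup>2\<close> the sum of the recorded residuals \<open>\<xi>\<close> and \<open>\<eta>\<close>.
\<close>
locale delayed_block_iteration = saddle_problem H G s r A C Q R Bm Bc Bl Dm Dc Dl L \<alpha>l \<beta>l \<delta>l \<kappa> \<alpha>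
  for H :: "'i::finite \<Rightarrow> 'h::real_inner set" and G :: "'k::finite \<Rightarrow> 'g::real_inner set"
    and s r A C Q R Bm Bc Bl Dm Dc Dl L \<alpha>l \<beta>l \<delta>l \<kappa> \<alpha> +
  fixes \<sigma> \<epsilon> :: real
    and \<gamma> :: "'i \<Rightarrow> nat \<Rightarrow> real" and \<mu> \<nu> \<sigma>K :: "'k \<Rightarrow> nat \<Rightarrow> real" and lam :: "nat \<Rightarrow> real"
    and N :: nat and \<tau> :: "'i \<Rightarrow> nat \<Rightarrow> nat" and \<tau>' :: "'k \<Rightarrow> nat \<Rightarrow> nat"
    and w c t delayed :: "nat \<Rightarrow> ('h ^ 'i) \<times> ('g ^ 'k) \<times> ('g ^ 'k) \<times> ('g ^ 'k)" and \<Delta> :: "nat \<Rightarrow> real"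
  assumes \<sigma>: "1 / (4 * \<alpha>) < \<sigma>" and \<epsilon>: "0 < \<epsilon>" "\<epsilon> < 1"
    and \<gamma>: "\<And>i n. \<epsilon> \<le> \<gamma> i n" "\<And>i n. \<alpha>l i + \<kappa> + \<sigma> \<le> inverse (\<gamma> i n)"
    and \<mu>: "\<And>k n. \<epsilon> \<le> \<mu> k n" "\<And>k n. \<beta>l k + \<sigma> \<le> inverse (\<mu> k n)"
    and \<nu>: "\<And>k n. \<epsilon> \<le> \<nu> k n" "\<And>k n. \<delta>l k + \<sigma> \<le> inverse (\<nu> k n)"
    and \<sigma>K: "\<And>k n. \<epsilon> \<le> \<sigma>K k n" "\<And>k n. \<sigma>K k n \<le> 1 / \<epsilon>"
    and lam: "\<And>n. \<epsilon> \<le> lam n" "\<And>n. lam n \<le> 2 - \<epsilon>"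
    and \<tau>: "\<And>i n. \<tau> i n \<le> n" "\<And>i n. n \<le> \<tau> i n + N"
    and \<tau>': "\<And>k n. \<tau>' k n \<le> n" "\<And>k n. n \<le> \<tau>' k n + N"
    and w0: "w 0 \<in> W"
    and c_x: "\<And>i n. px (c n) $ i = resolvent (H i) (\<gamma> i (\<tau> i n)) (A i)
      (px (w (\<tau> i n)) $ i + \<gamma> i (\<tau> i n) *\<^sub>R (- px (F (w (\<tau> i n))) $ i - C i (px (w (\<tau> i n)) $ i)))"
    and c_y: "\<And>k n. py (c n) $ k = resolvent (G k) (\<mu> k (\<tau>' k n)) (Bm k)
      (py (w (\<tau>' k n)) $ k + \<mu> k (\<tau>' k n) *\<^sub>R (- py (F (w (\<tau>' k n))) $ k - Bc k (py (w (\<tau>' k n)) $ k)))"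
    and c_z: "\<And>k n. pz (c n) $ k = resolvent (G k) (\<nu> k (\<tau>' k n)) (Dm k)
      (pz (w (\<tau>' k n)) $ k + \<nu> k (\<tau>' k n) *\<^sub>R (- pz (F (w (\<tau>' k n))) $ k - Dc k (pz (w (\<tau>' k n)) $ k)))"
    and c_v: "\<And>k n. pv (c n) $ k = pv (w (\<tau>' k n)) $ k - \<sigma>K k (\<tau>' k n) *\<^sub>R pv (F (w (\<tau>' k n))) $ k"
    and t_x: "\<And>i n. px (t n) $ i = inverse (\<gamma> i (\<tau> i n)) *\<^sub>R (px (w (\<tau> i n)) $ i - px (c n) $ i)
      - px (F (w (\<tau> i n))) $ i + px (F (c n)) $ i"
    and t_y: "\<And>k n. py (t n) $ k = inverse (\<mu> k (\<tau>' k n)) *\<^sub>R (py (w (\<tau>' k n)) $ k - py (c n) $ k)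
      - py (F (w (\<tau>' k n))) $ k + py (F (c n)) $ k"
    and t_z: "\<And>k n. pz (t n) $ k = inverse (\<nu> k (\<tau>' k n)) *\<^sub>R (pz (w (\<tau>' k n)) $ k - pz (c n) $ k)
      - pz (F (w (\<tau>' k n))) $ k + pz (F (c n)) $ k"
    and t_v: "\<And>n. pv (t n) = pv (F (c n))"
    and delayed: "\<And>n. delayed n = (\<chi> i. px (w (\<tau> i n)) $ i, \<chi> k. py (w (\<tau>' k n)) $ k, \<chi> k. pz (w (\<tau>' k n)) $ k, pv (c n))"
    and \<Delta>: "\<And>n. \<Delta> n = inner (w n - c n) (t n) - (norm (c n - delayed n))\<^sup>2 / (4 * \<alpha>)"
    and step: "\<And>n. 0 < \<Delta> n \<Longrightarrow> w (Suc n) = w n - (lam n * \<Delta> n / (norm (t n))\<^sup>2) *\<^sub>R t n"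
    and stay: "\<And>n. \<not> 0 < \<Delta> n \<Longrightarrow> w (Suc n) = w n"
    and Z_nonempty: "Z \<noteq> {}"
begin

lemma params_pos: "0 < \<gamma> i n" "0 < \<mu> k n" "0 < \<nu> k n" "0 < \<sigma>K k n"
  using \<epsilon>(1) \<gamma>(1)[of i n] \<mu>(1)[of k n] \<nu>(1)[of k n] \<sigma>K(1)[of k n] by linarith+

lemma resolvent_args_in:
  assumes "w m \<in> W"
  shows "px (w m) $ i + g *\<^sub>R (- px (F (w m)) $ i - C i (px (w m) $ i)) \<in> H i"
    and "py (w m) $ k + g *\<^sub>R (- py (F (w m)) $ k - Bc k (py (w m) $ k)) \<in> G k"
    and "pz (w m) $ k + g *\<^sub>R (- pz (F (w m)) $ k - Dc k (pz (w m) $ k)) \<in> G k"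
proof -
  note W = W_D[OF assms] W_D[OF F_in[OF assms]]
  show "px (w m) $ i + g *\<^sub>R (- px (F (w m)) $ i - C i (px (w m) $ i)) \<in> H i"
    by (intro subspace_add subspace_scale subspace_diff subspace_neg subspaces W C_in)
  show "py (w m) $ k + g *\<^sub>R (- py (F (w m)) $ k - Bc k (py (w m) $ k)) \<in> G k"
    by (intro subspace_add subspace_scale subspace_diff subspace_neg subspaces W Bc_in)
  show "pz (w m) $ k + g *\<^sub>R (- pz (F (w m)) $ k - Dc k (pz (w m) $ k)) \<in> G k"
    by (intro subspace_add subspace_scale subspace_diff subspace_neg subspaces W Dc_in)
qed

lemma c_in_of_past:
  assumes "\<And>m. m \<le> n \<Longrightarrow> w m \<in> W"
  shows "c n \<in> W"
proof -
  have W: "w (\<tau> i n) \<in> W" "w (\<tau>' k n) \<in> W" for i k using assms \<tau>(1) \<tau>'(1) by auto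
  have "px (c n) $ i \<in> H i" for i
    unfolding c_x by (rule resolvent_in[OF H A params_pos(1) resolvent_args_in(1)[OF W(1)]])
  moreover have "py (c n) $ k \<in> G k" for k
    unfolding c_y by (rule resolvent_in[OF G Bm params_pos(2) resolvent_args_in(2)[OF W(2)]])
  moreover have "pz (c n) $ k \<in> G k" for k
    unfolding c_z by (rule resolvent_in[OF G Dm params_pos(3) resolvent_args_in(3)[OF W(2)]])
  moreover have "pv (c n) $ k \<in> G k" for k
    unfolding c_v by (intro subspace_diff subspace_scale subspaces W_D[OF W(2)] W_D[OF F_in[OF W(2)]])
  ultimately show ?thesis by (simp add: mem_W_iff)
qed

lemma t_in_of_past:
  assumes "\<And>m. m \<le> n \<Longrightarrow> w m \<in> W"
  shows "t n \<in> W"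
proof -
  have W: "w (\<tau> i n) \<in> W" "w (\<tau>' k n) \<in> W" for i k using assms \<tau>(1) \<tau>'(1) by auto
  note c = c_in_of_past[OF assms, simplified]
  note in_W = W_D[OF W(1)] W_D[OF W(2)] W_D[OF F_in[OF W(1)]] W_D[OF F_in[OF W(2)]] W_D[OF c] W_D[OF F_in[OF c]]
  show ?thesis
    unfolding mem_W_iff t_x t_y t_z t_v
    by (intro conjI allI subspace_add subspace_diff subspace_scale subspaces in_W)
qed

lemma w_in: "w n \<in> W"
proof (induction n rule: less_induct)
  case (less n)
  show ?case
  proof (cases n)
    case (Suc m)
    have past: "w j \<in> W" if "j \<le> m" for j using less that Suc by simp
    show ?thesis
      unfolding Suc
    proof (cases "0 < \<Delta> m")
      case True
      show "w (Suc m) \<in> W"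
        unfolding step[OF True]
        by (intro subspace_diff subspace_scale subspace_W past t_in_of_past) auto
    qed (simp add: stay past)
  qed (simp add: w0)
qed

lemma c_in: "c n \<in> W" and t_in: "t n \<in> W"
  by (simp_all add: c_in_of_past t_in_of_past w_in)

lemma delayed_in: "delayed n \<in> W"
  using W_D[OF w_in] W_D[OF c_in] by (simp add: mem_W_iff delayed)

text \<open>
  The defining inclusions of the resolvents, so that \<open>t \<in> M c + F c + E (delayed)\<close>.
\<close>
lemma graph_inclusion: "(c n, t n - F (c n) - E (delayed n)) \<in> M"
proof -
  let ?m = "t n - F (c n) - E (delayed n)"
  have "px ?m $ i \<in> A i (px (c n) $ i)" for i
  proof -
    let ?j = "\<tau> i n"
    have "px ?m $ i = inverse (\<gamma> i ?j) *\<^sub>R (px (w ?j) $ i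
        + \<gamma> i ?j *\<^sub>R (- px (F (w ?j)) $ i - C i (px (w ?j) $ i)) - px (c n) $ i)"
      using params_pos(1)[of i ?j] by (simp add: t_x delayed E_def algebra_simps)
    then show ?thesis
      using resolvent_graph[OF H A params_pos(1) resolvent_args_in(1)[OF w_in]] by (metis c_x)
  qed
  moreover have "py ?m $ k \<in> Bm k (py (c n) $ k)" for k
  proof -
    let ?j = "\<tau>' k n"
    have "py ?m $ k = inverse (\<mu> k ?j) *\<^sub>R (py (w ?j) $ k
        + \<mu> k ?j *\<^sub>R (- py (F (w ?j)) $ k - Bc k (py (w ?j) $ k)) - py (c n) $ k)"
      using params_pos(2)[of k ?j] by (simp add: t_y delayed E_def algebra_simps)
    then show ?thesis
      using resolvent_graph[OF G Bm params_pos(2) resolvent_args_in(2)[OF w_in]] by (metis c_y)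
  qed
  moreover have "pz ?m $ k \<in> Dm k (pz (c n) $ k)" for k
  proof -
    let ?j = "\<tau>' k n"
    have "pz ?m $ k = inverse (\<nu> k ?j) *\<^sub>R (pz (w ?j) $ k
        + \<nu> k ?j *\<^sub>R (- pz (F (w ?j)) $ k - Dc k (pz (w ?j) $ k)) - pz (c n) $ k)"
      using params_pos(3)[of k ?j] by (simp add: t_z delayed E_def algebra_simps)
    then show ?thesis
      using resolvent_graph[OF G Dm params_pos(3) resolvent_args_in(3)[OF w_in]] by (metis c_z)
  qed
  moreover have "pv ?m = 0" by (simp add: t_v E_def)
  ultimately show ?thesis using c_in by (simp add: M_def)
qed

text \<open>
  Add up the monotonicity of \<open>M\<close> and of \<open>F\<close> between \<open>c\<close> and the zero \<open>z\<close> and the bound of lemma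
  \<open>cocoercive_delayed\<close>; the subtracted term of \<open>\<Delta>\<close> is exactly the loss in the latter.
\<close>
lemma separation:
  assumes "z \<in> Z"
  shows "\<Delta> n \<le> inner (w n - z) (t n)"
proof -
  have zM: "(z, - (F z + E z)) \<in> M" using assms by (simp add: Z_def)
  then have "z \<in> W" using M_subset by auto
  let ?m = "t n - F (c n) - E (delayed n)"
  have "0 \<le> inner (c n - z) (?m - - (F z + E z))" by (rule M_monotone[OF graph_inclusion zM])
  moreover have "0 \<le> inner (c n - z) (F (c n) - F z)" by (rule F_monotone[OF c_in \<open>z \<in> W\<close>])
  moreover have "- ((norm (c n - delayed n))\<^sup>2 / (4 * \<alpha>)) \<le> inner (c n - z) (E (delayed n) - E z)"
    by (rule cocoercive_delayed[OF E_cocoercive \<alpha> delayed_in \<open>z \<in> W\<close>])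
  moreover have "inner (c n - z) (?m - - (F z + E z)) + inner (c n - z) (F (c n) - F z)
      + inner (c n - z) (E (delayed n) - E z) = inner (c n - z) (t n)"
    by (simp flip: inner_add_right)
  moreover have "inner (w n - z) (t n) = inner (w n - c n) (t n) + inner (c n - z) (t n)"
    by (simp flip: inner_add_left)
  ultimately show ?thesis unfolding \<Delta> by linarith
qed

lemma fejer:
  assumes "z \<in> Z"
  shows "(norm (w (Suc n) - z))\<^sup>2 + \<epsilon> / 2 * (norm (w (Suc n) - w n))\<^sup>2 \<le> (norm (w n - z))\<^sup>2"
    and "lam n * \<Delta> n \<le> norm (w (Suc n) - w n) * norm (t n)"
proof -
  have "0 < lam n" using lam(1)[of n] \<epsilon>(1) by linarith
  note * = fejer_step[OF this lam(2) \<epsilon> step stay separation[OF assms]]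
  show "(norm (w (Suc n) - z))\<^sup>2 + \<epsilon> / 2 * (norm (w (Suc n) - w n))\<^sup>2 \<le> (norm (w n - z))\<^sup>2"
    "lam n * \<Delta> n \<le> norm (w (Suc n) - w n) * norm (t n)"
    using * by blast+
qed

lemma fejer_consequences:
  assumes "z \<in> Z"
  shows "summable (\<lambda>n. (norm (w (Suc n) - w n))\<^sup>2)"
    and "convergent (\<lambda>n. norm (w n - z))"
    and "norm (w n - z) \<le> norm (w 0 - z)"
  using fejer_monotone_summable[of "\<epsilon> / 2" w z, OF _ fejer(1)[OF assms]] \<epsilon>(1) by auto

lemma increments_summable: "summable (\<lambda>n. (norm (w (Suc n) - w n))\<^sup>2)"
  using Z_nonempty fejer_consequences(1) by blast

lemma increments_vanish: "(\<lambda>n. norm (w (Suc n) - w n)) \<longlonglongrightarrow> 0"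
  by (rule tendsto_zero_of_power2) (rule summable_LIMSEQ_zero[OF increments_summable])

lemma delays_vanish:
  "(\<lambda>n. w (\<tau> i n) - w n) \<longlonglongrightarrow> 0" "(\<lambda>n. w (\<tau>' k n) - w n) \<longlonglongrightarrow> 0"
proof -
  have "(\<lambda>n. w (Suc n) - w n) \<longlonglongrightarrow> 0" using increments_vanish by (rule tendsto_norm_zero_cancel)
  from bounded_delay_tendsto[OF this, of "\<tau> i" N] bounded_delay_tendsto[OF this, of "\<tau>' k" N]
  show "(\<lambda>n. w (\<tau> i n) - w n) \<longlonglongrightarrow> 0" "(\<lambda>n. w (\<tau>' k n) - w n) \<longlonglongrightarrow> 0"
    using \<tau> \<tau>' by blast+
qed

lemma F_delays_vanish:
  "(\<lambda>n. F (w (\<tau> i n)) - F (w n)) \<longlonglongrightarrow> 0" "(\<lambda>n. F (w (\<tau>' k n)) - F (w n)) \<longlonglongrightarrow> 0"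
  by (intro lipschitzian_tendsto_diff[OF F_lipschitzian w_in w_in] delays_vanish)+

text \<open>
  The operator \<open>\<Gamma>\<close> of inverse step sizes.
\<close>
definition stepmap where
  "stepmap n = scale (\<lambda>i. inverse (\<gamma> i (\<tau> i n))) (\<lambda>k. inverse (\<mu> k (\<tau>' k n))) (\<lambda>k. inverse (\<nu> k (\<tau>' k n)))
    (\<lambda>k. inverse (\<sigma>K k (\<tau>' k n)))"

text \<open>
  The deviation of \<open>t\<close> from the value it would have for the same \<open>c\<close> if all components
  used the current iterate.
\<close>
definition err where
  "err n = t n - (stepmap n (w n - c n) - (F (w n) - F (c n)))"

lemma inverse_params_le:
  "\<bar>inverse (\<gamma> i n)\<bar> \<le> 1 / \<epsilon>" "\<bar>inverse (\<mu> k n)\<bar> \<le> 1 / \<epsilon>" "\<bar>inverse (\<nu> k n)\<bar> \<le> 1 / \<epsilon>"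
  "\<bar>inverse (\<sigma>K k n)\<bar> \<le> 1 / \<epsilon>"
  using \<epsilon>(1) \<gamma>(1)[of i n] \<mu>(1)[of k n] \<nu>(1)[of k n] \<sigma>K(1)[of k n]
    params_pos(1)[of i n] params_pos(2,3,4)[of k n]
  by (simp_all add: inverse_eq_divide frac_le)

lemma err_component_vanishes:
  fixes f g :: "nat \<Rightarrow> 'z::real_normed_vector" and b :: "nat \<Rightarrow> real"
  assumes "f \<longlonglongrightarrow> 0" "g \<longlonglongrightarrow> 0" "\<And>n. \<bar>b n\<bar> \<le> 1 / \<epsilon>"
  shows "(\<lambda>n. b n *\<^sub>R f n - g n) \<longlonglongrightarrow> 0"
proof -
  have "(\<lambda>n. b n *\<^sub>R f n) \<longlonglongrightarrow> 0"
  proof (rule Lim_null_comparison)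
    show "eventually (\<lambda>n. norm (b n *\<^sub>R f n) \<le> 1 / \<epsilon> * norm (f n)) sequentially"
      using assms(3) by (intro always_eventually allI) (simp only: norm_scaleR mult_right_mono norm_ge_zero)
    show "(\<lambda>n. 1 / \<epsilon> * norm (f n)) \<longlonglongrightarrow> 0"
      by (rule tendsto_mult_right_zero[OF tendsto_norm_zero[OF assms(1)]])
  qed
  from tendsto_diff[OF this assms(2)] show ?thesis by simp
qed

lemma component_vanishes:
  fixes f :: "nat \<Rightarrow> ('h ^ 'i) \<times> ('g ^ 'k) \<times> ('g ^ 'k) \<times> ('g ^ 'k)"
  assumes "f \<longlonglongrightarrow> 0"
  shows "(\<lambda>n. px (f n) $ i) \<longlonglongrightarrow> 0" "(\<lambda>n. py (f n) $ k) \<longlonglongrightarrow> 0" "(\<lambda>n. pz (f n) $ k) \<longlonglongrightarrow> 0" "(\<lambda>n. pv (f n) $ k) \<longlonglongrightarrow> 0"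
proof -
  note l = tendsto_fst[OF assms] tendsto_snd[OF assms]
  note m = l(1) tendsto_fst[OF l(2)] tendsto_snd[OF l(2)]
  note n = m(1,2) tendsto_fst[OF m(3)] tendsto_snd[OF m(3)]
  show "(\<lambda>n. px (f n) $ i) \<longlonglongrightarrow> 0" "(\<lambda>n. py (f n) $ k) \<longlonglongrightarrow> 0" "(\<lambda>n. pz (f n) $ k) \<longlonglongrightarrow> 0" "(\<lambda>n. pv (f n) $ k) \<longlonglongrightarrow> 0"
    using tendsto_vec_nth[OF n(1), of i] tendsto_vec_nth[OF n(2), of k] tendsto_vec_nth[OF n(3), of k]
      tendsto_vec_nth[OF n(4), of k] by simp_all
qed

text \<open>
  Each component of the error is \<open>\<gamma>\<inverse> (w' - w) - (F w' - F w)\<close>, with \<open>w'\<close> the delayed iterate; it does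
  not involve \<open>c\<close>, whose boundedness is not yet known.
\<close>
lemma err_vanishes: "err \<longlonglongrightarrow> 0"
proof (rule tendsto_vec_Pair_zeroI)
  fix i
  have "px (err n) $ i = inverse (\<gamma> i (\<tau> i n)) *\<^sub>R (px (w (\<tau> i n) - w n) $ i) - px (F (w (\<tau> i n)) - F (w n)) $ i" for n
    by (simp add: err_def stepmap_def scale_def t_x algebra_simps)
  then show "(\<lambda>n. px (err n) $ i) \<longlonglongrightarrow> 0"
    by (simp only:) (intro err_component_vanishes component_vanishes delays_vanish F_delays_vanish inverse_params_le)
next
  fix k
  have "py (err n) $ k = inverse (\<mu> k (\<tau>' k n)) *\<^sub>R (py (w (\<tau>' k n) - w n) $ k) - py (F (w (\<tau>' k n)) - F (w n)) $ k" for n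
    by (simp add: err_def stepmap_def scale_def t_y algebra_simps)
  then show "(\<lambda>n. py (err n) $ k) \<longlonglongrightarrow> 0"
    by (simp only:) (intro err_component_vanishes component_vanishes delays_vanish F_delays_vanish inverse_params_le)
  have "pz (err n) $ k = inverse (\<nu> k (\<tau>' k n)) *\<^sub>R (pz (w (\<tau>' k n) - w n) $ k) - pz (F (w (\<tau>' k n)) - F (w n)) $ k" for n
    by (simp add: err_def stepmap_def scale_def t_z algebra_simps)
  then show "(\<lambda>n. pz (err n) $ k) \<longlonglongrightarrow> 0"
    by (simp only:) (intro err_component_vanishes component_vanishes delays_vanish F_delays_vanish inverse_params_le)
  have "pv (err n) $ k = inverse (\<sigma>K k (\<tau>' k n)) *\<^sub>R (pv (w (\<tau>' k n) - w n) $ k) - pv (F (w (\<tau>' k n)) - F (w n)) $ k" for n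
    using params_pos(4)[of k "\<tau>' k n"]
    by (simp add: err_def stepmap_def scale_def t_v c_v algebra_simps)
  then show "(\<lambda>n. pv (err n) $ k) \<longlonglongrightarrow> 0"
    by (simp only:) (intro err_component_vanishes component_vanishes delays_vanish F_delays_vanish inverse_params_le)
qed

text \<open>
  The point \<open>delayed\<close> freed from its delays.
\<close>
definition current where
  "current n = (px (w n), py (w n), pz (w n), pv (c n))"

lemma delayed_current_vanishes: "(\<lambda>n. delayed n - current n) \<longlonglongrightarrow> 0"
  by (rule tendsto_vec_Pair_zeroI)
     (simp_all add: delayed current_def component_vanishes(1)[OF delays_vanish(1), simplified]
       component_vanishes(2,3)[OF delays_vanish(2), simplified])

text \<open>
  Strong monotonicity with modulus \<open>\<sigma>\<close> in the first three components pays for the term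
  \<open>\<parallel>c - delayed\<parallel>\<^sup>2 / (4 \<alpha>)\<close>, since \<open>c\<close> and \<open>current\<close> have the same dual component; there the modulus \<open>\<epsilon>\<close> remains in full.
\<close>
lemma gap_lower_bound:
  defines "\<delta> \<equiv> min (\<sigma> - 1 / (4 * \<alpha>)) \<epsilon>" and "o' \<equiv> \<lambda>n. norm (delayed n - current n)"
  defines "e \<equiv> \<lambda>n. norm (err n) + o' n / (2 * \<alpha>) + (o' n)\<^sup>2 / (4 * \<alpha>)"
  shows "\<delta> * (norm (w n - c n))\<^sup>2 - e n * norm (w n - c n) - e n \<le> \<Delta> n"
proof -
  let ?D = "norm (w n - c n)" and ?a = "norm (c n - current n)" and ?b = "norm (pv (w n - c n))"
  have a2: "?a\<^sup>2 = (norm (px (w n - c n)))\<^sup>2 + (norm (py (w n - c n)))\<^sup>2 + (norm (pz (w n - c n)))\<^sup>2"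
    unfolding norm_quad_sq by (simp add: current_def norm_minus_commute)
  have D2: "?D\<^sup>2 = ?a\<^sup>2 + ?b\<^sup>2" using a2 norm_quad_sq[of "w n - c n"] by linarith
  have "?a\<^sup>2 \<le> ?D\<^sup>2" unfolding D2 by simp
  then have aD: "?a \<le> ?D" by (rule power2_le_imp_le) simp
  have "\<sigma> * ?a\<^sup>2 + \<epsilon> * ?b\<^sup>2 \<le> inner (w n - c n) (stepmap n (w n - c n) - (F (w n) - F (c n)))"
    unfolding a2 stepmap_def
  proof (rule scale_inner_ge[OF w_in c_in \<gamma>(2) \<mu>(2) \<nu>(2)])
    show "\<epsilon> \<le> inverse (\<sigma>K k (\<tau>' k n))" for k
      using \<sigma>K(2)[of k "\<tau>' k n"] params_pos(4)[of k "\<tau>' k n"] \<epsilon>(1) by (simp add: field_simps)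
  qed
  moreover have "inner (w n - c n) (t n) = inner (w n - c n) (stepmap n (w n - c n) - (F (w n) - F (c n))) + inner (w n - c n) (err n)"
    by (simp only: err_def flip: inner_add_right) simp
  moreover have "- (?D * norm (err n)) \<le> inner (w n - c n) (err n)"
    using Cauchy_Schwarz_ineq2[of "w n - c n" "err n"] by linarith
  ultimately have 1: "\<sigma> * ?a\<^sup>2 + \<epsilon> * ?b\<^sup>2 - ?D * norm (err n) \<le> inner (w n - c n) (t n)" by linarith
  have "norm (c n - delayed n) \<le> ?a + o' n"
    unfolding o'_def using norm_triangle_ineq4[of "c n - current n" "delayed n - current n"] by simp
  then have "(norm (c n - delayed n))\<^sup>2 \<le> (?a + o' n)\<^sup>2" by (rule power_mono) simp
  also have "\<dots> \<le> ?a\<^sup>2 + 2 * ?D * o' n + (o' n)\<^sup>2"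
    using aD mult_right_mono[OF aD, of "o' n"] by (simp add: power2_sum o'_def)
  finally have "(norm (c n - delayed n))\<^sup>2 / (4 * \<alpha>) \<le> (?a\<^sup>2 + 2 * ?D * o' n + (o' n)\<^sup>2) / (4 * \<alpha>)"
    using \<alpha> by (intro divide_right_mono) auto
  also have "\<dots> = 1 / (4 * \<alpha>) * ?a\<^sup>2 + ?D * (o' n / (2 * \<alpha>)) + (o' n)\<^sup>2 / (4 * \<alpha>)"
    using \<alpha> by (simp add: field_simps)
  finally have "\<sigma> * ?a\<^sup>2 + \<epsilon> * ?b\<^sup>2 - ?D * norm (err n) - (1 / (4 * \<alpha>) * ?a\<^sup>2 + ?D * (o' n / (2 * \<alpha>)) + (o' n)\<^sup>2 / (4 * \<alpha>)) \<le> \<Delta> n"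
    using 1 unfolding \<Delta> by linarith
  moreover have "\<delta> * ?D\<^sup>2 \<le> \<sigma> * ?a\<^sup>2 + \<epsilon> * ?b\<^sup>2 - 1 / (4 * \<alpha>) * ?a\<^sup>2"
  proof -
    have "\<delta> * ?a\<^sup>2 \<le> (\<sigma> - 1 / (4 * \<alpha>)) * ?a\<^sup>2" "\<delta> * ?b\<^sup>2 \<le> \<epsilon> * ?b\<^sup>2"
      by (intro mult_right_mono; simp add: \<delta>_def)+
    then show ?thesis unfolding D2 distrib_left left_diff_distrib by linarith
  qed
  moreover have "?D * norm (err n) + ?D * (o' n / (2 * \<alpha>)) + (o' n)\<^sup>2 / (4 * \<alpha>) \<le> e n * ?D + e n"
  proof -
    have "0 \<le> norm (err n)" "0 \<le> o' n / (2 * \<alpha>)" "0 \<le> (o' n)\<^sup>2 / (4 * \<alpha>)" "0 \<le> (o' n)\<^sup>2 / (4 * \<alpha>) * ?D"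
      using \<alpha> by (simp_all add: o'_def)
    then show ?thesis unfolding e_def distrib_right by (simp add: mult.commute[of ?D])
  qed
  ultimately show ?thesis by linarith
qed

lemma w_c_vanishes: "(\<lambda>n. w n - c n) \<longlonglongrightarrow> 0"
proof -
  obtain z where z: "z \<in> Z" using Z_nonempty by blast
  obtain l where l: "l-lipschitz_on W F" using F_lipschitzian by (auto simp: lipschitzian_def)
  define e where "e n = norm (err n) + norm (delayed n - current n) / (2 * \<alpha>) + (norm (delayed n - current n))\<^sup>2 / (4 * \<alpha>)" for n
  have e_lim: "e \<longlonglongrightarrow> 0 + 0 / (2 * \<alpha>) + 0\<^sup>2 / (4 * \<alpha>)"
    unfolding e_def[abs_def] using \<alpha>
    by (intro tendsto_intros tendsto_norm_zero err_vanishes delayed_current_vanishes) auto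
  have e_nonneg: "0 \<le> e n" and err_le: "norm (err n) \<le> e n" for n using \<alpha> by (simp_all add: e_def)
  have "(\<lambda>n. norm (w n - c n)) \<longlonglongrightarrow> 0"
  proof (rule gap_vanishes[where \<delta> = "min (\<sigma> - 1 / (4 * \<alpha>)) \<epsilon>" and \<epsilon> = \<epsilon> and B = "norm (w 0 - z)" and k = "1 / \<epsilon> + l"
        and r = e and \<Delta> = \<Delta> and \<tau> = "\<lambda>n. norm (t n)" and S = "\<lambda>n. norm (w (Suc n) - w n)" and lam = lam])
    show "0 < min (\<sigma> - 1 / (4 * \<alpha>)) \<epsilon>" using \<sigma> \<epsilon> by simp
    show "0 \<le> 1 / \<epsilon> + l" using \<epsilon> lipschitz_on_nonneg[OF l] by simp
    show "min (\<sigma> - 1 / (4 * \<alpha>)) \<epsilon> * (norm (w n - c n))\<^sup>2 - e n * norm (w n - c n) - e n \<le> \<Delta> n" for n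
      using gap_lower_bound by (simp add: e_def)
    show "\<Delta> n \<le> norm (w 0 - z) * norm (t n)" for n
    proof -
      have "inner (w n - z) (t n) \<le> norm (w n - z) * norm (t n)" by (rule norm_cauchy_schwarz)
      also have "\<dots> \<le> norm (w 0 - z) * norm (t n)" by (intro mult_right_mono fejer_consequences(3)[OF z]) auto
      finally show ?thesis using separation[OF z, of n] by linarith
    qed
    show "norm (t n) \<le> (1 / \<epsilon> + l) * norm (w n - c n) + e n" for n
    proof -
      have "norm (t n) = norm (stepmap n (w n - c n) - (F (w n) - F (c n)) + err n)" by (simp add: err_def)
      then have "norm (t n) \<le> norm (stepmap n (w n - c n)) + norm (F (w n) - F (c n)) + norm (err n)"
        using norm_triangle_ineq[of "stepmap n (w n - c n) - (F (w n) - F (c n))" "err n"]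
          norm_triangle_ineq4[of "stepmap n (w n - c n)" "F (w n) - F (c n)"] by linarith
      moreover have "norm (stepmap n (w n - c n)) \<le> 1 / \<epsilon> * norm (w n - c n)"
        unfolding stepmap_def by (intro norm_scale_le inverse_params_le)
      moreover have "norm (F (w n) - F (c n)) \<le> l * norm (w n - c n)"
        using lipschitz_onD[OF l w_in c_in] by (simp add: dist_norm)
      ultimately show ?thesis using err_le[of n] unfolding distrib_right by linarith
    qed
    show "lam n * \<Delta> n \<le> norm (w (Suc n) - w n) * norm (t n)" for n by (rule fejer(2)[OF z])
  qed (use \<epsilon> e_lim e_nonneg lam increments_vanish in auto)
  then show ?thesis by (rule tendsto_norm_zero_cancel)
qed

lemma t_vanishes: "t \<longlonglongrightarrow> 0"
proof -
  have "(\<lambda>n. stepmap n (w n - c n)) \<longlonglongrightarrow> 0"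
  proof (rule Lim_null_comparison)
    show "eventually (\<lambda>n. norm (stepmap n (w n - c n)) \<le> 1 / \<epsilon> * norm (w n - c n)) sequentially"
      unfolding stepmap_def by (intro always_eventually allI norm_scale_le inverse_params_le)
    show "(\<lambda>n. 1 / \<epsilon> * norm (w n - c n)) \<longlonglongrightarrow> 0"
      by (rule tendsto_mult_right_zero[OF tendsto_norm_zero[OF w_c_vanishes]])
  qed
  moreover have "(\<lambda>n. F (w n) - F (c n)) \<longlonglongrightarrow> 0"
    by (rule lipschitzian_tendsto_diff[OF F_lipschitzian w_in c_in w_c_vanishes])
  ultimately have "(\<lambda>n. stepmap n (w n - c n) - (F (w n) - F (c n)) + err n) \<longlonglongrightarrow> 0 - 0 + 0"
    by (intro tendsto_add tendsto_diff err_vanishes)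
  then show ?thesis by (simp add: err_def)
qed

lemma c_delayed_vanishes: "(\<lambda>n. c n - delayed n) \<longlonglongrightarrow> 0"
proof -
  have "(\<lambda>n. c n - current n) \<longlonglongrightarrow> 0"
    by (rule tendsto_vec_Pair_zeroI)
       (use component_vanishes[OF tendsto_minus[OF w_c_vanishes, simplified]] in \<open>simp_all add: current_def\<close>)
  from tendsto_diff[OF this delayed_current_vanishes] show ?thesis by simp
qed

lemma weak_limit:
  obtains z where "z \<in> Z" "weakly_converges_in W w z"
proof -
  obtain z0 where z0: "z0 \<in> Z" using Z_nonempty by blast
  define B where "B = norm (w 0 - z0) + norm z0"
  have bound: "norm (w n) \<le> B" for n
    using norm_triangle_ineq[of "w n - z0" z0] fejer_consequences(3)[OF z0, of n] by (simp add: B_def)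
  have "Bseq (\<lambda>n. w n - c n)"
    using w_c_vanishes by (intro convergent_imp_Bseq convergentI)
  then obtain B' where B': "\<And>n. norm (w n - c n) \<le> B'" unfolding Bseq_def by blast
  have cbound: "norm (c n) \<le> B + B'" for n
    using norm_triangle_ineq4[of "w n" "w n - c n"] bound[of n] B'[of n] by simp
  have FE_lip: "lipschitzian W (\<lambda>w. F w + E w)"
    by (intro lipschitzian_intros F_lipschitzian lipschitzianI[OF cocoercive_monotone_lipschitz(2)[OF E_cocoercive \<alpha>]])
  then obtain l where l: "l-lipschitz_on W (\<lambda>w. F w + E w)" by (auto simp: lipschitzian_def)
  have E_lim: "(\<lambda>n. E (c n) - E (delayed n)) \<longlonglongrightarrow> 0"
    by (rule lipschitzian_tendsto_diff[OF lipschitzianI[OF cocoercive_monotone_lipschitz(2)[OF E_cocoercive \<alpha>]]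
          c_in delayed_in c_delayed_vanishes])
  have strong: "(\<lambda>n. t n - F (c n) - E (delayed n) + (F (c n) + E (c n))) \<longlonglongrightarrow> 0"
    using tendsto_add[OF t_vanishes E_lim] by (simp add: algebra_simps)
  show ?thesis
  proof (rule opial[OF hilbert_W w_in bound fejer_consequences(2), of Z])
    show "z \<in> Z" if G: "G \<le> sequentially" "G \<noteq> bot" and "z \<in> W"
      and weak: "\<And>u. u \<in> W \<Longrightarrow> ((\<lambda>n. inner (w n) u) \<longlongrightarrow> inner z u) G" for G z
    proof -
      have "(z, - (F z + E z)) \<in> M"
      proof (rule demiclosed_graph[OF subspace_W M_subset M_monotone M_surj _ _ l G(2) graph_inclusion cbound])
        show "(\<lambda>w. F w + E w) \<in> W \<rightarrow> W" using F_in E_in subspace_W by (auto intro: subspace_add)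
        show "0 \<le> inner (x - y) (F x + E x - (F y + E y))" if "x \<in> W" "y \<in> W" for x y
          using F_monotone[OF that] cocoercive_monotone_lipschitz(1)[OF E_cocoercive \<alpha> that]
          by (simp add: add_diff_add inner_add_right)
        show "((\<lambda>n. t n - F (c n) - E (delayed n) + (F (c n) + E (c n))) \<longlongrightarrow> 0) G"
          by (rule tendsto_mono[OF G(1) strong])
        show "((\<lambda>n. inner (c n) u) \<longlongrightarrow> inner z u) G" if "u \<in> W" for u
        proof -
          have "((\<lambda>n. inner (w n - c n) u) \<longlongrightarrow> inner 0 u) G"
            by (intro tendsto_inner tendsto_const tendsto_mono[OF G(1) w_c_vanishes])
          from tendsto_diff[OF weak[OF that] this] show ?thesis by (simp add: inner_diff_left)
        qed
      qed (use \<open>z \<in> W\<close> in auto)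
      then show ?thesis by (simp add: Z_def)
    qed
    show thesis if "z \<in> Z" "weakly_converges_in W w z" for z
      using that by (rule \<open>\<And>z. z \<in> Z \<Longrightarrow> weakly_converges_in W w z \<Longrightarrow> thesis\<close>)
  qed auto
qed

end

section \<open>Convergence of the algorithm\<close>

lemma cocoercive_mono: "cocoercive a U f \<Longrightarrow> b \<le> a \<Longrightarrow> cocoercive b U f"
  unfolding cocoercive_def by (meson mult_right_mono order_trans zero_le_power2)

text \<open>
  Weak convergence in the product space implies weak convergence of the components: test with vectors
  supported in one component.
\<close>
lemma inner_single_component:
  fixes u :: "'a::real_inner" and w :: "('a ^ 'i) \<times> ('b::real_inner ^ 'k) \<times> ('b ^ 'k) \<times> ('b ^ 'k)"
  shows "inner w (axis i u, 0, 0, 0) = inner (px w $ i) u"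
    and "inner w (0, 0, 0, axis k v) = inner (pv w $ k) v"
  by (simp_all add: inner_prod_def inner_axis)

lemma norm_component_le:
  fixes w :: "('a::real_inner ^ 'i) \<times> ('b::real_inner ^ 'k) \<times> ('b ^ 'k) \<times> ('b ^ 'k)"
  shows "norm (px w $ i) \<le> norm w" "norm (py w $ k) \<le> norm w" "norm (pz w $ k) \<le> norm w" "norm (pv w $ k) \<le> norm w"
proof -
  have "norm (px w) \<le> norm w" "norm (py w) \<le> norm w" "norm (pz w) \<le> norm w" "norm (pv w) \<le> norm w"
    by (rule power2_le_imp_le, simp add: norm_quad_sq, simp)+
  then show "norm (px w $ i) \<le> norm w" "norm (py w $ k) \<le> norm w" "norm (pz w $ k) \<le> norm w" "norm (pv w $ k) \<le> norm w"
    by (blast intro: order_trans[OF Finite_Cartesian_Product.norm_nth_le])+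
qed

lemma inverse_ge_of_le_divide:
  fixes g X :: real
  assumes "0 < g" "0 < X" "g \<le> 1 / X"
  shows "X \<le> inverse g"
  using assms by (simp add: field_simps)

theorem theorem3p5:
  fixes H :: "'i::finite \<Rightarrow> 'h::real_inner set"
    and G :: "'k::finite \<Rightarrow> 'g::real_inner set"
    and s :: "'i \<Rightarrow> 'h" and r :: "'k \<Rightarrow> 'g"
    and A :: "'i \<Rightarrow> 'h \<Rightarrow> 'h set" and C Q :: "'i \<Rightarrow> 'h \<Rightarrow> 'h"
    and R :: "'h ^ 'i \<Rightarrow> 'h ^ 'i"
    and Bm :: "'k \<Rightarrow> 'g \<Rightarrow> 'g set" and Bc Bl :: "'k \<Rightarrow> 'g \<Rightarrow> 'g"
    and Dm :: "'k \<Rightarrow> 'g \<Rightarrow> 'g set" and Dc Dl :: "'k \<Rightarrow> 'g \<Rightarrow> 'g"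
    and L :: "'k \<Rightarrow> 'i \<Rightarrow> 'h \<Rightarrow> 'g"
    and \<alpha>c \<alpha>l :: "'i \<Rightarrow> real" and \<beta>c \<beta>l \<delta>c \<delta>l :: "'k \<Rightarrow> real" and \<kappa> :: real
    and \<alpha> \<sigma> \<epsilon> :: real
    and \<gamma> :: "'i \<Rightarrow> nat \<Rightarrow> real" and \<mu> \<nu> \<sigma>K :: "'k \<Rightarrow> nat \<Rightarrow> real" and lam :: "nat \<Rightarrow> real"
    and I :: "nat \<Rightarrow> 'i set" and K :: "nat \<Rightarrow> 'k set" and P T :: nat
    and \<pi> :: "'i \<Rightarrow> nat \<Rightarrow> nat" and \<omega> :: "'k \<Rightarrow> nat \<Rightarrow> nat"
    and x a lstar astar pstar :: "nat \<Rightarrow> 'h ^ 'i" and \<xi> :: "nat \<Rightarrow> 'i \<Rightarrow> real"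
    and y z vstar b d e ustar wstar estar qstar tstar :: "nat \<Rightarrow> 'g ^ 'k"
    and \<eta> :: "nat \<Rightarrow> 'k \<Rightarrow> real" and \<Delta> \<theta> :: "nat \<Rightarrow> real"
  \<comment> \<open>problem data\<close>
  assumes "\<forall>i. hilbert_space (H i)" and "\<forall>k. hilbert_space (G k)"
    and "\<forall>i. s i \<in> H i" and "\<forall>k. r k \<in> G k"
    and "\<forall>i. maximally_monotone (H i) (A i)"
    and "\<forall>i. \<alpha>c i > 0 \<and> cocoercive (\<alpha>c i) (H i) (C i)"
    and "\<forall>i. \<alpha>l i \<ge> 0 \<and> monotone_lipschitz (\<alpha>l i) (H i) (Q i)"
    and "\<forall>k. maximally_monotone (G k) (Bm k)"
    and "\<forall>k. \<beta>c k > 0 \<and> cocoercive (\<beta>c k) (G k) (Bc k)"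
    and "\<forall>k. \<beta>l k \<ge> 0 \<and> monotone_lipschitz (\<beta>l k) (G k) (Bl k)"
    and "\<forall>k. maximally_monotone (G k) (Dm k)"
    and "\<forall>k. \<delta>c k > 0 \<and> cocoercive (\<delta>c k) (G k) (Dc k)"
    and "\<forall>k. \<delta>l k \<ge> 0 \<and> monotone_lipschitz (\<delta>l k) (G k) (Dl k)"
    and "\<forall>k i. bounded_linear_between (H i) (G k) (L k i)"
    and "\<kappa> \<ge> 0 \<and> monotone_lipschitz \<kappa> (direct_sum H) R"
  \<comment> \<open>parameters\<close>
    and "\<alpha> = Min (range \<alpha>c \<union> range \<beta>c \<union> range \<delta>c)"
    and "\<sigma> > 0" and "0 < \<epsilon>" and "\<epsilon> < 1" and "\<sigma> > 1 / (4 * \<alpha>)"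
    and "1 / \<epsilon> > Max (range (\<lambda>i. \<alpha>l i + \<kappa> + \<sigma>) \<union> range (\<lambda>k. \<beta>l k + \<sigma>) \<union> range (\<lambda>k. \<delta>l k + \<sigma>))"
    and "\<forall>i n. \<gamma> i n \<in> {\<epsilon> .. 1 / (\<alpha>l i + \<kappa> + \<sigma>)}"
    and "\<forall>k n. \<mu> k n \<in> {\<epsilon> .. 1 / (\<beta>l k + \<sigma>)}"
    and "\<forall>k n. \<nu> k n \<in> {\<epsilon> .. 1 / (\<delta>l k + \<sigma>)}"
    and "\<forall>k n. \<sigma>K k n \<in> {\<epsilon> .. 1 / \<epsilon>}"
    and "\<forall>n. lam n \<in> {\<epsilon> .. 2 - \<epsilon>}"
    and "x 0 \<in> direct_sum H"
    and "y 0 \<in> direct_sum G" and "z 0 \<in> direct_sum G" and "vstar 0 \<in> direct_sum G"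
  \<comment> \<open>block selection and delays\<close>
    and "\<forall>n. I n \<noteq> {}" and "\<forall>n. K n \<noteq> {}" and "I 0 = UNIV" and "K 0 = UNIV"
    and "\<forall>n. (\<Union>j\<in>{n..n+P}. I j) = UNIV" and "\<forall>n. (\<Union>j\<in>{n..n+P}. K j) = UNIV"
    and "\<forall>i n. int n - int T \<le> int (\<pi> i n) \<and> \<pi> i n \<le> n"
    and "\<forall>k n. int n - int T \<le> int (\<omega> k n) \<and> \<omega> k n \<le> n"
  \<comment> \<open>steps 1 and 2\<close>
    and "\<forall>n. \<forall>i\<in>I n. let m = \<pi> i n in
          lstar n $ i = Q i (x m $ i) + R (x m) $ i
            + (\<Sum>k\<in>UNIV. adjoint_from (H i) (L k i) (vstar m $ k))
        \<and> a n $ i = resolvent (H i) (\<gamma> i m) (A i)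
            (x m $ i + \<gamma> i m *\<^sub>R (s i - lstar n $ i - C i (x m $ i)))
        \<and> astar n $ i = inverse (\<gamma> i m) *\<^sub>R (x m $ i - a n $ i) - lstar n $ i + Q i (a n $ i)
        \<and> \<xi> n i = (norm (a n $ i - x m $ i))\<^sup>2"
    and "\<forall>n. \<forall>i\<in>- I n.
          a n $ i = a (n - 1) $ i \<and> astar n $ i = astar (n - 1) $ i \<and> \<xi> n i = \<xi> (n - 1) i"
  \<comment> \<open>steps 3 and 4\<close>
    and "\<forall>n. \<forall>k\<in>K n. let m = \<omega> k n in
          ustar n $ k = vstar m $ k - Bl k (y m $ k)
        \<and> wstar n $ k = vstar m $ k - Dl k (z m $ k)
        \<and> b n $ k = resolvent (G k) (\<mu> k m) (Bm k)
            (y m $ k + \<mu> k m *\<^sub>R (ustar n $ k - Bc k (y m $ k)))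
        \<and> d n $ k = resolvent (G k) (\<nu> k m) (Dm k)
            (z m $ k + \<nu> k m *\<^sub>R (wstar n $ k - Dc k (z m $ k)))
        \<and> estar n $ k =
            \<sigma>K k m *\<^sub>R ((\<Sum>i\<in>UNIV. L k i (x m $ i)) - y m $ k - z m $ k - r k) + vstar m $ k
        \<and> qstar n $ k =
            inverse (\<mu> k m) *\<^sub>R (y m $ k - b n $ k) + ustar n $ k + Bl k (b n $ k) - estar n $ k
        \<and> tstar n $ k =
            inverse (\<nu> k m) *\<^sub>R (z m $ k - d n $ k) + wstar n $ k + Dl k (d n $ k) - estar n $ k
        \<and> \<eta> n k = (norm (b n $ k - y m $ k))\<^sup>2 + (norm (d n $ k - z m $ k))\<^sup>2"
    and "\<forall>n. \<forall>k\<in>- K n.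
          b n $ k = b (n - 1) $ k \<and> d n $ k = d (n - 1) $ k \<and> estar n $ k = estar (n - 1) $ k
        \<and> qstar n $ k = qstar (n - 1) $ k \<and> tstar n $ k = tstar (n - 1) $ k
        \<and> \<eta> n k = \<eta> (n - 1) k"
  \<comment> \<open>step 5\<close>
    and "\<forall>n k. e n $ k = r k + b n $ k + d n $ k - (\<Sum>i\<in>UNIV. L k i (a n $ i))"
    and "\<forall>n i. pstar n $ i =
          astar n $ i + R (a n) $ i + (\<Sum>k\<in>UNIV. adjoint_from (H i) (L k i) (estar n $ k))"
  \<comment> \<open>step 6\<close>
    and "\<forall>n. \<Delta> n = - inverse (4 * \<alpha>) * ((\<Sum>i\<in>UNIV. \<xi> n i) + (\<Sum>k\<in>UNIV. \<eta> n k))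
          + (\<Sum>i\<in>UNIV. inner (x n $ i - a n $ i) (pstar n $ i))
          + (\<Sum>k\<in>UNIV. inner (y n $ k - b n $ k) (qstar n $ k)
               + inner (z n $ k - d n $ k) (tstar n $ k)
               + inner (e n $ k) (vstar n $ k - estar n $ k))"
  \<comment> \<open>step 7\<close>
    and "\<forall>n. \<Delta> n > 0 \<longrightarrow>
          \<theta> n = lam n * \<Delta> n /
            ((\<Sum>i\<in>UNIV. (norm (pstar n $ i))\<^sup>2)
             + (\<Sum>k\<in>UNIV. (norm (qstar n $ k))\<^sup>2 + (norm (tstar n $ k))\<^sup>2 + (norm (e n $ k))\<^sup>2))
        \<and> (\<forall>i. x (Suc n) $ i = x n $ i - \<theta> n *\<^sub>R pstar n $ i)
        \<and> (\<forall>k. y (Suc n) $ k = y n $ k - \<theta> n *\<^sub>R qstar n $ k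
             \<and> z (Suc n) $ k = z n $ k - \<theta> n *\<^sub>R tstar n $ k
             \<and> vstar (Suc n) $ k = vstar n $ k - \<theta> n *\<^sub>R e n $ k)"
    and "\<forall>n. \<not> \<Delta> n > 0 \<longrightarrow>
          (\<forall>i. x (Suc n) $ i = x n $ i)
        \<and> (\<forall>k. y (Suc n) $ k = y n $ k \<and> z (Suc n) $ k = z n $ k
             \<and> vstar (Suc n) $ k = vstar n $ k)"
  \<comment> \<open>the dual inclusion has a solution\<close>
    and "dual_solutions H G s r A C Q R Bm Bc Bl Dm Dc Dl L \<noteq> {}"
  shows "(\<forall>i. summable (\<lambda>n. (norm (x (Suc n) $ i - x n $ i))\<^sup>2))
    \<and> (\<forall>k. summable (\<lambda>n. (norm (y (Suc n) $ k - y n $ k))\<^sup>2)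
         \<and> summable (\<lambda>n. (norm (z (Suc n) $ k - z n $ k))\<^sup>2)
         \<and> summable (\<lambda>n. (norm (vstar (Suc n) $ k - vstar n $ k))\<^sup>2))
    \<and> (\<forall>i k. (\<lambda>n. x n $ i - a n $ i) \<longlonglongrightarrow> 0
         \<and> (\<lambda>n. y n $ k - b n $ k) \<longlonglongrightarrow> 0
         \<and> (\<lambda>n. z n $ k - d n $ k) \<longlonglongrightarrow> 0
         \<and> (\<lambda>n. vstar n $ k - estar n $ k) \<longlonglongrightarrow> 0)
    \<and> (\<exists>xbar \<in> primal_solutions H G s r A C Q R Bm Bc Bl Dm Dc Dl L.
       \<exists>vbar \<in> dual_solutions H G s r A C Q R Bm Bc Bl Dm Dc Dl L.
         (\<forall>i k. weakly_converges_in (H i) (\<lambda>n. x n $ i) (xbar $ i)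
              \<and> weakly_converges_in (H i) (\<lambda>n. a n $ i) (xbar $ i)
              \<and> weakly_converges_in (G k) (\<lambda>n. vstar n $ k) (vbar $ k))
       \<and> (xbar, vbar) \<in> kuhn_tucker_set H G s r A C Q R Bm Bc Bl Dm Dc Dl L)"
proof -
  have \<alpha>_le: "\<alpha> \<le> \<alpha>c i" "\<alpha> \<le> \<beta>c k" "\<alpha> \<le> \<delta>c k" for i k
    unfolding assms(16) by (auto intro!: Min_le)
  have \<alpha>_pos: "0 < \<alpha>"
    unfolding assms(16) using assms(6,9,12) by (subst Min_gr_iff) auto
  interpret saddle_problem H G s r A C Q R Bm Bc Bl Dm Dc Dl L \<alpha>l \<beta>l \<delta>l \<kappa> \<alpha>
  proof
    show "cocoercive \<alpha> (H i) (C i)" for i by (rule cocoercive_mono[OF conjunct2[OF spec[OF assms(6)]] \<alpha>_le(1)])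
    show "cocoercive \<alpha> (G k) (Bc k)" for k by (rule cocoercive_mono[OF conjunct2[OF spec[OF assms(9)]] \<alpha>_le(2)])
    show "cocoercive \<alpha> (G k) (Dc k)" for k by (rule cocoercive_mono[OF conjunct2[OF spec[OF assms(12)]] \<alpha>_le(3)])
  qed (rule assms(1-5,8,11)[THEN spec] assms(7,10,13)[THEN spec, THEN conjunct2] assms(14)[THEN spec, THEN spec]
      conjunct2[OF assms(15)] \<alpha>_pos)+
  obtain l where l: "\<And>i n. l i n \<le> n" "\<And>i n. n \<le> l i n + P" "\<And>i n. i \<in> I (l i n)"
    "\<And>i n m. l i n < m \<Longrightarrow> m \<le> n \<Longrightarrow> i \<notin> I m"
    using last_activation[OF assms(33) assms(35)] by blast
  obtain l' where l': "\<And>k n. l' k n \<le> n" "\<And>k n. n \<le> l' k n + P" "\<And>k n. k \<in> K (l' k n)"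
    "\<And>k n m. l' k n < m \<Longrightarrow> m \<le> n \<Longrightarrow> k \<notin> K m"
    using last_activation[OF assms(34) assms(36)] by blast
  \<comment> \<open>The quantities of index \<open>i\<close> at time \<open>n\<close> were computed at time \<open>l i n\<close> from data of time \<open>\<pi> i (l i n)\<close>.\<close>
  define \<tau> where "\<tau> i n = \<pi> i (l i n)" for i n
  define \<tau>' where "\<tau>' k n = \<omega> k (l' k n)" for k n
  define w where "w n = (x n, y n, z n, vstar n)" for n
  define c where "c n = (a n, b n, d n, estar n)" for n
  define t where "t n = (pstar n, qstar n, tstar n, e n)" for n
  define delayed where "delayed n = (\<chi> i. px (w (\<tau> i n)) $ i, \<chi> k. py (w (\<tau>' k n)) $ k, \<chi> k. pz (w (\<tau>' k n)) $ k, pv (c n))" for n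
  have frozen_I: "a n $ i = a (l i n) $ i" "astar n $ i = astar (l i n) $ i" "\<xi> n i = \<xi> (l i n) i" for i n
  proof -
    have upd: "a m $ i = a (m - 1) $ i" "astar m $ i = astar (m - 1) $ i" "\<xi> m i = \<xi> (m - 1) i" if "l i n < m" "m \<le> n" for m
      using assms(40)[THEN spec, THEN bspec, OF iffD2[OF Compl_iff l(4)[OF that]]] by - (elim conjE, assumption)+
    show "a n $ i = a (l i n) $ i" "astar n $ i = astar (l i n) $ i" "\<xi> n i = \<xi> (l i n) i"
      by (rule frozen_since[of "l i n" n "\<lambda>n. a n $ i", OF upd(1) l(1)]
          frozen_since[of "l i n" n "\<lambda>n. astar n $ i", OF upd(2) l(1)]
          frozen_since[of "l i n" n "\<lambda>n. \<xi> n i", OF upd(3) l(1)]; assumption)+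
  qed
  have frozen_K: "b n $ k = b (l' k n) $ k" "d n $ k = d (l' k n) $ k" "estar n $ k = estar (l' k n) $ k"
    "qstar n $ k = qstar (l' k n) $ k" "tstar n $ k = tstar (l' k n) $ k" "\<eta> n k = \<eta> (l' k n) k" for k n
  proof -
    have upd: "b m $ k = b (m - 1) $ k" "d m $ k = d (m - 1) $ k" "estar m $ k = estar (m - 1) $ k" "qstar m $ k = qstar (m - 1) $ k" "tstar m $ k = tstar (m - 1) $ k" "\<eta> m k = \<eta> (m - 1) k" if "l' k n < m" "m \<le> n" for m
      using assms(42)[THEN spec, THEN bspec, OF iffD2[OF Compl_iff l'(4)[OF that]]] by - (elim conjE, assumption)+
    show "b n $ k = b (l' k n) $ k" "d n $ k = d (l' k n) $ k" "estar n $ k = estar (l' k n) $ k" "qstar n $ k = qstar (l' k n) $ k" "tstar n $ k = tstar (l' k n) $ k" "\<eta> n k = \<eta> (l' k n) k"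
      by (rule frozen_since[of "l' k n" n "\<lambda>n. b n $ k", OF upd(1) l'(1)]
          frozen_since[of "l' k n" n "\<lambda>n. d n $ k", OF upd(2) l'(1)]
          frozen_since[of "l' k n" n "\<lambda>n. estar n $ k", OF upd(3) l'(1)]
          frozen_since[of "l' k n" n "\<lambda>n. qstar n $ k", OF upd(4) l'(1)]
          frozen_since[of "l' k n" n "\<lambda>n. tstar n $ k", OF upd(5) l'(1)]
          frozen_since[of "l' k n" n "\<lambda>n. \<eta> n k", OF upd(6) l'(1)]; assumption)+
  qed
  have proj: "px (w n) = x n" "py (w n) = y n" "pz (w n) = z n" "pv (w n) = vstar n"
    "px (c n) = a n" "py (c n) = b n" "pz (c n) = d n" "pv (c n) = estar n"
    "px (t n) = pstar n" "py (t n) = qstar n" "pz (t n) = tstar n" "pv (t n) = e n" for n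
    by (simp_all add: w_def c_def t_def)
  have F_x: "px (F (w m)) $ i = Q i (x m $ i) + R (x m) $ i + (\<Sum>k\<in>UNIV. L_adj k i (vstar m $ k)) - s i"
    and F_y: "py (F (w m)) $ k = Bl k (y m $ k) - vstar m $ k"
    and F_z: "pz (F (w m)) $ k = Dl k (z m $ k) - vstar m $ k"
    and F_v: "pv (F (w m)) $ k = r k + y m $ k + z m $ k - (\<Sum>i\<in>UNIV. L k i (x m $ i))" for m i k
    by (simp_all add: F_def w_def)
  have Fc_x: "px (F (c n)) $ i = Q i (a n $ i) + R (a n) $ i + (\<Sum>k\<in>UNIV. L_adj k i (estar n $ k)) - s i"
    and Fc_y: "py (F (c n)) $ k = Bl k (b n $ k) - estar n $ k"
    and Fc_z: "pz (F (c n)) $ k = Dl k (d n $ k) - estar n $ k"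
    and Fc_v: "pv (F (c n)) $ k = r k + b n $ k + d n $ k - (\<Sum>i\<in>UNIV. L k i (a n $ i))" for n i k
    by (simp_all add: F_def c_def)
  have block_I: "lstar (l i n) $ i = Q i (x (\<tau> i n) $ i) + R (x (\<tau> i n)) $ i + (\<Sum>k\<in>UNIV. L_adj k i (vstar (\<tau> i n) $ k))"
    "a (l i n) $ i = resolvent (H i) (\<gamma> i (\<tau> i n)) (A i)
            (x (\<tau> i n) $ i + \<gamma> i (\<tau> i n) *\<^sub>R (s i - lstar (l i n) $ i - C i (x (\<tau> i n) $ i)))"
    "astar (l i n) $ i = inverse (\<gamma> i (\<tau> i n)) *\<^sub>R (x (\<tau> i n) $ i - a (l i n) $ i) - lstar (l i n) $ i + Q i (a (l i n) $ i)"
    "\<xi> (l i n) i = (norm (a (l i n) $ i - x (\<tau> i n) $ i))\<^sup>2" for i n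
    using assms(39)[THEN spec, THEN bspec, OF l(3)[of i n]] unfolding Let_def \<tau>_def by - (elim conjE, assumption)+
  have block_K: "ustar (l' k n) $ k = vstar (\<tau>' k n) $ k - Bl k (y (\<tau>' k n) $ k)"
    "wstar (l' k n) $ k = vstar (\<tau>' k n) $ k - Dl k (z (\<tau>' k n) $ k)"
    "b (l' k n) $ k = resolvent (G k) (\<mu> k (\<tau>' k n)) (Bm k)
            (y (\<tau>' k n) $ k + \<mu> k (\<tau>' k n) *\<^sub>R (ustar (l' k n) $ k - Bc k (y (\<tau>' k n) $ k)))"
    "d (l' k n) $ k = resolvent (G k) (\<nu> k (\<tau>' k n)) (Dm k)
            (z (\<tau>' k n) $ k + \<nu> k (\<tau>' k n) *\<^sub>R (wstar (l' k n) $ k - Dc k (z (\<tau>' k n) $ k)))"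
    "estar (l' k n) $ k =
            \<sigma>K k (\<tau>' k n) *\<^sub>R ((\<Sum>i\<in>UNIV. L k i (x (\<tau>' k n) $ i)) - y (\<tau>' k n) $ k - z (\<tau>' k n) $ k - r k) + vstar (\<tau>' k n) $ k"
    "qstar (l' k n) $ k =
            inverse (\<mu> k (\<tau>' k n)) *\<^sub>R (y (\<tau>' k n) $ k - b (l' k n) $ k) + ustar (l' k n) $ k + Bl k (b (l' k n) $ k) - estar (l' k n) $ k"
    "tstar (l' k n) $ k =
            inverse (\<nu> k (\<tau>' k n)) *\<^sub>R (z (\<tau>' k n) $ k - d (l' k n) $ k) + wstar (l' k n) $ k + Dl k (d (l' k n) $ k) - estar (l' k n) $ k"
    "\<eta> (l' k n) k = (norm (b (l' k n) $ k - y (\<tau>' k n) $ k))\<^sup>2 + (norm (d (l' k n) $ k - z (\<tau>' k n) $ k))\<^sup>2" for k n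
    using assms(41)[THEN spec, THEN bspec, OF l'(3)[of k n]] unfolding Let_def \<tau>'_def by - (elim conjE, assumption)+
  have bounds: "\<epsilon> \<le> \<gamma> i n" "\<gamma> i n \<le> 1 / (\<alpha>l i + \<kappa> + \<sigma>)" "\<epsilon> \<le> \<mu> k n" "\<mu> k n \<le> 1 / (\<beta>l k + \<sigma>)"
    "\<epsilon> \<le> \<nu> k n" "\<nu> k n \<le> 1 / (\<delta>l k + \<sigma>)" "\<epsilon> \<le> \<sigma>K k n" "\<sigma>K k n \<le> 1 / \<epsilon>" "\<epsilon> \<le> lam n" "lam n \<le> 2 - \<epsilon>" for i k n
    using assms(22-25)[THEN spec, THEN spec] assms(26)[THEN spec] by (simp_all only: atLeastAtMost_iff)
  have pos: "0 < \<gamma> i n" "0 < \<mu> k n" "0 < \<nu> k n" "0 < \<alpha>l i + \<kappa> + \<sigma>" "0 < \<beta>l k + \<sigma>" "0 < \<delta>l k + \<sigma>" for i k n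
  proof -
    show "0 < \<gamma> i n" "0 < \<mu> k n" "0 < \<nu> k n"
      by (rule less_le_trans[OF assms(18)], rule bounds)+
    have "0 \<le> \<alpha>l i" "0 \<le> \<beta>l k" "0 \<le> \<delta>l k" "0 \<le> \<kappa>" using assms(7,10,13,15) by blast+
    then show "0 < \<alpha>l i + \<kappa> + \<sigma>" "0 < \<beta>l k + \<sigma>" "0 < \<delta>l k + \<sigma>" using assms(17) by linarith+
  qed
  interpret delayed_block_iteration H G s r A C Q R Bm Bc Bl Dm Dc Dl L \<alpha>l \<beta>l \<delta>l \<kappa> \<alpha>
    \<sigma> \<epsilon> \<gamma> \<mu> \<nu> \<sigma>K lam "P + T" \<tau> \<tau>' w c t delayed \<Delta>
  proof
    show "\<alpha>l i + \<kappa> + \<sigma> \<le> inverse (\<gamma> i n)" for i n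
      by (rule inverse_ge_of_le_divide[OF pos(1) pos(4) bounds(2)])
    show "\<beta>l k + \<sigma> \<le> inverse (\<mu> k n)" for k n
      by (rule inverse_ge_of_le_divide[OF pos(2) pos(5) bounds(4)])
    show "\<delta>l k + \<sigma> \<le> inverse (\<nu> k n)" for k n
      by (rule inverse_ge_of_le_divide[OF pos(3) pos(6) bounds(6)])
    show "\<tau> i n \<le> n" "n \<le> \<tau> i n + (P + T)" for i n
      using assms(37)[rule_format, of "l i n" i] l(1)[of i n] l(2)[of n i] by (auto simp: \<tau>_def)
    show "\<tau>' k n \<le> n" "n \<le> \<tau>' k n + (P + T)" for k n
      using assms(38)[rule_format, of "l' k n" k] l'(1)[of k n] l'(2)[of n k] by (auto simp: \<tau>'_def)
    show "w 0 \<in> W" using assms(27-30) by (simp add: W_def w_def)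
    show "px (c n) $ i = resolvent (H i) (\<gamma> i (\<tau> i n)) (A i)
      (px (w (\<tau> i n)) $ i + \<gamma> i (\<tau> i n) *\<^sub>R (- px (F (w (\<tau> i n))) $ i - C i (px (w (\<tau> i n)) $ i)))" for i n
      unfolding F_x proj frozen_I(1)[of n] block_I(2) block_I(1) by (simp only: minus_diff_eq)
    show "py (c n) $ k = resolvent (G k) (\<mu> k (\<tau>' k n)) (Bm k)
      (py (w (\<tau>' k n)) $ k + \<mu> k (\<tau>' k n) *\<^sub>R (- py (F (w (\<tau>' k n))) $ k - Bc k (py (w (\<tau>' k n)) $ k)))" for k n
      unfolding F_y proj frozen_K(1)[of n] block_K(3) block_K(1) by (simp only: minus_diff_eq)
    show "pz (c n) $ k = resolvent (G k) (\<nu> k (\<tau>' k n)) (Dm k)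
      (pz (w (\<tau>' k n)) $ k + \<nu> k (\<tau>' k n) *\<^sub>R (- pz (F (w (\<tau>' k n))) $ k - Dc k (pz (w (\<tau>' k n)) $ k)))" for k n
      unfolding F_z proj frozen_K(2)[of n] block_K(4) block_K(2) by (simp only: minus_diff_eq)
    show "pv (c n) $ k = pv (w (\<tau>' k n)) $ k - \<sigma>K k (\<tau>' k n) *\<^sub>R pv (F (w (\<tau>' k n))) $ k" for k n
      unfolding F_v proj frozen_K(3)[of n] block_K(5) by (simp add: algebra_simps)
    show "px (t n) $ i = inverse (\<gamma> i (\<tau> i n)) *\<^sub>R (px (w (\<tau> i n)) $ i - px (c n) $ i)
      - px (F (w (\<tau> i n))) $ i + px (F (c n)) $ i" for i n
    proof -
      have "astar n $ i = inverse (\<gamma> i (\<tau> i n)) *\<^sub>R (x (\<tau> i n) $ i - a n $ i) - (Q i (x (\<tau> i n) $ i) + R (x (\<tau> i n)) $ i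
          + (\<Sum>k\<in>UNIV. L_adj k i (vstar (\<tau> i n) $ k))) + Q i (a n $ i)"
        unfolding frozen_I(1,2)[of n] block_I(3) block_I(1) ..
      then show ?thesis
        unfolding F_x Fc_x proj assms(44)[THEN spec, THEN spec, of n i] by simp
    qed
    show "py (t n) $ k = inverse (\<mu> k (\<tau>' k n)) *\<^sub>R (py (w (\<tau>' k n)) $ k - py (c n) $ k)
      - py (F (w (\<tau>' k n))) $ k + py (F (c n)) $ k" for k n
      unfolding F_y Fc_y proj frozen_K(1,3,4)[of n] block_K(6) block_K(1) by simp
    show "pz (t n) $ k = inverse (\<nu> k (\<tau>' k n)) *\<^sub>R (pz (w (\<tau>' k n)) $ k - pz (c n) $ k)
      - pz (F (w (\<tau>' k n))) $ k + pz (F (c n)) $ k" for k n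
      unfolding F_z Fc_z proj frozen_K(2,3,5)[of n] block_K(7) block_K(2) by simp
    show "pv (t n) = pv (F (c n))" for n
      unfolding vec_eq_iff Fc_v proj using assms(43) by blast
    \<comment> \<open>The recorded residuals add up to the squared distance of \<open>c\<close> to the delayed point.\<close>
    show "\<Delta> n = inner (w n - c n) (t n) - (norm (c n - delayed n))\<^sup>2 / (4 * \<alpha>)" for n
    proof -
      have \<xi>: "\<xi> n i = inner (a n $ i - x (\<tau> i n) $ i) (a n $ i - x (\<tau> i n) $ i)" for i
        unfolding frozen_I(1,3)[of n] block_I(4) power2_norm_eq_inner ..
      have \<eta>: "\<eta> n k = inner (b n $ k - y (\<tau>' k n) $ k) (b n $ k - y (\<tau>' k n) $ k)
          + inner (d n $ k - z (\<tau>' k n) $ k) (d n $ k - z (\<tau>' k n) $ k)" for k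
        unfolding frozen_K(1,2,6)[of n] block_K(8) power2_norm_eq_inner ..
      have "(norm (c n - delayed n))\<^sup>2 = (\<Sum>i\<in>UNIV. \<xi> n i) + (\<Sum>k\<in>UNIV. \<eta> n k)"
        by (simp add: power2_norm_eq_inner inner_prod_def inner_vec_def \<xi> \<eta> c_def w_def delayed_def sum.distrib)
      moreover have "inner (w n - c n) (t n) = (\<Sum>i\<in>UNIV. inner (x n $ i - a n $ i) (pstar n $ i))
          + (\<Sum>k\<in>UNIV. inner (y n $ k - b n $ k) (qstar n $ k)
               + inner (z n $ k - d n $ k) (tstar n $ k)
               + inner (e n $ k) (vstar n $ k - estar n $ k))"
        by (simp add: inner_prod_def inner_vec_def w_def c_def t_def sum.distrib inner_commute[of "e n $ _"])
      moreover have "- inverse u * X + a + b = (a + b) - X / u" for u X a b :: real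
        by (simp add: divide_inverse mult.commute)
      ultimately show ?thesis using assms(45)[THEN spec, of n] by (simp only:)
    qed
    show "w (Suc n) = w n - (lam n * \<Delta> n / (norm (t n))\<^sup>2) *\<^sub>R t n" if "0 < \<Delta> n" for n
    proof -
      have "(norm (t n))\<^sup>2 = (\<Sum>i\<in>UNIV. (norm (pstar n $ i))\<^sup>2)
             + (\<Sum>k\<in>UNIV. (norm (qstar n $ k))\<^sup>2 + (norm (tstar n $ k))\<^sup>2 + (norm (e n $ k))\<^sup>2)"
        by (simp add: power2_norm_eq_inner inner_prod_def inner_vec_def t_def sum.distrib)
      then have \<theta>: "\<theta> n = lam n * \<Delta> n / (norm (t n))\<^sup>2"
        using assms(46)[rule_format, OF that] by simp
      show ?thesis
        unfolding \<theta>[symmetric] using assms(46)[rule_format, OF that] by (simp add: w_def t_def vec_eq_iff)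
    qed
    show "w (Suc n) = w n" if "\<not> 0 < \<Delta> n" for n
      using assms(47)[rule_format, OF that] by (simp add: w_def vec_eq_iff)
    show "Z \<noteq> {}" using assms(48) dual_solution_imp_Z by blast
  qed (rule delayed_def assms(18-20) bounds)+
  have summable_part: "summable (\<lambda>n. (norm (f n))\<^sup>2)" if "\<And>n. norm (f n) \<le> norm (w (Suc n) - w n)" for f :: "nat \<Rightarrow> 'z::real_normed_vector"
    by (rule summable_comparison_test'[OF increments_summable, of 0]) (simp add: that power_mono)
  have inc: "summable (\<lambda>n. (norm (x (Suc n) $ i - x n $ i))\<^sup>2)" "summable (\<lambda>n. (norm (y (Suc n) $ k - y n $ k))\<^sup>2)"
    "summable (\<lambda>n. (norm (z (Suc n) $ k - z n $ k))\<^sup>2)" "summable (\<lambda>n. (norm (vstar (Suc n) $ k - vstar n $ k))\<^sup>2)" for i k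
  proof -
    have *: "norm (px (w (Suc n) - w n) $ i) \<le> norm (w (Suc n) - w n)" "norm (py (w (Suc n) - w n) $ k) \<le> norm (w (Suc n) - w n)"
      "norm (pz (w (Suc n) - w n) $ k) \<le> norm (w (Suc n) - w n)" "norm (pv (w (Suc n) - w n) $ k) \<le> norm (w (Suc n) - w n)" for n
      by (rule norm_component_le)+
    from summable_part[OF *(1)] summable_part[OF *(2)] summable_part[OF *(3)] summable_part[OF *(4)]
    show "summable (\<lambda>n. (norm (x (Suc n) $ i - x n $ i))\<^sup>2)" "summable (\<lambda>n. (norm (y (Suc n) $ k - y n $ k))\<^sup>2)"
      "summable (\<lambda>n. (norm (z (Suc n) $ k - z n $ k))\<^sup>2)" "summable (\<lambda>n. (norm (vstar (Suc n) $ k - vstar n $ k))\<^sup>2)"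
      by (simp_all add: w_def)
  qed
  have lim: "(\<lambda>n. x n $ i - a n $ i) \<longlonglongrightarrow> 0" "(\<lambda>n. y n $ k - b n $ k) \<longlonglongrightarrow> 0"
    "(\<lambda>n. z n $ k - d n $ k) \<longlonglongrightarrow> 0" "(\<lambda>n. vstar n $ k - estar n $ k) \<longlonglongrightarrow> 0" for i k
    using component_vanishes[OF w_c_vanishes] by (simp_all add: w_def c_def)
  obtain zb where zb: "zb \<in> Z" and weak: "weakly_converges_in W w zb" by (rule weak_limit)
  have weak_x: "weakly_converges_in (H i) (\<lambda>n. x n $ i) (px zb $ i)" for i
    unfolding weakly_converges_in_def
  proof
    fix u assume "u \<in> H i"
    then have "(axis i u, 0, 0, 0) \<in> W" by (auto simp: mem_W_iff axis_def subspaces subspace_0)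
    from weak[unfolded weakly_converges_in_def, rule_format, OF this]
    show "(\<lambda>n. inner (x n $ i) u) \<longlonglongrightarrow> inner (px zb $ i) u" by (simp add: inner_single_component w_def)
  qed
  have weak_a: "weakly_converges_in (H i) (\<lambda>n. a n $ i) (px zb $ i)" for i
    unfolding weakly_converges_in_def
  proof
    fix u assume "u \<in> H i"
    have 1: "(\<lambda>n. inner (x n $ i) u) \<longlonglongrightarrow> inner (px zb $ i) u"
      using weak_x[of i, unfolded weakly_converges_in_def] \<open>u \<in> H i\<close> by (rule bspec)
    have 2: "(\<lambda>n. inner (x n $ i - a n $ i) u) \<longlonglongrightarrow> inner 0 u"
      by (rule tendsto_inner[OF lim(1) tendsto_const])
    from tendsto_diff[OF 1 2]
    show "(\<lambda>n. inner (a n $ i) u) \<longlonglongrightarrow> inner (px zb $ i) u" by (simp add: inner_diff_left)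
  qed
  have weak_v: "weakly_converges_in (G k) (\<lambda>n. vstar n $ k) (pv zb $ k)" for k
    unfolding weakly_converges_in_def
  proof
    fix u assume "u \<in> G k"
    then have "(0, 0, 0, axis k u) \<in> W" by (auto simp: mem_W_iff axis_def subspaces subspace_0)
    from weak[unfolded weakly_converges_in_def, rule_format, OF this]
    show "(\<lambda>n. inner (vstar n $ k) u) \<longlonglongrightarrow> inner (pv zb $ k) u" by (simp add: inner_single_component w_def)
  qed
  show ?thesis
  proof (intro conjI allI bexI)
    show "(px zb, pv zb) \<in> KT" by (rule Z_imp_solutions(1)[OF zb])
    show "pv zb \<in> dual_solutions H G s r A C Q R Bm Bc Bl Dm Dc Dl L" by (rule Z_imp_solutions(2)[OF zb])
    show "px zb \<in> primal_solutions H G s r A C Q R Bm Bc Bl Dm Dc Dl L" by (rule Z_imp_solutions(3)[OF zb])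
  qed (rule inc lim weak_x weak_a weak_v)+
qed

end
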